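(* Let $d\ge1$ be an integer and let $S=\{(\omega,\xi)\in\mathbb{R}\times\mathbb{R}^d : \omega=-|\xi|^2\}$ be the paraboloid in $\mathbb{R}^{d+1}$. Let $p,q\ge1$ be exponents (in $[1,\infty]$) satisfying $\frac2p+\frac dq=1$. Assume that there exist $\alpha\ge1$ (in $[1,\infty]$) and $C>0$ such that for all Schwartz functions $W$ on $\mathbb{R}\times\mathbb{R}^d$ one has $$\big\|\overline{W}\,T_S\,W\big\|_{\mathfrak{S}^\alpha(L^2(\mathbb{R}^{d+1}))}\le C\,\|W\|_{L^p_tL^q_x(\mathbb{R}\times\mathbb{R}^d)}^2 .$$ Then $\alpha\ge \frac{q}{q-d}$.
   Context: The paraboloid $S$ is endowed with the measure obtained by pushing forward the Lebesgue measure of $\mathbb{R}^d$ under $\xi\mapsto(-|\xi|^2,\xi)$, so that $L^2(S)\simeq L^2(\mathbb{R}^d)$ isometrically. The restriction operator $\mathcal{R}_S$ sends a function $F(t,x)$ on $\mathbb{R}\times\mathbb{R}^d$ to the restriction of its space-time Fourier transform to $S$: $$(\mathcal{R}_SF)(\xi)=\int_{\mathbb{R}}\int_{\mathbb{R}^d}e^{-i(x\cdot\xi-t|\xi|^2)}F(t,x)\,dx\,dt .$$ Its formal adjoint is $((\mathcal{R}_S)^*g)(t,x)=\int_{\mathbb{R}^d}e^{i(x\cdot\xi-t|\xi|^2)}g(\xi)\,d\xi$, and $T_S:=(\mathcal{R}_S)^*\mathcal{R}_S$; equivalently, up to a positive constant depending only on $d$ and the normalization of the Fourier transform, $(T_SF)(t,\cdot)=\int_{\mathbb{R}}e^{i(t-s)\Delta_x}F(s,\cdot)\,ds$.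 The functions $W$ and $\overline{W}$ (complex conjugate) are viewed as multiplication operators, so $\overline{W}T_SW$ denotes $F\mapsto\overline{W}\,T_S(WF)$, i.e. $\overline{W}T_SW=(\mathcal{R}_SW)^*(\mathcal{R}_SW)$ on $L^2(\mathbb{R}^{d+1})$, where $\mathcal{R}_SW:F\mapsto\mathcal{R}_S(WF)$ maps $L^2(\mathbb{R}^{d+1})$ to $L^2(\mathbb{R}^d)$. For $1\le\alpha<\infty$, $\mathfrak{S}^\alpha(\mathfrak{H})$ is the Schatten class of compact operators $A$ on the Hilbert space $\mathfrak{H}$ whose sequence of singular values $(\mu_n(A))$ lies in $\ell^\alpha$, with $\|A\|_{\mathfrak{S}^\alpha}=\|(\mu_n(A))\|_{\ell^\alpha}$; for $\alpha=\infty$ the norm is the operator norm. The mixed norm is $\|W\|_{L^p_tL^q_x}=\big\|\,\|W(t,\cdot)\|_{L^q_x(\mathbb{R}^d)}\big\|_{L^p_t(\mathbb{R})}$. Conventions: the relation $\frac2p+\frac dq=1$ forces $q\ge d$; $\frac{q}{q-d}$ is read as $\infty$ when $q=d$ (i.e. $p=\infty$) and as $1$ when $q=\infty$. *)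

theory Defs
  imports "HOL-Analysis.Analysis" "HOL-Probability.Essential_Supremum"
begin

section \<open>Lebesgue norms with exponent in [1,\<infinity>]\<close>

text \<open>Real powers on the extended half line; used for strictly positive exponents only.\<close>

definition ennreal_powr :: "ennreal \<Rightarrow> real \<Rightarrow> ennreal" where
  "ennreal_powr u r = (if u = \<infinity> then \<infinity> else ennreal (enn2real u powr r))"

definition Lp_norm :: "ennreal \<Rightarrow> 'a measure \<Rightarrow> ('a \<Rightarrow> ennreal) \<Rightarrow> ennreal" where
  "Lp_norm p M u =
     (if p = \<infinity> then esssup M u
      else ennreal_powr (\<integral>\<^sup>+ x. ennreal_powr (u x) (enn2real p) \<partial>M) (1 / enn2real p))"

definition mixed_norm ::
    "ennreal \<Rightarrow> ennreal \<Rightarrow> (real \<times> (real ^ 'n) \<Rightarrow> complex) \<Rightarrow> ennreal" where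
  "mixed_norm p q W =
     Lp_norm p lborel (\<lambda>t. Lp_norm q lborel (\<lambda>x. ennreal (norm (W (t, x)))))"

section \<open>Schwartz functions\<close>

definition dir_deriv ::
    "'a::euclidean_space \<Rightarrow> ('a \<Rightarrow> complex) \<Rightarrow> 'a \<Rightarrow> complex" where
  "dir_deriv v f = (\<lambda>z. frechet_derivative f (at z) v)"

text \<open>All iterated partial derivatives exist, are differentiable (so that the function is
  smooth), and decay faster than any power.\<close>

definition schwartz :: "('a::euclidean_space \<Rightarrow> complex) \<Rightarrow> bool" where
  "schwartz f \<longleftrightarrow>
     (\<forall>vs. set vs \<subseteq> Basis \<longrightarrow>
        (\<forall>z. fold dir_deriv vs f differentiable (at z)) \<and>
        (\<forall>k::nat. bounded (range (\<lambda>z. norm z ^ k *\<^sub>R fold dir_deriv vs f z))))"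

section \<open>Operators on complex L2 spaces\<close>

text \<open>Elements of the Hilbert space are represented by square integrable functions, equality
  being equality almost everywhere; operators act on representatives.\<close>

definition l2_norm :: "'a measure \<Rightarrow> ('a \<Rightarrow> complex) \<Rightarrow> ennreal" where
  "l2_norm M f = Lp_norm 2 M (\<lambda>x. ennreal (norm (f x)))"

definition L2 :: "'a measure \<Rightarrow> ('a \<Rightarrow> complex) set" where
  "L2 M = {f \<in> borel_measurable M. l2_norm M f < \<infinity>}"

definition l2_inner :: "'a measure \<Rightarrow> ('a \<Rightarrow> complex) \<Rightarrow> ('a \<Rightarrow> complex) \<Rightarrow> complex" where
  "l2_inner M f g = (\<integral>x. cnj (f x) * g x \<partial>M)"

definition l2_linear ::
    "'a measure \<Rightarrow> 'b measure \<Rightarrow> (('a \<Rightarrow> complex) \<Rightarrow> 'b \<Rightarrow> complex) \<Rightarrow> bool" where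
  "l2_linear M N A \<longleftrightarrow>
     (\<forall>f\<in>L2 M. A f \<in> L2 N) \<and>
     (\<forall>f\<in>L2 M. \<forall>g\<in>L2 M. (AE x in M. f x = g x) \<longrightarrow> (AE y in N. A f y = A g y)) \<and>
     (\<forall>f\<in>L2 M. \<forall>g\<in>L2 M. \<forall>a b.
        AE y in N. A (\<lambda>x. a * f x + b * g x) y = a * A f y + b * A g y)"

definition l2_compact :: "'a measure \<Rightarrow> (('a \<Rightarrow> complex) \<Rightarrow> 'a \<Rightarrow> complex) \<Rightarrow> bool" where
  "l2_compact M A \<longleftrightarrow>
     l2_linear M M A \<and>
     (\<forall>f. (\<forall>n::nat. f n \<in> L2 M \<and> l2_norm M (f n) \<le> 1) \<longrightarrow>
        (\<exists>g\<in>L2 M. \<exists>r::nat \<Rightarrow> nat. strict_mono r \<and>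
           (\<lambda>n. l2_norm M (\<lambda>x. A (f (r n)) x - g x)) \<longlonglongrightarrow> 0))"

definition is_l2_adjoint ::
    "'a measure \<Rightarrow> 'b measure \<Rightarrow> (('a \<Rightarrow> complex) \<Rightarrow> 'b \<Rightarrow> complex) \<Rightarrow>
     (('b \<Rightarrow> complex) \<Rightarrow> 'a \<Rightarrow> complex) \<Rightarrow> bool" where
  "is_l2_adjoint M N A B \<longleftrightarrow>
     (\<forall>g\<in>L2 N. B g \<in> L2 M) \<and>
     (\<forall>f\<in>L2 M. \<forall>g\<in>L2 N. l2_inner N (A f) g = l2_inner M f (B g))"

text \<open>For a bounded operator between L2 spaces of sigma-finite measures the adjoint exists and
  is unique up to equality almost everywhere, so the choice only picks representatives.\<close>

definition l2_adjoint ::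
    "'a measure \<Rightarrow> 'b measure \<Rightarrow> (('a \<Rightarrow> complex) \<Rightarrow> 'b \<Rightarrow> complex) \<Rightarrow>
     (('b \<Rightarrow> complex) \<Rightarrow> 'a \<Rightarrow> complex)" where
  "l2_adjoint M N A = (SOME B. is_l2_adjoint M N A B)"

section \<open>Singular values and Schatten norms\<close>

text \<open>A subspace has complex dimension \<open>k\<close> if it has an orthonormal basis with \<open>k\<close> elements.\<close>

definition l2_has_dim :: "'a measure \<Rightarrow> ('a \<Rightarrow> complex) set \<Rightarrow> nat \<Rightarrow> bool" where
  "l2_has_dim M E k \<longleftrightarrow>
     (\<exists>e::nat \<Rightarrow> 'a \<Rightarrow> complex.
        (\<forall>i<k. e i \<in> E) \<and>
        (\<forall>i<k. \<forall>j<k. l2_inner M (e i) (e j) = (if i = j then 1 else 0)) \<and>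
        (\<forall>f\<in>E. AE x in M. f x = (\<Sum>i<k. l2_inner M (e i) f * e i x)))"

text \<open>\<open>\<mu>\<close> lists in nonincreasing order the square roots of the positive eigenvalues of
  \<open>A\<^sup>*A\<close>, each repeated according to its multiplicity, and is padded with zeros if there are
  only finitely many of them.\<close>

definition singular_value_seq ::
    "'a measure \<Rightarrow> (('a \<Rightarrow> complex) \<Rightarrow> 'a \<Rightarrow> complex) \<Rightarrow> (nat \<Rightarrow> real) \<Rightarrow> bool" where
  "singular_value_seq M A \<mu> \<longleftrightarrow>
     decseq \<mu> \<and> (\<forall>n. 0 \<le> \<mu> n) \<and>
     (\<forall>s>0. finite {n. \<mu> n = s} \<and>
        l2_has_dim M
          {f \<in> L2 M. AE x in M. l2_adjoint M M A (A f) x = complex_of_real (s\<^sup>2) * f x}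
          (card {n. \<mu> n = s}))"

text \<open>A compact operator has exactly one singular value sequence, so for finite \<open>\<alpha>\<close> the infimum
  below ranges over a singleton; for a non-compact operator it ranges over the empty set
  and the norm is \<open>\<infinity>\<close>. Hence the norm is finite iff the operator lies in the Schatten class.\<close>

definition schatten_norm ::
    "ennreal \<Rightarrow> 'a measure \<Rightarrow> (('a \<Rightarrow> complex) \<Rightarrow> 'a \<Rightarrow> complex) \<Rightarrow> ennreal" where
  "schatten_norm \<alpha> M A =
     (if \<alpha> = \<infinity> then SUP f\<in>{f \<in> L2 M. l2_norm M f \<le> 1}. l2_norm M (A f)
      else INF \<mu>\<in>{\<mu>. l2_compact M A \<and> singular_value_seq M A \<mu>}.
             Lp_norm \<alpha> (count_space UNIV) (\<lambda>n. ennreal (\<mu> n)))"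

section \<open>Fourier restriction to the paraboloid\<close>

text \<open>The Fourier transform of \<open>F\<close> at the point \<open>(-|\<xi>|\<^sup>2, \<xi>)\<close> of the paraboloid, whose measure is
  the image of Lebesgue measure under this parametrization.\<close>

definition restriction_op ::
    "(real \<times> (real ^ 'n) \<Rightarrow> complex) \<Rightarrow> real ^ 'n \<Rightarrow> complex" where
  "restriction_op F \<xi> =
     (\<integral>t. (\<integral>x. exp (- \<i> * complex_of_real (x \<bullet> \<xi> - t * (norm \<xi>)\<^sup>2)) * F (t, x) \<partial>lborel) \<partial>lborel)"

definition weighted_restriction ::
    "(real \<times> (real ^ 'n) \<Rightarrow> complex) \<Rightarrow>
     (real \<times> (real ^ 'n) \<Rightarrow> complex) \<Rightarrow> real ^ 'n \<Rightarrow> complex" where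
  "weighted_restriction W F = restriction_op (\<lambda>z. W z * F z)"

text \<open>The operator obtained by multiplying with \<open>W\<close>, applying \<open>T\<^sub>S = R\<^sub>S\<^sup>* R\<^sub>S\<close>, and multiplying
  with the conjugate of \<open>W\<close>. The integral for the formal adjoint \<open>R\<^sub>S\<^sup>*\<close> need not converge
  absolutely on \<open>R\<^sub>S (W F)\<close> for square integrable \<open>F\<close>, so the operator is taken as
  \<open>(R\<^sub>S W)\<^sup>* (R\<^sub>S W)\<close>, with the Hilbert space adjoint of the bounded operator \<open>R\<^sub>S W\<close>.\<close>

definition sandwiched_TS ::
    "(real \<times> (real ^ 'n) \<Rightarrow> complex) \<Rightarrow>
     (real \<times> (real ^ 'n) \<Rightarrow> complex) \<Rightarrow> real \<times> (real ^ 'n) \<Rightarrow> complex" where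
  "sandwiched_TS W F =
     l2_adjoint lborel lborel (weighted_restriction W) (weighted_restriction W F)"

end

theory Submission
  imports Defs "HOL-Probability.Characteristic_Functions"
begin

text \<open>The relation between the exponents says that \<open>q / (q - d) = p / 2\<close>, so the claim is \<open>\<alpha> \<ge> p / 2\<close>. This
is forced by weights \<open>W\<close> that last for a long time \<open>N\<close>. Take \<open>W (t, x) = exp (- (t / N)\<^sup>2 - |x|\<^sup>2)\<close>. The
square of its mixed norm is a constant times \<open>N powr (2 / p)\<close>. On the other hand \<open>W\<close> is comparable to a
sum of \<open>N\<close> translates in time of one fixed weight. Let \<open>F j\<close>, for \<open>j < N\<close>, be the indicator function of
the slab \<open>j \<le> t < j + 1\<close> over the unit cube. These functions are orthonormal in \<open>L\<^sup>2\<close>, and with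
\<open>A = (R W)\<^sup>* (R W)\<close> one has \<open>\<langle>F j, A (F j)\<rangle> = \<parallel>R (W F j)\<parallel>\<^sup>2 \<ge> c\<close> with \<open>c > 0\<close> independent of \<open>j\<close> and \<open>N\<close>:
up to the unimodular factor \<open>exp (i j |\<xi>|\<^sup>2)\<close> the integral defining \<open>R (W F j)\<close> does not oscillate for
small \<open>\<xi>\<close> (\<open>slab_energy_ge\<close>).

A compact positive operator with \<open>N\<close> orthonormal vectors of energy at least \<open>c\<close> has large eigenvalues
in the sense that those above \<open>c / 2\<close> add up to at least \<open>N c / 2\<close> (\<open>sum_eigenvalues_ge\<close>). Therefore
its \<open>\<alpha>\<close>-Schatten norm is at least \<open>(c / 2) N powr (1 / \<alpha>)\<close> (\<open>schatten_norm_ge\<close>). Comparing with the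
assumed bound, \<open>N powr (1 / \<alpha>) \<le> C' N powr (2 / p)\<close> for all \<open>N\<close>, hence \<open>1 / \<alpha> \<le> 2 / p\<close>. For
\<open>p = \<infinity>\<close> the right side is bounded, which excludes every finite \<open>\<alpha>\<close>.

Two analytic facts stand behind this. The lower bound on eigenvalues rests on the variational part of
the spectral theorem: on an invariant complement of finitely many eigenvectors the Rayleigh quotient
attains its supremum at an eigenvector (\<open>rayleigh_attained\<close>). The identity \<open>A = (R W)\<^sup>* (R W)\<close> is only
meaningful once \<open>R W\<close> is known to be bounded between the \<open>L\<^sup>2\<close> spaces and to have an adjoint
(\<open>restr_gram_operator\<close>). For Gaussian weights both follow from an elementary inequality for Fourier
integrals weighted by a Gaussian (\<open>gaussian_weighted_fourier_bound\<close>), applied at each fixed time, first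
to the explicit formal adjoint on integrable functions and then extended by duality and completeness.\<close>

section \<open>Positive semidefinite forms\<close>

text \<open>The vectors are functions, not classes of functions modulo null sets, so the form is only required
to be semidefinite. The same locale then serves for the inner product of an \<open>L\<^sup>2\<close> space, for the
energy \<open>ip f (A g)\<close> of a positive operator, and for the defect \<open>s ip - ip A\<close> of a Rayleigh bound.\<close>
locale psd_form =
  fixes H :: "('b \<Rightarrow> complex) set"
    and ip :: "('b \<Rightarrow> complex) \<Rightarrow> ('b \<Rightarrow> complex) \<Rightarrow> complex"
  assumes lin_closed: "f \<in> H \<Longrightarrow> g \<in> H \<Longrightarrow> (\<lambda>x. a * f x + b * g x) \<in> H"
    and zero_closed: "(\<lambda>x. 0) \<in> H"
    and lin_right: "h \<in> H \<Longrightarrow> f \<in> H \<Longrightarrow> g \<in> H \<Longrightarrow>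
      ip h (\<lambda>x. a * f x + b * g x) = a * ip h f + b * ip h g"
    and herm: "f \<in> H \<Longrightarrow> g \<in> H \<Longrightarrow> ip f g = cnj (ip g f)"
    and pos: "f \<in> H \<Longrightarrow> 0 \<le> Re (ip f f)"
begin

lemma lin_left:
  assumes "h \<in> H" "f \<in> H" "g \<in> H"
  shows "ip (\<lambda>x. a * f x + b * g x) h = cnj a * ip f h + cnj b * ip g h"
proof -
  have "ip (\<lambda>x. a * f x + b * g x) h = cnj (ip h (\<lambda>x. a * f x + b * g x))"
    using herm lin_closed assms by blast
  also have "\<dots> = cnj a * cnj (ip h f) + cnj b * cnj (ip h g)"
    by (simp add: lin_right assms)
  finally show ?thesis using herm assms by metis
qed

lemma diff_closed: "f \<in> H \<Longrightarrow> g \<in> H \<Longrightarrow> (\<lambda>x. f x - g x) \<in> H"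
  using lin_closed[of f g 1 "-1"] by simp

lemma diff_right: "h \<in> H \<Longrightarrow> f \<in> H \<Longrightarrow> g \<in> H \<Longrightarrow> ip h (\<lambda>x. f x - g x) = ip h f - ip h g"
  using lin_right[of h f g 1 "-1"] by simp

lemma diff_left: "h \<in> H \<Longrightarrow> f \<in> H \<Longrightarrow> g \<in> H \<Longrightarrow> ip (\<lambda>x. f x - g x) h = ip f h - ip g h"
  using lin_left[of h f g 1 "-1"] by simp

lemma zero_right: "h \<in> H \<Longrightarrow> ip h (\<lambda>x. 0) = 0"
  using lin_right[of h h h 0 0] by simp

lemma sum_closed:
  "finite S \<Longrightarrow> (\<And>n. n \<in> S \<Longrightarrow> e n \<in> H) \<Longrightarrow> (\<lambda>x. \<Sum>n\<in>S. c n * e n x) \<in> H"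
proof (induction S rule: finite_induct)
  case empty
  then show ?case by (simp add: zero_closed)
next
  case (insert m S)
  then show ?case using lin_closed[of "e m" "\<lambda>x. \<Sum>n\<in>S. c n * e n x" "c m" 1] by simp
qed

lemma sum_right:
  "finite S \<Longrightarrow> (\<And>n. n \<in> S \<Longrightarrow> e n \<in> H) \<Longrightarrow> h \<in> H \<Longrightarrow>
    ip h (\<lambda>x. \<Sum>n\<in>S. c n * e n x) = (\<Sum>n\<in>S. c n * ip h (e n))"
proof (induction S rule: finite_induct)
  case empty
  then show ?case by (simp add: zero_right)
next
  case (insert m S)
  then show ?case
    using lin_right[of h "e m" "\<lambda>x. \<Sum>n\<in>S. c n * e n x" "c m" 1] sum_closed[of S e c] by simp
qed

text \<open>As the form may be degenerate, the case of a null vector \<open>g\<close> is treated by letting the multiple of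
\<open>g\<close> grow.\<close>
lemma cauchy_schwarz:
  assumes "f \<in> H" "g \<in> H"
  shows "(cmod (ip f g))\<^sup>2 \<le> Re (ip f f) * Re (ip g g)"
proof -
  let ?b = "ip f g"
  have key: "0 \<le> Re (ip f f) - 2 * s * (cmod ?b)\<^sup>2 + s\<^sup>2 * (cmod ?b)\<^sup>2 * Re (ip g g)" for s :: real
  proof -
    define z where "z = - complex_of_real s * cnj ?b"
    let ?h = "\<lambda>x. 1 * f x + z * g x"
    have h: "?h \<in> H" using lin_closed assms by blast
    have gf: "ip g f = cnj ?b" using herm assms by blast
    have "ip ?h ?h = ip f f + z * ?b + cnj z * cnj ?b + cnj z * z * ip g g"
      using lin_left[OF h assms, of 1 z] lin_right[OF assms(1) assms, of 1 z]
        lin_right[OF assms(2) assms, of 1 z] by (simp add: gf algebra_simps)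
    also have "\<dots> = ip f f - complex_of_real (2 * s * (cmod ?b)\<^sup>2)
        + complex_of_real (s\<^sup>2 * (cmod ?b)\<^sup>2) * ip g g"
      unfolding of_real_mult complex_norm_square z_def by (simp add: algebra_simps power2_eq_square)
    finally show ?thesis using pos[OF h] by simp
  qed
  show ?thesis
  proof (cases "Re (ip g g) = 0")
    case True
    have "cmod ?b = 0"
    proof (rule ccontr)
      assume "cmod ?b \<noteq> 0"
      then show False
        using key[of "(Re (ip f f) + 1) / (2 * (cmod ?b)\<^sup>2)"] True by simp
    qed
    then show ?thesis using True by simp
  next
    case False
    then have gg: "Re (ip g g) > 0" using pos[OF assms(2)] by simp
    have "0 \<le> Re (ip f f) - (cmod ?b)\<^sup>2 / Re (ip g g)"
      using key[of "1 / Re (ip g g)"] gg by (simp add: power2_eq_square)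
    then show ?thesis using gg by (simp add: field_simps)
  qed
qed

lemma null_right:
  assumes "f \<in> H" "g \<in> H" "Re (ip g g) = 0"
  shows "ip f g = 0"
  using cauchy_schwarz[OF assms(1,2)] assms(3) by simp

lemma conv_right:
  assumes "\<And>n. f n \<in> H" "g \<in> H" "h \<in> H"
    and "(\<lambda>n. Re (ip (\<lambda>x. f n x - g x) (\<lambda>x. f n x - g x))) \<longlonglongrightarrow> 0"
  shows "(\<lambda>n. ip h (f n)) \<longlonglongrightarrow> ip h g"
proof -
  have "(\<lambda>n. (cmod (ip h (\<lambda>x. f n x - g x)))\<^sup>2) \<longlonglongrightarrow> 0"
    by (rule tendsto_sandwich[OF _ _ tendsto_const tendsto_mult_right_zero[OF assms(4), of "Re (ip h h)"]])
       (auto intro!: always_eventually cauchy_schwarz diff_closed assms)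
  then have "(\<lambda>n. sqrt ((cmod (ip h (\<lambda>x. f n x - g x)))\<^sup>2)) \<longlonglongrightarrow> sqrt 0"
    by (rule tendsto_real_sqrt)
  then have "(\<lambda>n. cmod (ip h (f n) - ip h g)) \<longlonglongrightarrow> 0"
    using diff_right assms by simp
  then have "(\<lambda>n. ip h (f n) - ip h g) \<longlonglongrightarrow> 0" by (simp only: tendsto_norm_zero_iff)
  then show ?thesis by (rule LIM_zero_cancel)
qed

definition orthonormal :: "nat set \<Rightarrow> (nat \<Rightarrow> 'b \<Rightarrow> complex) \<Rightarrow> bool" where
  "orthonormal S e \<longleftrightarrow>
     (\<forall>n\<in>S. e n \<in> H) \<and> (\<forall>n\<in>S. \<forall>m\<in>S. ip (e n) (e m) = (if n = m then 1 else 0))"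

definition residual :: "nat set \<Rightarrow> (nat \<Rightarrow> 'b \<Rightarrow> complex) \<Rightarrow> ('b \<Rightarrow> complex) \<Rightarrow> 'b \<Rightarrow> complex" where
  "residual S e f = (\<lambda>x. f x - (\<Sum>n\<in>S. ip (e n) f * e n x))"

lemma residual:
  assumes "finite S" "orthonormal S e" "f \<in> H"
  shows "residual S e f \<in> H"
    and "n \<in> S \<Longrightarrow> ip (e n) (residual S e f) = 0"
    and "Re (ip (residual S e f) (residual S e f)) = Re (ip f f) - (\<Sum>n\<in>S. (cmod (ip (e n) f))\<^sup>2)"
proof -
  let ?u = "\<lambda>x. \<Sum>n\<in>S. ip (e n) f * e n x"
  have e: "\<And>n. n \<in> S \<Longrightarrow> e n \<in> H" using assms(2) by (auto simp: orthonormal_def)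
  have u: "?u \<in> H" by (intro sum_closed assms(1) e)
  show r: "residual S e f \<in> H"
    unfolding residual_def using diff_closed u assms(3) by blast
  show o: "ip (e n) (residual S e f) = 0" if "n \<in> S" for n
  proof -
    have "ip (e n) ?u = (\<Sum>m\<in>S. ip (e m) f * (if n = m then 1 else 0))"
      using that assms(2) by (subst sum_right[OF assms(1)]) (auto simp: e orthonormal_def)
    also have "\<dots> = ip (e n) f" using that assms(1) by (simp add: if_distrib cong: if_cong)
    finally show ?thesis
      unfolding residual_def using diff_right u assms(3) e that by simp
  qed
  have o': "ip (residual S e f) (e n) = 0" if "n \<in> S" for n
    using o[OF that] herm[OF r e[OF that]] by simp
  have "ip (residual S e f) ?u = 0"
    by (subst sum_right[OF assms(1)]) (auto simp: e r o')
  then have "ip (residual S e f) (residual S e f) = ip (residual S e f) f"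
    using diff_right[OF r assms(3) u] by (simp add: residual_def)
  also have "\<dots> = cnj (ip f (residual S e f))" using herm r assms(3) by blast
  also have "ip f (residual S e f) = ip f f - (\<Sum>n\<in>S. ip (e n) f * ip f (e n))"
    unfolding residual_def using diff_right[OF assms(3) assms(3) u]
    by (simp add: sum_right[OF assms(1) e assms(3)])
  also have "(\<Sum>n\<in>S. ip (e n) f * ip f (e n)) = (\<Sum>n\<in>S. complex_of_real ((cmod (ip (e n) f))\<^sup>2))"
  proof (intro sum.cong refl)
    fix n assume "n \<in> S"
    then have "ip f (e n) = cnj (ip (e n) f)" by (intro herm e assms(3))
    then show "ip (e n) f * ip f (e n) = complex_of_real ((cmod (ip (e n) f))\<^sup>2)"
      unfolding complex_norm_square by simp
  qed
  finally show "Re (ip (residual S e f) (residual S e f)) = Re (ip f f) - (\<Sum>n\<in>S. (cmod (ip (e n) f))\<^sup>2)"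
    by simp
qed

lemma bessel:
  assumes "finite S" "orthonormal S e" "f \<in> H"
  shows "(\<Sum>n\<in>S. (cmod (ip (e n) f))\<^sup>2) \<le> Re (ip f f)"
  using residual(3)[OF assms] pos[OF residual(1)[OF assms]] by simp

end

section \<open>Compact positive operators\<close>

text \<open>Symmetry gives linearity in the weak sense \<open>ip h (A (a f + b g))\<close>, and all
arguments below test against arbitrary \<open>h\<close>, so equality almost everywhere never enters.\<close>
locale compact_positive = psd_form H ip for H :: "('b \<Rightarrow> complex) set" and ip +
  fixes A :: "('b \<Rightarrow> complex) \<Rightarrow> 'b \<Rightarrow> complex"
  assumes A_closed: "f \<in> H \<Longrightarrow> A f \<in> H"
    and A_sym: "f \<in> H \<Longrightarrow> g \<in> H \<Longrightarrow> ip f (A g) = ip (A f) g"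
    and A_pos: "f \<in> H \<Longrightarrow> 0 \<le> Re (ip f (A f))"
    and A_bdd: "\<exists>K. \<forall>f\<in>H. Re (ip f (A f)) \<le> K * Re (ip f f)"
    and A_compact: "(\<And>n::nat. u n \<in> H \<and> Re (ip (u n) (u n)) \<le> 1) \<Longrightarrow>
       \<exists>g\<in>H. \<exists>r. strict_mono r \<and>
         (\<lambda>n. Re (ip (\<lambda>x. A (u (r n)) x - g x) (\<lambda>x. A (u (r n)) x - g x))) \<longlonglongrightarrow> 0"
begin

sublocale energy: psd_form H "\<lambda>f g. ip f (A g)"
proof
  fix f g h :: "'b \<Rightarrow> complex" and a b
  assume [simp]: "f \<in> H" "g \<in> H"
  show "(\<lambda>x. a * f x + b * g x) \<in> H" by (simp add: lin_closed)
  show "h \<in> H \<Longrightarrow> ip h (A (\<lambda>x. a * f x + b * g x)) = a * ip h (A f) + b * ip h (A g)"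
    by (simp add: A_sym lin_closed lin_right A_closed)
  have "ip (A f) g = cnj (ip g (A f))" by (intro herm A_closed) simp_all
  then show "ip f (A g) = cnj (ip g (A f))" by (simp add: A_sym)
qed (auto simp: zero_closed A_pos)

text \<open>The equation is tested against all of \<open>H\<close>; it determines \<open>A f\<close> up to null vectors, and null
vectors are eigenvectors for every \<open>s\<close>.\<close>
definition eigvec :: "real \<Rightarrow> ('b \<Rightarrow> complex) \<Rightarrow> bool" where
  "eigvec s f \<longleftrightarrow> f \<in> H \<and> (\<forall>h\<in>H. ip h (A f) = complex_of_real s * ip h f)"

text \<open>The spectral theorem enters only here. On the orthogonal complement \<open>V\<close> of a family of vectors,
if \<open>V\<close> is invariant, the supremum \<open>s\<close> of the Rayleigh quotient is an eigenvalue: the images of a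
maximizing sequence converge along a subsequence by compactness, and their limit is an eigenvector.
It is not a null vector because the energies converge to \<open>s > 0\<close>.\<close>
lemma rayleigh_attained:
  assumes inv: "\<And>f. f \<in> V \<Longrightarrow> A f \<in> V"
    and V: "V = {f \<in> H. \<forall>n\<in>S. ip (e n) f = 0}" and e: "\<And>n. n \<in> S \<Longrightarrow> e n \<in> H"
    and f0: "f0 \<in> V" "Re (ip f0 (A f0)) > \<epsilon> * Re (ip f0 f0)" and "0 \<le> \<epsilon>"
  obtains s g where "s > \<epsilon>" "g \<in> V" "Re (ip g g) > 0" "eigvec s g"
proof -
  have VH: "V \<subseteq> H" using V by auto
  have Vlin: "f \<in> V \<Longrightarrow> g \<in> V \<Longrightarrow> (\<lambda>x. a * f x + b * g x) \<in> V" for f g a b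
    unfolding V using e by (auto simp: lin_closed lin_right)
  have Vdiff: "f \<in> V \<Longrightarrow> g \<in> V \<Longrightarrow> (\<lambda>x. f x - g x) \<in> V" for f g
    using Vlin[of f g 1 "-1"] by simp
  have Vzero: "(\<lambda>x. 0) \<in> V" unfolding V using e by (auto simp: zero_closed zero_right)
  have scale: "ip (\<lambda>x. of_real c * f x) (\<lambda>x. of_real c * f x) = of_real (c\<^sup>2) * ip f f"
       "ip (\<lambda>x. of_real c * f x) (A (\<lambda>x. of_real c * f x)) = of_real (c\<^sup>2) * ip f (A f)"
     "(\<lambda>x. of_real c * f x) \<in> V"
    if "f \<in> V" for f and c :: real
  proof -
    have f: "f \<in> H" using that VH by auto
    have cf: "(\<lambda>x. of_real c * f x) \<in> H" using lin_closed[OF f f, of c 0] by simp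
    show "(\<lambda>x. of_real c * f x) \<in> V" using Vlin[OF that that, of c 0] by simp
    show "ip (\<lambda>x. of_real c * f x) (\<lambda>x. of_real c * f x) = of_real (c\<^sup>2) * ip f f"
      using lin_left[OF cf f f, of c 0] lin_right[OF f f f, of c 0] by (simp add: power2_eq_square)
    show "ip (\<lambda>x. of_real c * f x) (A (\<lambda>x. of_real c * f x)) = of_real (c\<^sup>2) * ip f (A f)"
      using energy.lin_left[OF cf f f, of c 0] energy.lin_right[OF f f f, of c 0] by (simp add: power2_eq_square)
  qed
  define R where "R = (\<lambda>f. Re (ip f (A f))) ` {f \<in> V. Re (ip f f) \<le> 1}"
  obtain K where K: "\<And>f. f \<in> H \<Longrightarrow> Re (ip f (A f)) \<le> K * Re (ip f f)" using A_bdd by auto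
  have bdd: "bdd_above R"
  proof (rule bdd_aboveI)
    fix y assume "y \<in> R"
    then obtain f where "f \<in> V" and f': "Re (ip f f) \<le> 1" "y = Re (ip f (A f))" unfolding R_def by auto
    then have f: "f \<in> H" "Re (ip f f) \<le> 1" "y = Re (ip f (A f))" using VH by auto
    have "K * Re (ip f f) \<le> \<bar>K\<bar> * Re (ip f f)" using pos[OF f(1)] by (intro mult_right_mono) auto
    also have "\<dots> \<le> \<bar>K\<bar> * 1" using f(2) by (intro mult_left_mono) auto
    finally show "y \<le> \<bar>K\<bar>" using K[OF f(1)] f(3) by simp
  qed
  define s where "s = Sup R"
  have le_s: "Re (ip f (A f)) \<le> s" if "f \<in> V" "Re (ip f f) \<le> 1" for f
    unfolding s_def by (rule cSup_upper[OF _ bdd]) (use that in \<open>auto simp: R_def\<close>)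
  have f0H: "f0 \<in> H" using f0 VH by auto
  have f0pos: "Re (ip f0 f0) > 0"
  proof (rule ccontr)
    assume "\<not> ?thesis"
    then have z: "Re (ip f0 f0) = 0" using pos[OF f0H] by simp
    then show False
      using null_right[OF A_closed[OF f0H] f0H z] A_sym[OF f0H f0H] f0(2) by simp
  qed
  have s_gt: "s > \<epsilon>"
  proof -
    define c where "c = 1 / sqrt (Re (ip f0 f0))"
    have c2: "c\<^sup>2 = 1 / Re (ip f0 f0)" unfolding c_def using f0pos by (simp add: power_divide)
    have "Re (ip f0 (A f0)) / Re (ip f0 f0) \<le> s"
      using le_s[OF scale(3)[OF f0(1), of c]] scale(1,2)[OF f0(1), of c] c2 f0pos by simp
    moreover have "Re (ip f0 (A f0)) / Re (ip f0 f0) > \<epsilon>" using f0(2) f0pos by (simp add: field_simps)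
    ultimately show ?thesis by simp
  qed
  then have s0: "s > 0" using assms(6) by simp
  have le_s': "Re (ip f (A f)) \<le> s * Re (ip f f)" if "f \<in> V" for f
  proof (cases "Re (ip f f) = 0")
    case True
    have fH: "f \<in> H" using that VH by auto
    then show ?thesis using True null_right[OF A_closed[OF fH] fH] A_sym[OF fH fH] by simp
  next
    case False
    have fH: "f \<in> H" using that VH by auto
    then have p: "Re (ip f f) > 0" using False pos[OF fH] by simp
    define c where "c = 1 / sqrt (Re (ip f f))"
    have c2: "c\<^sup>2 = 1 / Re (ip f f)" unfolding c_def using p by (simp add: power_divide)
    have "Re (ip f (A f)) / Re (ip f f) \<le> s"
      using le_s[OF scale(3)[OF that, of c]] scale(1,2)[OF that, of c] c2 p by simp
    then show ?thesis using p by (simp add: field_simps)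
  qed
  interpret D: psd_form V "\<lambda>f g. of_real s * ip f g - ip f (A g)"
  proof
    fix f g h :: "'b \<Rightarrow> complex" and a b
    assume V': "f \<in> V" "g \<in> V"
    then have [simp]: "f \<in> H" "g \<in> H" using VH by auto
    show "(\<lambda>x. a * f x + b * g x) \<in> V" by (simp add: Vlin V')
    show "h \<in> V \<Longrightarrow> of_real s * ip h (\<lambda>x. a * f x + b * g x) - ip h (A (\<lambda>x. a * f x + b * g x))
       = a * (of_real s * ip h f - ip h (A f)) + b * (of_real s * ip h g - ip h (A g))"
      using VH by (auto simp: lin_right energy.lin_right subset_iff algebra_simps)
    show "of_real s * ip f g - ip f (A g) = cnj (of_real s * ip g f - ip g (A f))"
      using herm[of f g] energy.herm[of f g] by simp
  next
    fix f assume "f \<in> V"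
    then show "0 \<le> Re (of_real s * ip f f - ip f (A f))" using le_s' by simp
  qed (rule Vzero)
  have Rne: "R \<noteq> {}" using Vzero zero_right zero_closed unfolding R_def by force
  have "\<exists>f. f \<in> V \<and> Re (ip f f) \<le> 1 \<and> s - 1 / Suc n < Re (ip f (A f))" for n
  proof -
    have "s - 1 / Suc n < Sup R" unfolding s_def[symmetric] by simp
    then obtain y where "y \<in> R" "s - 1 / Suc n < y" using less_cSupD[OF Rne] by blast
    then show ?thesis unfolding R_def by auto
  qed
  then obtain f where f: "\<And>n. f n \<in> V" "\<And>n. Re (ip (f n) (f n)) \<le> 1"
      "\<And>n. s - 1 / Suc n < Re (ip (f n) (A (f n)))" by metis
  have fH: "f n \<in> H" for n using f(1) VH by auto
  obtain g r where g: "g \<in> H" "strict_mono r"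
     and lim: "(\<lambda>n. Re (ip (\<lambda>x. A (f (r n)) x - g x) (\<lambda>x. A (f (r n)) x - g x))) \<longlonglongrightarrow> 0"
    using A_compact[of f] f(2) fH by blast
  have inv_n: "(\<lambda>n. 1 / real (Suc (r n))) \<longlonglongrightarrow> 0"
    using LIMSEQ_subseq_LIMSEQ[OF LIMSEQ_inverse_real_of_nat g(2)] by (simp add: o_def inverse_eq_divide)
  have Afg: "(\<lambda>n. ip h (A (f (r n)))) \<longlonglongrightarrow> ip h g" if "h \<in> H" for h
    by (rule conv_right[OF _ g(1) that lim]) (simp add: A_closed fH)
  have gV: "g \<in> V"
  proof -
    have "ip (e n) g = 0" if "n \<in> S" for n
    proof -
      have "(\<lambda>k. ip (e n) (A (f (r k)))) \<longlonglongrightarrow> ip (e n) g" using Afg e that by blast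
      moreover have "ip (e n) (A (f (r k))) = 0" for k using inv[OF f(1)] that unfolding V by auto
      ultimately show ?thesis by (simp add: LIMSEQ_const_iff)
    qed
    then show ?thesis unfolding V using g by auto
  qed
  \<comment> \<open>Cauchy--Schwarz for the form \<open>s ip - ip A\<close>, which is small at almost maximizers, makes them almost
    eigenvectors; passing to the limit needs only convergence of their images under \<open>A\<close>.\<close>
  have D0: "(\<lambda>n. of_real s * ip h (f (r n)) - ip h (A (f (r n)))) \<longlonglongrightarrow> 0" if "h \<in> V" for h
  proof -
    let ?D = "\<lambda>f g. of_real s * ip f g - ip f (A g)"
    have up: "(cmod (?D h (f (r n))))\<^sup>2 \<le> Re (?D h h) * (1 / Suc (r n))" for n
    proof -
      have "Re (?D (f (r n)) (f (r n))) \<le> 1 / Suc (r n)"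
      proof -
        have "s * Re (ip (f (r n)) (f (r n))) \<le> s" using f(2) s0 by simp
        then show ?thesis using f(3)[of "r n"] by simp
      qed
      then show ?thesis
        by (rule order_trans[OF D.cauchy_schwarz[OF that f(1)] mult_left_mono[OF _ D.pos[OF that]]])
    qed
    have "(\<lambda>n. (cmod (?D h (f (r n))))\<^sup>2) \<longlonglongrightarrow> 0"
    proof (rule tendsto_sandwich[where f = "\<lambda>_. 0"])
      show "\<forall>\<^sub>F n in sequentially. (cmod (?D h (f (r n))))\<^sup>2 \<le> Re (?D h h) * (1 / Suc (r n))"
        using up by (intro always_eventually) blast
      show "(\<lambda>n. Re (?D h h) * (1 / Suc (r n))) \<longlonglongrightarrow> 0"
        by (rule tendsto_mult_right_zero[OF inv_n])
    qed auto
    then have "(\<lambda>n. sqrt ((cmod (?D h (f (r n))))\<^sup>2)) \<longlonglongrightarrow> sqrt 0" by (rule tendsto_real_sqrt)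
    then have "(\<lambda>n. cmod (?D h (f (r n)))) \<longlonglongrightarrow> 0" by simp
    then show ?thesis by (simp only: tendsto_norm_zero_iff)
  qed
  have weak: "(\<lambda>n. of_real s * ip h (f (r n))) \<longlonglongrightarrow> ip h g" if "h \<in> V" for h
  proof -
    have "h \<in> H" using that VH by auto
    then show ?thesis using tendsto_add[OF D0[OF that] Afg[of h]] by simp
  qed
  have Ag: "ip h (A g) = of_real s * ip h g" if "h \<in> V" for h
  proof -
    have hH: "h \<in> H" using that VH by auto
    have "(\<lambda>n. of_real s * ip (A h) (f (r n))) \<longlonglongrightarrow> ip (A h) g" by (rule weak[OF inv[OF that]])
    moreover have "(\<lambda>n. of_real s * ip h (A (f (r n)))) \<longlonglongrightarrow> of_real s * ip h g"
      by (intro tendsto_mult tendsto_const Afg hH)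
    ultimately have "ip (A h) g = of_real s * ip h g"
      using A_sym[OF hH fH] LIMSEQ_unique by simp
    then show ?thesis using A_sym[OF hH g(1)] by simp
  qed
  let ?k = "\<lambda>x. 1 * A g x + (- of_real s) * g x"
  have kV: "?k \<in> V" using Vlin[OF inv[OF gV] gV] by blast
  have kH: "?k \<in> H" using kV VH by auto
  have "ip ?k ?k = 0"
    using lin_right[OF kH A_closed[OF g(1)] g(1), of 1 "- of_real s"] Ag[OF kV] by simp
  then have eig: "eigvec s g"
    using null_right[OF _ kH] lin_right[OF _ A_closed[OF g(1)] g(1), of _ 1 "- of_real s"] g(1)
    unfolding eigvec_def by auto
  have "Re (ip g g) \<noteq> 0"
  proof
    assume z: "Re (ip g g) = 0"
    have "(\<lambda>n. Re (ip (A (f (r n))) (A (f (r n))))) \<longlonglongrightarrow> 0"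
    proof -
      have "Re (ip (\<lambda>x. A (f (r n)) x - g x) (\<lambda>x. A (f (r n)) x - g x)) = Re (ip (A (f (r n))) (A (f (r n))))" for n
      proof -
        have a: "A (f (r n)) \<in> H" using A_closed fH by auto
        show ?thesis
          using diff_right[OF diff_closed[OF a g(1)] a g(1)] diff_left[OF a a g(1)] null_right[OF diff_closed[OF a g(1)] g(1) z]
            null_right[OF a g(1) z] herm[OF g(1) a] by simp
      qed
      then show ?thesis using lim by simp
    qed
    then have l0: "(\<lambda>n. sqrt (Re (ip (A (f (r n))) (A (f (r n)))))) \<longlonglongrightarrow> 0"
      using tendsto_real_sqrt[of _ 0] by simp
    have "s - 1 / Suc (r n) \<le> sqrt (Re (ip (A (f (r n))) (A (f (r n)))))" for n
    proof -
      have a: "A (f (r n)) \<in> H" using A_closed fH by auto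
      have "(cmod (ip (f (r n)) (A (f (r n)))))\<^sup>2
          \<le> Re (ip (f (r n)) (f (r n))) * Re (ip (A (f (r n))) (A (f (r n))))"
        using cauchy_schwarz[OF fH a] .
      also have "\<dots> \<le> 1 * Re (ip (A (f (r n))) (A (f (r n))))"
        using f(2)[of "r n"] pos[OF a] by (rule mult_right_mono)
      finally have "(cmod (ip (f (r n)) (A (f (r n)))))\<^sup>2 \<le> Re (ip (A (f (r n))) (A (f (r n))))"
        by simp
      then have "cmod (ip (f (r n)) (A (f (r n)))) \<le> sqrt (Re (ip (A (f (r n))) (A (f (r n)))))"
        by (rule real_le_rsqrt)
      then show ?thesis using f(3)[of "r n"] complex_Re_le_cmod[of "ip (f (r n)) (A (f (r n)))"] by linarith
    qed
    then have "s - 0 \<le> 0"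
      by (intro LIMSEQ_le[OF tendsto_diff[OF tendsto_const inv_n] l0]) auto
    then show False using s0 by simp
  qed
  then have "Re (ip g g) > 0" using pos[OF g(1)] by simp
  then show ?thesis using that s_gt gV eig by blast
qed

text \<open>If the eigenvectors \<open>e n\<close> account for all eigenvalues above \<open>\<epsilon>\<close>, then the Rayleigh quotient on their
complement is at most \<open>\<epsilon>\<close>, since otherwise its supremum there would be a further eigenvalue. The
energy splits without cross terms because the \<open>e n\<close> are eigenvectors.\<close>
lemma energy_le:
  assumes S: "finite S" "orthonormal S e" and eig: "\<And>n. n \<in> S \<Longrightarrow> eigvec (\<mu> n) (e n)"
    and complete: "\<And>s g. s > \<epsilon> \<Longrightarrow> eigvec s g \<Longrightarrow> (\<And>n. n \<in> S \<Longrightarrow> ip (e n) g = 0) \<Longrightarrow> Re (ip g g) = 0"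
    and "0 \<le> \<epsilon>" and f: "f \<in> H"
  shows "Re (ip f (A f)) \<le> (\<Sum>n\<in>S. \<mu> n * (cmod (ip (e n) f))\<^sup>2) + \<epsilon> * Re (ip f f)"
proof -
  have e: "\<And>n. n \<in> S \<Longrightarrow> e n \<in> H" using S(2) by (auto simp: orthonormal_def)
  let ?g = "residual S e f" and ?u = "\<lambda>x. \<Sum>n\<in>S. ip (e n) f * e n x"
  note g = residual[OF S f]
  have u: "?u \<in> H" by (intro sum_closed S(1) e)
  have fe: "f = (\<lambda>x. 1 * ?g x + 1 * ?u x)" by (simp add: residual_def)
  have ev: "ip h (A (e n)) = \<mu> n * ip h (e n)" if "n \<in> S" "h \<in> H" for h n
    using eig[OF that(1)] that(2) by (auto simp: eigvec_def)
  have "ip ?g (A (e n)) = 0" if "n \<in> S" for n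
    using ev[OF that g(1)] g(2)[OF that] herm[OF g(1) e[OF that]] by simp
  then have gu: "ip ?g (A ?u) = 0"
    using energy.sum_right[OF S(1) e g(1), where c = "\<lambda>n. ip (e n) f"] by simp
  have "ip f (A ?u) = (\<Sum>n\<in>S. ip (e n) f * ip f (A (e n)))"
    by (rule energy.sum_right[OF S(1) e f])
  also have "\<dots> = (\<Sum>n\<in>S. complex_of_real (\<mu> n * (cmod (ip (e n) f))\<^sup>2))"
  proof (intro sum.cong refl)
    fix n assume n: "n \<in> S"
    have "ip f (e n) = cnj (ip (e n) f)" using herm e f n by blast
    then show "ip (e n) f * ip f (A (e n)) = complex_of_real (\<mu> n * (cmod (ip (e n) f))\<^sup>2)"
      unfolding of_real_mult complex_norm_square ev[OF n f] by simp
  qed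
  finally have fu: "ip f (A ?u) = (\<Sum>n\<in>S. complex_of_real (\<mu> n * (cmod (ip (e n) f))\<^sup>2))" .
  have "ip f (A f) = ip f (A ?g) + ip f (A ?u)"
    using energy.lin_right[OF f g(1) u, of 1 1] fe by simp
  also have "ip f (A ?g) = ip ?g (A ?g) + ip ?u (A ?g)"
    using energy.lin_left[OF g(1) g(1) u, of 1 1] fe by simp
  also have "ip ?u (A ?g) = 0" using energy.herm[OF u g(1)] gu by simp
  finally have split: "Re (ip f (A f)) = Re (ip ?g (A ?g)) + (\<Sum>n\<in>S. \<mu> n * (cmod (ip (e n) f))\<^sup>2)"
    unfolding fu by simp
  have "Re (ip ?g (A ?g)) \<le> \<epsilon> * Re (ip ?g ?g)"
  proof (rule ccontr)
    assume "\<not> ?thesis"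
    then have gt: "Re (ip ?g (A ?g)) > \<epsilon> * Re (ip ?g ?g)" by simp
    define V where "V = {f \<in> H. \<forall>n\<in>S. ip (e n) f = 0}"
    have inv: "A h \<in> V" if "h \<in> V" for h
    proof -
      have h: "h \<in> H" using that V_def by auto
      have "ip (e n) (A h) = 0" if n: "n \<in> S" for n
        using energy.herm[OF e[OF n] h] ev[OF n h] herm[OF h e[OF n]] \<open>h \<in> V\<close> n by (simp add: V_def)
      then show ?thesis using A_closed h V_def by auto
    qed
    have "?g \<in> V" using g V_def by auto
    from rayleigh_attained[OF inv V_def e this gt assms(5)]
    obtain s h where "s > \<epsilon>" "h \<in> V" "Re (ip h h) > 0" "eigvec s h" by blast
    then show False using complete[of s h] V_def by auto
  qed
  also have "\<epsilon> * Re (ip ?g ?g) \<le> \<epsilon> * Re (ip f f)"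
    using g(3) assms(5) by (intro mult_left_mono) (auto intro: sum_nonneg)
  finally show ?thesis using split by simp
qed

text \<open>Only the diagonal energies of the \<open>F j\<close> enter. Summing the energy bound with
\<open>\<epsilon> = c / 2\<close> over \<open>j\<close> gives total energy at least \<open>N c\<close>, of which at most \<open>N c / 2\<close> comes from the
small eigenvalues; each large eigenvalue has total weight \<open>\<Sum>j. |ip (e n) (F j)|\<^sup>2 \<le> 1\<close> by Bessel.\<close>
lemma sum_eigenvalues_ge:
  assumes S: "finite S" "orthonormal S e" and eig: "\<And>n. n \<in> S \<Longrightarrow> eigvec (\<mu> n) (e n)"
    and "\<And>n. n \<in> S \<Longrightarrow> 0 \<le> \<mu> n"
    and complete: "\<And>s g. s > c / 2 \<Longrightarrow> eigvec s g \<Longrightarrow> (\<And>n. n \<in> S \<Longrightarrow> ip (e n) g = 0) \<Longrightarrow> Re (ip g g) = 0"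
    and "0 \<le> c" and F: "orthonormal {..<N} F" and "\<And>j. j < N \<Longrightarrow> c \<le> Re (ip (F j) (A (F j)))"
  shows "N * (c / 2) \<le> (\<Sum>n\<in>S. \<mu> n)"
proof -
  have e: "\<And>n. n \<in> S \<Longrightarrow> e n \<in> H" using S(2) by (auto simp: orthonormal_def)
  have FH: "\<And>j. j < N \<Longrightarrow> F j \<in> H" and F1: "\<And>j. j < N \<Longrightarrow> ip (F j) (F j) = 1"
    using F by (auto simp: orthonormal_def)
  have "N * c = (\<Sum>j<N. c)" by simp
  also have "\<dots> \<le> (\<Sum>j<N. (\<Sum>n\<in>S. \<mu> n * (cmod (ip (e n) (F j)))\<^sup>2) + c / 2)"
  proof (rule sum_mono)
    fix j assume "j \<in> {..<N}"
    then have j: "j < N" by simp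
    have "Re (ip (F j) (A (F j))) \<le> (\<Sum>n\<in>S. \<mu> n * (cmod (ip (e n) (F j)))\<^sup>2) + c / 2 * Re (ip (F j) (F j))"
    proof (rule energy_le[OF S])
      show "eigvec (\<mu> n) (e n)" if "n \<in> S" for n using eig that .
      show "Re (ip g g) = 0" if "c / 2 < s" "eigvec s g" "\<And>n. n \<in> S \<Longrightarrow> ip (e n) g = 0" for s g
        using complete[OF that] .
    qed (use assms(6) FH[OF j] in simp_all)
    then show "c \<le> (\<Sum>n\<in>S. \<mu> n * (cmod (ip (e n) (F j)))\<^sup>2) + c / 2"
      using assms(8)[OF j] F1[OF j] by simp
  qed
  also have "\<dots> = (\<Sum>n\<in>S. \<mu> n * (\<Sum>j<N. (cmod (ip (e n) (F j)))\<^sup>2)) + N * (c / 2)"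
    by (simp add: sum.distrib sum.swap[of _ "{..<N}"] sum_distrib_left)
  also have "(\<Sum>n\<in>S. \<mu> n * (\<Sum>j<N. (cmod (ip (e n) (F j)))\<^sup>2)) \<le> (\<Sum>n\<in>S. \<mu> n * 1)"
  proof (intro sum_mono mult_left_mono assms(4))
    fix n assume n: "n \<in> S"
    have "(\<Sum>j<N. (cmod (ip (e n) (F j)))\<^sup>2) = (\<Sum>j<N. (cmod (ip (F j) (e n)))\<^sup>2)"
    proof (intro sum.cong refl)
      fix j assume "j \<in> {..<N}"
      then have "ip (e n) (F j) = cnj (ip (F j) (e n))" by (intro herm e n FH) simp
      then show "(cmod (ip (e n) (F j)))\<^sup>2 = (cmod (ip (F j) (e n)))\<^sup>2" by simp
    qed
    also have "\<dots> \<le> 1" using bessel[OF _ F e[OF n]] S(2) n by (simp add: orthonormal_def)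
    finally show "(\<Sum>j<N. (cmod (ip (e n) (F j)))\<^sup>2) \<le> 1" .
  qed
  finally show ?thesis by simp
qed

end

section \<open>Square integrable functions\<close>
lemma l2_norm_eq_nn:
  "l2_norm M f = ennreal_powr (\<integral>\<^sup>+x. ennreal ((cmod (f x))\<^sup>2) \<partial>M) (1/2)"
proof -
  have "ennreal_powr (ennreal (cmod (f x))) 2 = ennreal ((cmod (f x))\<^sup>2)" for x
    by (simp add: ennreal_powr_def)
  then show ?thesis by (simp add: l2_norm_def Lp_norm_def)
qed

lemma L2_iff: "f \<in> L2 M \<longleftrightarrow> f \<in> borel_measurable M \<and> integrable M (\<lambda>x. (cmod (f x))\<^sup>2)"
proof -
  have "l2_norm M f < \<infinity> \<longleftrightarrow> (\<integral>\<^sup>+x. ennreal ((cmod (f x))\<^sup>2) \<partial>M) < \<infinity>"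
    unfolding l2_norm_eq_nn by (auto simp: ennreal_powr_def top.not_eq_extremum)
  then show ?thesis by (auto simp: L2_def integrable_iff_bounded)
qed

lemma L2_measurable [measurable_dest]: "f \<in> L2 M \<Longrightarrow> f \<in> borel_measurable M"
  by (simp add: L2_iff)

lemma l2_norm_eq:
  assumes "f \<in> L2 M"
  shows "l2_norm M f = ennreal (sqrt (\<integral>x. (cmod (f x))\<^sup>2 \<partial>M))"
proof -
  have "(\<integral>\<^sup>+x. ennreal ((cmod (f x))\<^sup>2) \<partial>M) = ennreal (\<integral>x. (cmod (f x))\<^sup>2 \<partial>M)"
    using assms by (intro nn_integral_eq_integral) (auto simp: L2_iff)
  then show ?thesis by (simp add: l2_norm_eq_nn ennreal_powr_def powr_half_sqrt)
qed

lemma L2_integrable_mult: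
  assumes "f \<in> L2 M" "g \<in> L2 M"
  shows "integrable M (\<lambda>x. f x * g x)"
proof (rule Bochner_Integration.integrable_bound)
  show "integrable M (\<lambda>x. (cmod (f x))\<^sup>2 + (cmod (g x))\<^sup>2)" using assms by (auto simp: L2_iff)
  show "(\<lambda>x. f x * g x) \<in> borel_measurable M" using assms by (auto simp: L2_iff)
  have "a * b \<le> a\<^sup>2 + b\<^sup>2" if "0 \<le> a" "0 \<le> b" for a b :: real
    using sum_squares_bound[of a b] that mult_nonneg_nonneg[of a b] by linarith
  then show "AE x in M. norm (f x * g x) \<le> norm ((cmod (f x))\<^sup>2 + (cmod (g x))\<^sup>2)"
    by (simp add: norm_mult)
qed

lemma borel_measurable_cnj [measurable]: "cnj \<in> borel_measurable borel"
  by (intro borel_measurable_continuous_onI continuous_intros)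

lemma L2_cnj: "f \<in> L2 M \<Longrightarrow> (\<lambda>x. cnj (f x)) \<in> L2 M"
  by (auto simp: L2_iff intro: measurable_compose)

lemma L2_lin:
  assumes "f \<in> L2 M" "g \<in> L2 M"
  shows "(\<lambda>x. a * f x + b * g x) \<in> L2 M"
  unfolding L2_iff
proof
  show m: "(\<lambda>x. a * f x + b * g x) \<in> borel_measurable M" using assms by (auto simp: L2_iff)
  show "integrable M (\<lambda>x. (cmod (a * f x + b * g x))\<^sup>2)"
  proof (rule Bochner_Integration.integrable_bound)
    show "integrable M (\<lambda>x. 2 * (cmod a)\<^sup>2 * (cmod (f x))\<^sup>2 + 2 * (cmod b)\<^sup>2 * (cmod (g x))\<^sup>2)"
      using assms by (auto simp: L2_iff)
    have "(cmod (a * f x + b * g x))\<^sup>2 \<le> 2 * (cmod a)\<^sup>2 * (cmod (f x))\<^sup>2 + 2 * (cmod b)\<^sup>2 * (cmod (g x))\<^sup>2" for x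
    proof -
      have "(cmod (a * f x + b * g x))\<^sup>2 \<le> (cmod a * cmod (f x) + cmod b * cmod (g x))\<^sup>2"
        by (intro power_mono) (auto intro: order_trans[OF norm_triangle_ineq] simp: norm_mult)
      also have "\<dots> \<le> 2 * (cmod a * cmod (f x))\<^sup>2 + 2 * (cmod b * cmod (g x))\<^sup>2"
        using sum_squares_bound[of "cmod a * cmod (f x)" "cmod b * cmod (g x)"] by (simp add: power2_sum)
      finally show ?thesis by (simp add: power_mult_distrib)
    qed
    then show "AE x in M. norm ((cmod (a * f x + b * g x))\<^sup>2)
       \<le> norm (2 * (cmod a)\<^sup>2 * (cmod (f x))\<^sup>2 + 2 * (cmod b)\<^sup>2 * (cmod (g x))\<^sup>2)"
      by (auto intro!: AE_I2 order_trans[OF _ abs_ge_self])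
  qed (use m in measurable)
qed

lemma l2_inner_self: "l2_inner M f f = complex_of_real (\<integral>x. (cmod (f x))\<^sup>2 \<partial>M)"
proof -
  have "cnj (f x) * f x = complex_of_real ((cmod (f x))\<^sup>2)" for x
    by (metis complex_norm_square mult.commute)
  then show ?thesis by (simp only: l2_inner_def integral_complex_of_real)
qed

interpretation L2: psd_form "L2 M" "l2_inner M" for M :: "'b measure"
proof
  fix f g h :: "'b \<Rightarrow> complex" and a b :: complex
  assume [simp]: "f \<in> L2 M" "g \<in> L2 M"
  show "(\<lambda>x. a * f x + b * g x) \<in> L2 M" by (simp add: L2_lin)
  show "l2_inner M h (\<lambda>x. a * f x + b * g x) = a * l2_inner M h f + b * l2_inner M h g" if "h \<in> L2 M"
  proof -
    have "l2_inner M h (\<lambda>x. a * f x + b * g x) = (\<integral>x. a * (cnj (h x) * f x) + b * (cnj (h x) * g x) \<partial>M)"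
      unfolding l2_inner_def by (intro Bochner_Integration.integral_cong) (auto simp: algebra_simps)
    also have "\<dots> = a * l2_inner M h f + b * l2_inner M h g"
      unfolding l2_inner_def
      using L2_integrable_mult[OF L2_cnj[OF that] \<open>f \<in> L2 M\<close>]
        L2_integrable_mult[OF L2_cnj[OF that] \<open>g \<in> L2 M\<close>] by simp
    finally show ?thesis .
  qed
  show "l2_inner M f g = cnj (l2_inner M g f)"
    unfolding l2_inner_def by (subst Bochner_Integration.integral_cnj[symmetric]) (simp add: mult.commute)
qed (auto simp: l2_inner_self L2_iff)

lemma AE_eq_0_of_l2_null:
  assumes "f \<in> L2 M" "Re (l2_inner M f f) = 0"
  shows "AE x in M. f x = 0"
proof -
  have "AE x in M. (cmod (f x))\<^sup>2 = 0"
    using assms integral_nonneg_eq_0_iff_AE[of M "\<lambda>x. (cmod (f x))\<^sup>2"] by (auto simp: L2_iff l2_inner_self)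
  then show ?thesis by simp
qed

lemma l2_inner_cong_AE:
  assumes "f \<in> L2 M" "g \<in> L2 M" "h \<in> L2 M" "AE x in M. f x = g x"
  shows "l2_inner M h f = l2_inner M h g"
  unfolding l2_inner_def using assms
  by (intro Bochner_Integration.integral_cong_AE) auto

lemma is_l2_adjoint_unique:
  assumes "is_l2_adjoint M N T B" "is_l2_adjoint M N T B'" "g \<in> L2 N"
  shows "AE x in M. B g x = B' g x"
proof -
  have B: "B g \<in> L2 M" "B' g \<in> L2 M" using assms by (auto simp: is_l2_adjoint_def)
  note d = L2.diff_closed[OF B]
  have "l2_inner M f (\<lambda>x. B g x - B' g x) = 0" if "f \<in> L2 M" for f
    using L2.diff_right[OF that B] assms that by (auto simp: is_l2_adjoint_def)
  from this[OF d] have "AE x in M. B g x - B' g x = 0"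
    by (intro AE_eq_0_of_l2_null d) simp
  then show ?thesis by simp
qed

section \<open>Singular values of Gram operators\<close>

text \<open>The operators \<open>T\<^sup>* T\<close> for bounded \<open>T\<close>. An explicit adjoint \<open>B\<close> certifies that the one picked by
\<open>l2_adjoint\<close> is an adjoint, so the two agree almost everywhere.\<close>
locale gram_operator =
  fixes M :: "'a measure" and N :: "'b measure" and T B K
  assumes T_closed: "f \<in> L2 M \<Longrightarrow> T f \<in> L2 N"
    and T_bdd: "f \<in> L2 M \<Longrightarrow> Re (l2_inner N (T f) (T f)) \<le> K * Re (l2_inner M f f)"
    and adj: "is_l2_adjoint M N T B"
begin

definition gram where "gram f = l2_adjoint M N T (T f)"

lemma is_adj: "is_l2_adjoint M N T (l2_adjoint M N T)"
  using someI[of "is_l2_adjoint M N T", OF adj] by (simp add: l2_adjoint_def)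

lemma gram_closed: "f \<in> L2 M \<Longrightarrow> gram f \<in> L2 M"
  using is_adj T_closed by (simp add: is_l2_adjoint_def gram_def)

lemma gram_right: "f \<in> L2 M \<Longrightarrow> g \<in> L2 M \<Longrightarrow> l2_inner M f (gram g) = l2_inner N (T f) (T g)"
  using is_adj T_closed by (simp add: is_l2_adjoint_def gram_def)

lemma gram_left: "f \<in> L2 M \<Longrightarrow> g \<in> L2 M \<Longrightarrow> l2_inner M (gram f) g = l2_inner N (T f) (T g)"
  using L2.herm[OF gram_closed[of f], of g] gram_right[of g f] L2.herm[OF T_closed[of f] T_closed[of g]] by simp

lemma gram_self_adjoint: "is_l2_adjoint M M gram gram"
  by (simp add: is_l2_adjoint_def gram_closed gram_left gram_right)

lemma adjoint_gram: "g \<in> L2 M \<Longrightarrow> AE x in M. l2_adjoint M M gram g x = gram g x"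
  unfolding l2_adjoint_def
  by (rule is_l2_adjoint_unique[OF someI[of "is_l2_adjoint M M gram"] gram_self_adjoint]) (rule gram_self_adjoint)

lemma compact_positive:
  assumes "l2_compact M gram"
  shows "compact_positive (L2 M) (l2_inner M) gram"
proof
  fix f g :: "'a \<Rightarrow> complex" assume f: "f \<in> L2 M"
  show "gram f \<in> L2 M" using f by (rule gram_closed)
  show "0 \<le> Re (l2_inner M f (gram f))" using f by (simp add: gram_right L2.pos T_closed)
  show "l2_inner M f (gram g) = l2_inner M (gram f) g" if "g \<in> L2 M" using f that by (simp add: gram_left gram_right)
next
  show "\<exists>K. \<forall>f\<in>L2 M. Re (l2_inner M f (gram f)) \<le> K * Re (l2_inner M f f)"
    by (rule exI[of _ K]) (simp add: gram_right T_bdd)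
next
  fix u :: "nat \<Rightarrow> 'a \<Rightarrow> complex"
  assume u: "\<And>n. u n \<in> L2 M \<and> Re (l2_inner M (u n) (u n)) \<le> 1"
  then have "\<forall>n. u n \<in> L2 M \<and> l2_norm M (u n) \<le> 1"
    by (simp add: l2_norm_eq l2_inner_self)
  then obtain g r where g: "g \<in> L2 M" "strict_mono r"
     "(\<lambda>n. l2_norm M (\<lambda>x. gram (u (r n)) x - g x)) \<longlonglongrightarrow> 0"
    using assms unfolding l2_compact_def by blast
  let ?q = "\<lambda>n. Re (l2_inner M (\<lambda>x. gram (u (r n)) x - g x) (\<lambda>x. gram (u (r n)) x - g x))"
  have mem: "(\<lambda>x. gram (u (r n)) x - g x) \<in> L2 M" for n
    using L2.diff_closed gram_closed g(1) u by blast
  have "(\<lambda>n. ennreal (sqrt (?q n))) \<longlonglongrightarrow> ennreal 0"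
    using g(3) l2_norm_eq[OF mem] by (simp add: l2_inner_self)
  then have "(\<lambda>n. sqrt (?q n)) \<longlonglongrightarrow> 0"
    by (subst (asm) tendsto_ennreal_iff) (auto simp: L2.pos mem)
  then have "(\<lambda>n. (sqrt (?q n))\<^sup>2) \<longlonglongrightarrow> 0\<^sup>2" by (rule tendsto_power)
  then show "\<exists>g\<in>L2 M. \<exists>r. strict_mono r \<and>
     (\<lambda>n. Re (l2_inner M (\<lambda>x. gram (u (r n)) x - g x) (\<lambda>x. gram (u (r n)) x - g x))) \<longlonglongrightarrow> 0"
    using g(1,2) by (auto simp: L2.pos mem)
qed

end

text \<open>Singular values are defined through the eigenspaces of \<open>A\<^sup>* A = A\<^sup>2\<close>. These are the eigenspaces of
\<open>A\<close>: the vector \<open>k = A f - s f\<close> satisfies \<open>A k = - s k\<close>, which positivity of \<open>A\<close> permits only for null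
vectors.\<close>
lemma (in compact_positive) eigvec_of_square:
  assumes f: "f \<in> H" and s: "s > 0" and sq: "\<And>h. h \<in> H \<Longrightarrow> ip h (A (A f)) = complex_of_real (s\<^sup>2) * ip h f"
  shows "eigvec s f"
proof -
  define k where "k = (\<lambda>x. 1 * A f x + (- complex_of_real s) * f x)"
  have Af: "A f \<in> H" using f A_closed by blast
  have k: "k \<in> H" unfolding k_def by (rule lin_closed[OF Af f])
  have ipk: "ip h k = ip h (A f) - s * ip h f" if "h \<in> H" for h
    using lin_right[OF that Af f, of 1 "- complex_of_real s"] by (simp add: k_def)
  have "ip k (A k) = ip k (A (A f)) - s * ip k (A f)"
    using energy.lin_right[OF k Af f, of 1 "- complex_of_real s"] by (simp add: k_def)
  also have "\<dots> = - (s * ip k k)"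
    by (simp add: sq[OF k] ipk[OF k] power2_eq_square algebra_simps)
  finally have "Re (ip k (A k)) = - (s * Re (ip k k))" by simp
  then have "s * Re (ip k k) \<le> 0" using A_pos[OF k] by linarith
  then have "Re (ip k k) \<le> 0" using s by (simp add: mult_le_0_iff)
  then have z: "Re (ip k k) = 0" using pos[OF k] by linarith
  have "ip h (A f) = of_real s * ip h f" if "h \<in> H" for h
    using null_right[OF that k z] ipk[OF that] by simp
  then show ?thesis using f by (simp add: eigvec_def)
qed

lemma (in compact_positive) eigvec_orthogonal:
  assumes "eigvec s f" "eigvec t g" "s \<noteq> t"
  shows "ip f g = 0"
proof -
  have fg: "f \<in> H" "g \<in> H" using assms by (auto simp: eigvec_def)
  have "t * ip f g = ip f (A g)" using assms fg by (simp add: eigvec_def)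
  also have "\<dots> = cnj (ip g (A f))" using energy.herm fg by blast
  also have "\<dots> = s * ip f g" using assms fg herm[of f g] by (simp add: eigvec_def)
  finally show ?thesis using assms(3) by simp
qed

text \<open>The orthonormal bases of the eigenspaces, one for each value \<open>s > 0\<close> of \<open>\<mu>\<close>, are reassembled into one
orthonormal family \<open>e n\<close> with eigenvalue \<open>\<mu> n\<close>, by choosing bijections \<open>\<phi> s\<close> from the positions of
\<open>s\<close> in \<open>\<mu>\<close> to the indices of the basis. Since the dimension of each eigenspace equals the number of
these positions, no eigenvector for an eigenvalue above \<open>c / 2\<close> is orthogonal to all of them.\<close>
lemma (in gram_operator) singular_values_sum_ge:
  assumes comp: "l2_compact M gram" and sv: "singular_value_seq M gram \<mu>"
    and fin: "finite {n. \<mu> n > c / 2}" and c: "c > 0"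
    and F: "L2.orthonormal M {..<k} F" "\<And>j. j < k \<Longrightarrow> c \<le> Re (l2_inner N (T (F j)) (T (F j)))"
  shows "k * (c / 2) \<le> (\<Sum>n | \<mu> n > c / 2. \<mu> n)"
proof -
  interpret C: compact_positive "L2 M" "l2_inner M" gram by (rule compact_positive[OF comp])
  define E where "E s = {f \<in> L2 M. AE x in M. l2_adjoint M M gram (gram f) x = complex_of_real (s\<^sup>2) * f x}" for s :: real
  have eig: "C.eigvec s f" if "s > 0" "f \<in> E s" for s f
  proof (rule C.eigvec_of_square)
    show f: "f \<in> L2 M" using that E_def by auto
    fix h assume h: "h \<in> L2 M"
    have AAf: "gram (gram f) \<in> L2 M" using f gram_closed by blast
    have sf: "(\<lambda>x. complex_of_real (s\<^sup>2) * f x) \<in> L2 M"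
      using L2_lin[OF f f, of "complex_of_real (s\<^sup>2)" 0] by simp
    have "AE x in M. gram (gram f) x = complex_of_real (s\<^sup>2) * f x"
      using adjoint_gram[OF gram_closed[OF f]] that(2) unfolding E_def by auto
    then have "l2_inner M h (gram (gram f)) = l2_inner M h (\<lambda>x. complex_of_real (s\<^sup>2) * f x)"
      using l2_inner_cong_AE AAf sf h by blast
    then show "l2_inner M h (gram (gram f)) = complex_of_real (s\<^sup>2) * l2_inner M h f"
      using L2.lin_right[OF h f f, of "complex_of_real (s\<^sup>2)" 0] by simp
  qed (use that in auto)
  have eigE: "f \<in> E s" if "C.eigvec s f" for s f
  proof -
    have f: "f \<in> L2 M" using that by (simp add: C.eigvec_def)
    have AAf: "gram (gram f) \<in> L2 M" using f gram_closed by blast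
    let ?d = "\<lambda>x. 1 * gram (gram f) x + (- complex_of_real (s\<^sup>2)) * f x"
    have d: "?d \<in> L2 M" using L2_lin[OF AAf f] by blast
    have "l2_inner M h (gram (gram f)) = s\<^sup>2 * l2_inner M h f" if h: "h \<in> L2 M" for h
    proof -
      have "l2_inner M h (gram (gram f)) = l2_inner M (gram h) (gram f)" using C.A_sym h f gram_closed by blast
      also have "\<dots> = s * l2_inner M h (gram f)" using \<open>C.eigvec s f\<close> gram_closed[OF h] C.A_sym[OF h f] by (simp add: C.eigvec_def)
      also have "\<dots> = s\<^sup>2 * l2_inner M h f" using \<open>C.eigvec s f\<close> h by (simp add: C.eigvec_def power2_eq_square)
      finally show ?thesis .
    qed
    then have "l2_inner M ?d ?d = 0" using L2.lin_right[OF d AAf f, of 1 "- complex_of_real (s\<^sup>2)"] d by simp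
    then have "AE x in M. ?d x = 0" using AE_eq_0_of_l2_null[OF d] by simp
    then have "AE x in M. l2_adjoint M M gram (gram f) x = complex_of_real (s\<^sup>2) * f x"
      using adjoint_gram[OF gram_closed[OF f]] by auto
    then show ?thesis using f E_def by auto
  qed
  define d where "d s = card {n. \<mu> n = s}" for s
  define is_basis where "is_basis s b \<longleftrightarrow> (\<forall>i<d s. b i \<in> E s) \<and>
     (\<forall>i<d s. \<forall>j<d s. l2_inner M (b i) (b j) = (if i = j then 1 else 0)) \<and>
     (\<forall>f\<in>E s. AE x in M. f x = (\<Sum>i<d s. l2_inner M (b i) f * b i x))"
    for s and b :: "nat \<Rightarrow> 'a \<Rightarrow> complex"
  define b where "b s = (SOME b. is_basis s b)" for s
  have "is_basis s (b s)" if "s > 0" for s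
  proof -
    have "l2_has_dim M (E s) (d s)" using sv that by (simp add: singular_value_seq_def E_def d_def)
    then have "\<exists>b. is_basis s b" by (simp add: l2_has_dim_def is_basis_def)
    then show ?thesis unfolding b_def by (rule someI_ex)
  qed
  then have b: "\<And>s i. s > 0 \<Longrightarrow> i < d s \<Longrightarrow> b s i \<in> E s"
    "\<And>s i j. s > 0 \<Longrightarrow> i < d s \<Longrightarrow> j < d s \<Longrightarrow> l2_inner M (b s i) (b s j) = (if i = j then 1 else 0)"
    "\<And>s f. s > 0 \<Longrightarrow> f \<in> E s \<Longrightarrow> AE x in M. f x = (\<Sum>i<d s. l2_inner M (b s i) f * b s i x)"
    by (simp_all add: is_basis_def)
  define \<phi> where "\<phi> s = (SOME h. bij_betw h {n. \<mu> n = s} {0..<d s})" for s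
  have \<phi>: "bij_betw (\<phi> s) {n. \<mu> n = s} {0..<d s}" if "s > 0" for s
  proof -
    have "finite {n. \<mu> n = s}" using sv that by (simp add: singular_value_seq_def)
    then show ?thesis unfolding \<phi>_def d_def by (rule someI_ex[OF ex_bij_betw_finite_nat])
  qed
  have \<phi>_less: "\<phi> (\<mu> n) n < d (\<mu> n)" if "\<mu> n > 0" for n
    using bij_betw_apply[OF \<phi>[OF that], of n] by simp
  define e where "e n = b (\<mu> n) (\<phi> (\<mu> n) n)" for n
  have eE: "e n \<in> E (\<mu> n)" if "\<mu> n > 0" for n
    unfolding e_def using b(1) \<phi>_less that by blast
  define S where "S = {n. \<mu> n > c / 2}"
  have Spos: "\<mu> n > 0" if "n \<in> S" for n using that c S_def by auto
  have on: "L2.orthonormal M S e"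
    unfolding L2.orthonormal_def
  proof safe
    fix n m assume n: "n \<in> S" and m: "m \<in> S"
    show "e n \<in> L2 M" using eE[OF Spos[OF n]] E_def by auto
    show "l2_inner M (e n) (e m) = (if n = m then 1 else 0)"
    proof (cases "\<mu> n = \<mu> m")
      case True
      have "\<phi> (\<mu> n) n = \<phi> (\<mu> n) m \<longleftrightarrow> n = m"
        using bij_betw_imp_inj_on[OF \<phi>[OF Spos[OF n]]] True by (auto dest: inj_onD)
      then show ?thesis
        using b(2)[OF Spos[OF n] \<phi>_less[OF Spos[OF n]], of "\<phi> (\<mu> n) m"] \<phi>_less[OF Spos[OF m]] True
        by (simp add: e_def)
    next
      case False
      then have "l2_inner M (e n) (e m) = 0"
        by (intro C.eigvec_orthogonal[of "\<mu> n" _ "\<mu> m"] eig eE Spos n m)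
      then show ?thesis using False by auto
    qed
  qed
  have complete: "Re (l2_inner M g g) = 0"
    if sc: "s > c / 2" and g: "C.eigvec s g" and gz: "\<And>n. n \<in> S \<Longrightarrow> l2_inner M (e n) g = 0" for s g
  proof -
    have s: "s > 0" using sc c by simp
    have "l2_inner M (b s i) g = 0" if i: "i < d s" for i
    proof -
      have "i \<in> \<phi> s ` {n. \<mu> n = s}" using bij_betw_imp_surj_on[OF \<phi>[OF s]] i by simp
      then obtain n where "\<mu> n = s" "\<phi> s n = i" by auto
      then show ?thesis using gz[of n] sc by (auto simp: e_def S_def)
    qed
    then have "AE x in M. g x = 0" using b(3)[OF s eigE[OF g]] by simp
    then have "l2_inner M g g = l2_inner M g (\<lambda>x. 0)"
      using g by (intro l2_inner_cong_AE) (auto simp: C.eigvec_def L2.zero_closed)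
    then show ?thesis by (simp add: l2_inner_def)
  qed
  show ?thesis
    unfolding S_def[symmetric]
  proof (rule C.sum_eigenvalues_ge[of S e \<mu> c k F])
    show "finite S" using fin by (simp add: S_def)
    show "C.eigvec (\<mu> n) (e n)" if "n \<in> S" for n using eig eE Spos[OF that] by blast
    show "Re (l2_inner M g g) = 0"
      if "c / 2 < s" "C.eigvec s g" "\<And>n. n \<in> S \<Longrightarrow> l2_inner M (e n) g = 0" for s g
      using complete[OF that] .
    show "c \<le> Re (l2_inner M (F j) (gram (F j)))" if "j < k" for j
    proof -
      have "F j \<in> L2 M" using F(1) that by (simp add: L2.orthonormal_def)
      then show ?thesis using F(2)[OF that] by (simp add: gram_right)
    qed
  qed (use on F c Spos in \<open>auto intro: less_imp_le\<close>)
qed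

section \<open>Gaussian integrals\<close>
lemma integrable_gaussian_real:
  assumes "a > 0"
  shows "integrable lborel (\<lambda>x::real. exp (- (a * x\<^sup>2)))"
proof -
  define \<sigma> where "\<sigma> = 1 / sqrt (2 * a)"
  have s2: "2 * \<sigma>\<^sup>2 = 1 / a" using assms by (simp add: \<sigma>_def power_divide)
  have "(\<lambda>x. exp (- (a * x\<^sup>2))) = (\<lambda>x. sqrt (2 * pi * \<sigma>\<^sup>2) * normal_density 0 \<sigma> x)"
  proof
    fix x :: real
    have "sqrt (2 * pi * \<sigma>\<^sup>2) \<noteq> 0" using assms by (simp add: \<sigma>_def)
    then show "exp (- (a * x\<^sup>2)) = sqrt (2 * pi * \<sigma>\<^sup>2) * normal_density 0 \<sigma> x"
      unfolding normal_density_def s2 using assms by (simp add: mult.commute)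
  qed
  moreover have "\<sigma> > 0" using assms by (simp add: \<sigma>_def)
  ultimately show ?thesis by (simp add: integrable_normal_density)
qed

lemma norm_sq_Basis: "(norm (x::'a::euclidean_space))\<^sup>2 = (\<Sum>b\<in>Basis. (x \<bullet> b)\<^sup>2)"
  unfolding power2_norm_eq_inner by (subst euclidean_inner) (simp add: power2_eq_square)

lemma gaussian_prod:
  "exp (- (a * (norm (x::'a::euclidean_space))\<^sup>2)) = (\<Prod>b\<in>Basis. exp (- (a * (x \<bullet> b)\<^sup>2)))" for a :: real
  by (simp add: norm_sq_Basis sum_distrib_left exp_sum sum_negf[symmetric])

lemma integrable_gaussian:
  assumes "a > 0"
  shows "integrable lborel (\<lambda>x::'a::euclidean_space. exp (- (a * (norm x)\<^sup>2)))"
proof (rule integrableI_bounded)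
  have "(\<integral>\<^sup>+x. ennreal (exp (- (a * (norm (x::'a))\<^sup>2))) \<partial>lborel)
      = (\<integral>\<^sup>+x. (\<Prod>b\<in>Basis. ennreal (exp (- (a * (x \<bullet> b)\<^sup>2)))) \<partial>(lborel :: 'a measure))"
    by (simp add: gaussian_prod prod_ennreal)
  also have "\<dots> = (\<Prod>b\<in>(Basis :: 'a set). \<integral>\<^sup>+x. ennreal (exp (- (a * x\<^sup>2))) \<partial>lborel)"
    by (rule nn_integral_lborel_prod[of "\<lambda>_ x. ennreal (exp (- (a * x\<^sup>2)))"]) auto
  also have "\<dots> < \<infinity>"
    using integrable_gaussian_real[OF assms]
    by (auto simp: integrable_iff_bounded power_less_top_ennreal)
  finally show "(\<integral>\<^sup>+x. ennreal (norm (exp (- (a * (norm (x::'a))\<^sup>2)))) \<partial>lborel) < \<infinity>" by simp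
qed simp

lemma integral_lborel_prod:
  fixes f :: "'a::euclidean_space \<Rightarrow> real \<Rightarrow> complex"
  assumes f: "\<And>b. b \<in> Basis \<Longrightarrow> integrable lborel (f b)"
  shows "(\<integral>x. (\<Prod>b\<in>Basis. f b (x \<bullet> b)) \<partial>lborel) = (\<Prod>b\<in>Basis. \<integral>x. f b x \<partial>lborel)"
proof -
  interpret finite_product_sigma_finite "\<lambda>_::'a. lborel :: real measure" Basis
    by unfold_locales simp
  have [measurable]: "b \<in> Basis \<Longrightarrow> f b \<in> borel_measurable borel" for b using f[of b] by auto
  have "(\<integral>x. (\<Prod>b\<in>Basis. f b (x \<bullet> b)) \<partial>lborel)
     = (\<integral>y. (\<Prod>b\<in>Basis. f b ((\<Sum>c\<in>Basis. y c *\<^sub>R c) \<bullet> b)) \<partial>(\<Pi>\<^sub>M b\<in>Basis. lborel))"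
    by (subst lborel_eq, rule integral_distr) measurable
  also have "\<dots> = (\<integral>y. (\<Prod>b\<in>Basis. f b (y b)) \<partial>(\<Pi>\<^sub>M b\<in>Basis. lborel))"
    by (intro Bochner_Integration.integral_cong prod.cong refl) simp
  also have "\<dots> = (\<Prod>b\<in>Basis. \<integral>x. f b x \<partial>lborel)"
    using f by (intro product_integral_prod) auto
  finally show ?thesis .
qed

text \<open>Each coordinate contributes the characteristic function of the standard normal distribution.\<close>
lemma fourier_gaussian:
  "(\<integral>x. exp (\<i> * complex_of_real (x \<bullet> \<xi>)) * complex_of_real (exp (- ((norm x)\<^sup>2 / 2))) \<partial>lborel)
     = complex_of_real (sqrt (2 * pi) ^ DIM('a) * exp (- ((norm \<xi>)\<^sup>2 / 2)))"
  for \<xi> :: "'a::euclidean_space"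
proof -
  define f where "f b x = exp (\<i> * complex_of_real (x * (\<xi> \<bullet> b))) * complex_of_real (exp (- (x\<^sup>2 / 2)))"
    for b :: 'a and x :: real
  have fm: "f b \<in> borel_measurable lborel" for b unfolding f_def by measurable
  have "integrable lborel (\<lambda>x::real. exp (- ((1/2) * x\<^sup>2)))" by (rule integrable_gaussian_real) simp
  then have f: "integrable lborel (f b)" for b
    by (rule Bochner_Integration.integrable_bound[OF _ fm]) (auto simp: f_def norm_mult)
  have "(\<integral>x. f b x \<partial>lborel) = complex_of_real (sqrt (2 * pi) * exp (- ((\<xi> \<bullet> b)\<^sup>2 / 2)))" for b
  proof -
    have "(\<integral>x. f b x \<partial>lborel) = (\<integral>x. complex_of_real (sqrt (2 * pi)) *
        (std_normal_density x *\<^sub>R iexp ((\<xi> \<bullet> b) * x)) \<partial>lborel)"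
      by (intro Bochner_Integration.integral_cong)
         (auto simp: f_def std_normal_density_def scaleR_conv_of_real mult_ac)
    also have "\<dots> = sqrt (2 * pi) * (\<integral>x. std_normal_density x *\<^sub>R iexp ((\<xi> \<bullet> b) * x) \<partial>lborel)"
      by (rule integral_mult_right_zero)
    also have "(\<integral>x. std_normal_density x *\<^sub>R iexp ((\<xi> \<bullet> b) * x) \<partial>lborel) = char std_normal_distribution (\<xi> \<bullet> b)"
      unfolding char_def by (rule integral_density[symmetric]) auto
    finally show ?thesis by (simp add: char_std_normal_distribution)
  qed
  then have "(\<Prod>b\<in>Basis. \<integral>x. f b x \<partial>lborel) = complex_of_real (sqrt (2 * pi) ^ DIM('a) * exp (- ((norm \<xi>)\<^sup>2 / 2)))"
    using gaussian_prod[of "1/2" \<xi>] by (simp add: prod.distrib)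
  moreover have "(\<integral>x. (\<Prod>b\<in>Basis. f b (x \<bullet> b)) \<partial>lborel)
     = (\<integral>x. exp (\<i> * complex_of_real (x \<bullet> \<xi>)) * complex_of_real (exp (- ((norm x)\<^sup>2 / 2))) \<partial>lborel)"
  proof (intro Bochner_Integration.integral_cong refl)
    fix x :: 'a
    have "(\<Prod>b\<in>Basis. f b (x \<bullet> b))
       = exp (\<Sum>b\<in>Basis. \<i> * complex_of_real ((x \<bullet> b) * (\<xi> \<bullet> b))) * complex_of_real (\<Prod>b\<in>Basis. exp (- ((1/2) * (x \<bullet> b)\<^sup>2)))"
      by (simp add: f_def prod.distrib exp_sum)
    also have "(\<Sum>b\<in>Basis. \<i> * complex_of_real ((x \<bullet> b) * (\<xi> \<bullet> b))) = \<i> * complex_of_real (x \<bullet> \<xi>)"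
      by (subst euclidean_inner) (simp add: sum_distrib_left)
    finally show "(\<Prod>b\<in>Basis. f b (x \<bullet> b)) = exp (\<i> * complex_of_real (x \<bullet> \<xi>)) * complex_of_real (exp (- ((norm x)\<^sup>2 / 2)))"
      unfolding gaussian_prod[of "1/2", symmetric] by simp
  qed
  ultimately show ?thesis using integral_lborel_prod[of f, OF f] by simp
qed

section \<open>Gaussians are Schwartz functions\<close>
lemma real_polynomial_function_dir_deriv:
  assumes "real_polynomial_function p"
  obtains p' where "real_polynomial_function p'"
    and "\<And>z. \<exists>D. (p has_derivative D) (at z) \<and> D v = p' z"
proof -
  from assms have "\<exists>p'. real_polynomial_function p' \<and> (\<forall>z. \<exists>D. (p has_derivative D) (at z) \<and> D v = p' z)"
  proof induction
    case (linear f)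
    then show ?case
      by (intro exI[of _ "\<lambda>_. f v"]) (auto intro: bounded_linear_imp_has_derivative)
  next
    case (const c)
    show ?case by (rule exI[of _ "\<lambda>_. 0"]) (auto intro: has_derivative_const)
  next
    case (add f g)
    then obtain f' g' where "real_polynomial_function f'" "real_polynomial_function g'"
      and D: "\<And>z. \<exists>D. (f has_derivative D) (at z) \<and> D v = f' z" "\<And>z. \<exists>D. (g has_derivative D) (at z) \<and> D v = g' z"
      by blast
    moreover have "\<exists>D. ((\<lambda>x. f x + g x) has_derivative D) (at z) \<and> D v = f' z + g' z" for z
    proof -
      obtain D E where "(f has_derivative D) (at z)" "D v = f' z" "(g has_derivative E) (at z)" "E v = g' z"
        using D by meson
      then show ?thesis by (intro exI[of _ "\<lambda>h. D h + E h"]) (auto intro: has_derivative_add)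
    qed
    ultimately show ?case by (intro exI[of _ "\<lambda>z. f' z + g' z"]) auto
  next
    case (mult f g)
    then obtain f' g' where "real_polynomial_function f'" "real_polynomial_function g'"
      and D: "\<And>z. \<exists>D. (f has_derivative D) (at z) \<and> D v = f' z" "\<And>z. \<exists>D. (g has_derivative D) (at z) \<and> D v = g' z"
      by blast
    moreover have "\<exists>D. ((\<lambda>x. f x * g x) has_derivative D) (at z) \<and> D v = f z * g' z + f' z * g z" for z
    proof -
      obtain D E where "(f has_derivative D) (at z)" "D v = f' z" "(g has_derivative E) (at z)" "E v = g' z"
        using D by meson
      then show ?thesis by (intro exI[of _ "\<lambda>h. f z * E h + D h * g z"]) (auto intro: has_derivative_mult)
    qed
    ultimately show ?case using mult.hyps by (intro exI[of _ "\<lambda>z. f z * g' z + f' z * g z"]) auto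
  qed
  then show ?thesis using that by blast
qed

lemma real_polynomial_function_bound:
  assumes "real_polynomial_function p"
  obtains C m where "C \<ge> 0" "\<And>z. \<bar>p z\<bar> \<le> C * (1 + norm z) ^ m"
proof -
  from assms have "\<exists>C m. C \<ge> 0 \<and> (\<forall>z. \<bar>p z\<bar> \<le> C * (1 + norm z) ^ m)"
  proof induction
    case (linear f)
    then obtain K where K: "K \<ge> 0" "\<And>z. norm (f z) \<le> norm z * K" using bounded_linear.nonneg_bounded by blast
    have "\<bar>f z\<bar> \<le> K * (1 + norm z) ^ 1" for z using K(2)[of z] K(1) by (simp add: algebra_simps)
    then show ?case using K(1) by blast
  next
    case (const c)
    show ?case by (rule exI[of _ "\<bar>c\<bar>"], rule exI[of _ 0]) simp
  next
    case (add f g)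
    then obtain C m D n where *: "C \<ge> 0" "\<And>z. \<bar>f z\<bar> \<le> C * (1 + norm z) ^ m" "D \<ge> 0" "\<And>z. \<bar>g z\<bar> \<le> D * (1 + norm z) ^ n"
      by blast
    have "\<bar>f z + g z\<bar> \<le> (C + D) * (1 + norm z) ^ (m + n)" for z
    proof -
      have "C * (1 + norm z) ^ m \<le> C * (1 + norm z) ^ (m + n)" "D * (1 + norm z) ^ n \<le> D * (1 + norm z) ^ (m + n)"
        using * by (auto intro!: mult_left_mono power_increasing)
      then show ?thesis using *(2,4)[of z] by (simp add: algebra_simps)
    qed
    then show ?case using * by (meson add_nonneg_nonneg)
  next
    case (mult f g)
    then obtain C m D n where *: "C \<ge> 0" "\<And>z. \<bar>f z\<bar> \<le> C * (1 + norm z) ^ m" "D \<ge> 0" "\<And>z. \<bar>g z\<bar> \<le> D * (1 + norm z) ^ n"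
      by blast
    have "\<bar>f z * g z\<bar> \<le> (C * D) * (1 + norm z) ^ (m + n)" for z
    proof -
      have "\<bar>f z\<bar> * \<bar>g z\<bar> \<le> (C * (1 + norm z) ^ m) * (D * (1 + norm z) ^ n)"
        using * by (intro mult_mono) auto
      then show ?thesis by (simp add: abs_mult power_add mult_ac)
    qed
    then show ?case using * by (meson mult_nonneg_nonneg)
  qed
  then show ?thesis using that by blast
qed

text \<open>From \<open>(1 + r / n) ^ n \<le> exp r\<close> one gets \<open>(1 + r) ^ n \<le> n ^ n exp r\<close>, and \<open>r - c r\<^sup>2\<close> is maximal at
\<open>r = 1 / (2 c)\<close>.\<close>
lemma power_times_gaussian_bound:
  assumes "c > 0" "r \<ge> 0"
  shows "(1 + r) ^ n * exp (- (c * r\<^sup>2)) \<le> real n ^ n * exp (1 / (4 * c))"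
proof -
  have "(1 + r) ^ n \<le> real n ^ n * exp r"
  proof (cases "n = 0")
    case False
    then have "1 + r \<le> real n * (1 + r / real n)" by (simp add: field_simps)
    then have "(1 + r) ^ n \<le> (real n * (1 + r / real n)) ^ n" using assms by (intro power_mono) auto
    also have "\<dots> = real n ^ n * (1 + r / real n) ^ n" by (rule power_mult_distrib)
    also have "\<dots> \<le> real n ^ n * exp r"
      using False assms by (intro mult_left_mono exp_ge_one_plus_x_over_n_power_n) auto
    finally show ?thesis .
  qed (use assms in simp)
  then have "(1 + r) ^ n * exp (- (c * r\<^sup>2)) \<le> real n ^ n * exp r * exp (- (c * r\<^sup>2))"
    by (intro mult_right_mono) auto
  also have "\<dots> = real n ^ n * exp (r - c * r\<^sup>2)" by (simp add: exp_diff exp_minus field_simps)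
  also have "\<dots> \<le> real n ^ n * exp (1 / (4 * c))"
  proof -
    have "0 \<le> c * (r - 1 / (2 * c))\<^sup>2" using assms by simp
    also have "\<dots> = c * r\<^sup>2 - r + 1 / (4 * c)" using assms by (simp add: power2_eq_square field_simps)
    finally show ?thesis by (intro mult_left_mono) auto
  qed
  finally show ?thesis .
qed

text \<open>The functions \<open>p exp (- q)\<close> with polynomial \<open>p\<close> are closed under directional derivatives, because
\<open>p' - p q'\<close> is again a polynomial, and the quadratic lower bound on \<open>q\<close> beats any polynomial growth.\<close>
lemma schwartz_exp_neg_polynomial:
  fixes q :: "'a::euclidean_space \<Rightarrow> real"
  assumes q: "real_polynomial_function q" and c: "c > 0" "\<And>z. c * (norm z)\<^sup>2 \<le> q z"
  shows "schwartz (\<lambda>z. complex_of_real (exp (- q z)))"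
proof -
  let ?G = "\<lambda>p z. complex_of_real (p z * exp (- q z))"
  have der: "\<exists>p'. real_polynomial_function p' \<and> (\<forall>z. ?G p differentiable (at z)) \<and> dir_deriv v (?G p) = ?G p'"
    if p: "real_polynomial_function p" for p v
  proof -
    obtain p' where p': "real_polynomial_function p'" "\<And>z. \<exists>D. (p has_derivative D) (at z) \<and> D v = p' z"
      using real_polynomial_function_dir_deriv[OF p] by blast
    obtain q' where q': "real_polynomial_function q'" "\<And>z. \<exists>D. (q has_derivative D) (at z) \<and> D v = q' z"
      using real_polynomial_function_dir_deriv[OF q] by blast
    have *: "?G p differentiable (at z) \<and> frechet_derivative (?G p) (at z) v = ?G (\<lambda>z. p' z - p z * q' z) z" for z
    proof -
      obtain D E where D: "(p has_derivative D) (at z)" "D v = p' z" and E: "(q has_derivative E) (at z)" "E v = q' z"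
        using p'(2) q'(2) by meson
      have "((\<lambda>z. exp (- q z)) has_derivative (\<lambda>h. exp (- q z) * (- E h))) (at z)"
        using E(1) by (auto intro!: derivative_eq_intros)
      then have "((\<lambda>z. p z * exp (- q z)) has_derivative (\<lambda>h. p z * (exp (- q z) * (- E h)) + D h * exp (- q z))) (at z)"
        by (rule has_derivative_mult[OF D(1)])
      then have d: "(?G p has_derivative (\<lambda>h. complex_of_real (p z * (exp (- q z) * (- E h)) + D h * exp (- q z)))) (at z)"
        by (rule has_derivative_of_real)
      then have "frechet_derivative (?G p) (at z) = (\<lambda>h. complex_of_real (p z * (exp (- q z) * (- E h)) + D h * exp (- q z)))"
        by (rule frechet_derivative_at[symmetric])
      then show ?thesis using d D(2) E(2) by (auto simp: differentiable_def algebra_simps)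
    qed
    have "real_polynomial_function (\<lambda>z. p' z - p z * q' z)" using p p'(1) q'(1) by auto
    then show ?thesis using * by (intro exI[of _ "\<lambda>z. p' z - p z * q' z"]) (simp add: dir_deriv_def)
  qed
  have fold: "\<exists>p'. real_polynomial_function p' \<and> fold dir_deriv vs (?G p) = ?G p'"
    if "real_polynomial_function p" for vs p
    using that
  proof (induction vs arbitrary: p)
    case (Cons v vs)
    obtain p' where "real_polynomial_function p'" "dir_deriv v (?G p) = ?G p'" using der[OF Cons.prems] by blast
    then show ?case using Cons.IH[of p'] by simp
  qed auto
  have dec: "bounded (range (\<lambda>z. norm z ^ k *\<^sub>R ?G p z))" if p: "real_polynomial_function p" for p k
  proof -
    obtain C m where C: "C \<ge> 0" "\<And>z. \<bar>p z\<bar> \<le> C * (1 + norm z) ^ m" using real_polynomial_function_bound[OF p] by blast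
    have "norm (norm z ^ k *\<^sub>R ?G p z) \<le> C * (real (k + m) ^ (k + m) * exp (1 / (4 * c)))" for z
    proof -
      have "norm (norm z ^ k *\<^sub>R ?G p z) = norm z ^ k * (\<bar>p z\<bar> * exp (- q z))" by (simp add: norm_mult)
      also have "\<dots> \<le> (1 + norm z) ^ k * ((C * (1 + norm z) ^ m) * exp (- (c * (norm z)\<^sup>2)))"
        using C c by (intro mult_mono power_mono mult_nonneg_nonneg) auto
      also have "\<dots> = C * ((1 + norm z) ^ (k + m) * exp (- (c * (norm z)\<^sup>2)))" by (simp add: power_add)
      also have "\<dots> \<le> C * (real (k + m) ^ (k + m) * exp (1 / (4 * c)))"
        using C(1) c(1) by (intro mult_left_mono power_times_gaussian_bound) auto
      finally show ?thesis .
    qed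
    then show ?thesis by (intro boundedI) auto
  qed
  have "(\<forall>z. fold dir_deriv vs (?G (\<lambda>_. 1)) differentiable (at z)) \<and>
      (\<forall>k::nat. bounded (range (\<lambda>z. norm z ^ k *\<^sub>R fold dir_deriv vs (?G (\<lambda>_. 1)) z)))" for vs
  proof -
    obtain p' where p': "real_polynomial_function p'" and eq: "fold dir_deriv vs (?G (\<lambda>_. 1)) = ?G p'"
      using fold[OF real_polynomial_function.intros(2)] by blast
    have "\<forall>z. ?G p' differentiable (at z)" using der[OF p'] by blast
    then show ?thesis unfolding eq using dec[OF p'] by blast
  qed
  then show ?thesis unfolding schwartz_def by simp
qed

text \<open>Long in time, of unit size in space: its mixed norm grows like \<open>N powr (1 / p)\<close>, while in each of the
first \<open>N\<close> unit time intervals it acts with a strength independent of \<open>N\<close>.\<close>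
definition gauss_weight :: "real \<Rightarrow> real \<times> 'a::euclidean_space \<Rightarrow> complex" where
  "gauss_weight N z = complex_of_real (exp (- ((fst z / N)\<^sup>2 + (norm (snd z))\<^sup>2)))"

lemma schwartz_gauss_weight:
  assumes "N \<ge> 1"
  shows "schwartz (gauss_weight N :: real \<times> 'a::euclidean_space \<Rightarrow> complex)"
  unfolding gauss_weight_def[abs_def]
proof (rule schwartz_exp_neg_polynomial)
  have "bounded_linear (\<lambda>z::real \<times> 'a. fst z / N)"
    by (intro bounded_linear_divide[THEN bounded_linear_compose] bounded_linear_fst)
  then have 1: "real_polynomial_function (\<lambda>z::real \<times> 'a. fst z / N)" by auto
  have "bounded_linear (\<lambda>z::real \<times> 'a. snd z \<bullet> b)" for b
    by (intro bounded_linear_inner_left[THEN bounded_linear_compose] bounded_linear_snd)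
  then have 2: "real_polynomial_function (\<lambda>z::real \<times> 'a. snd z \<bullet> b)" for b by auto
  show "real_polynomial_function (\<lambda>z::real \<times> 'a. (fst z / N)\<^sup>2 + (norm (snd z))\<^sup>2)"
    unfolding norm_sq_Basis unfolding power2_eq_square
    by (intro real_polynomial_function.intros(3,4) real_polynomial_function_sum 1 2 finite_Basis)
  show "1 / N\<^sup>2 * (norm z)\<^sup>2 \<le> (fst z / N)\<^sup>2 + (norm (snd z))\<^sup>2" for z :: "real \<times> 'a"
  proof -
    have "1 / N\<^sup>2 * (norm (snd z))\<^sup>2 \<le> 1 * (norm (snd z))\<^sup>2"
      using assms by (intro mult_right_mono) auto
    then show ?thesis by (simp add: norm_prod_def power_divide add_divide_distrib)
  qed
qed (use assms in auto)

section \<open>A Gaussian-weighted Fourier bound\<close>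
lemma lborel_fubini:
  fixes f :: "'a::euclidean_space \<times> 'b::euclidean_space \<Rightarrow> complex"
  assumes "integrable lborel f"
  shows "integrable lborel (\<lambda>x. \<integral>y. f (x, y) \<partial>lborel)"
    and "integrable lborel (\<lambda>y. \<integral>x. f (x, y) \<partial>lborel)"
    and "(\<integral>x. \<integral>y. f (x, y) \<partial>lborel \<partial>lborel) = (\<integral>z. f z \<partial>lborel)"
    and "(\<integral>y. \<integral>x. f (x, y) \<partial>lborel \<partial>lborel) = (\<integral>z. f z \<partial>lborel)"
proof -
  have f: "integrable (lborel \<Otimes>\<^sub>M lborel) f" using assms by (simp add: lborel_prod)
  show "integrable lborel (\<lambda>x. \<integral>y. f (x, y) \<partial>lborel)" by (rule lborel_pair.integrable_fst'[OF f])
  show "integrable lborel (\<lambda>y. \<integral>x. f (x, y) \<partial>lborel)"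
    using lborel_pair.integrable_snd[of "\<lambda>x y. f (x, y)"] f by simp
  show "(\<integral>x. \<integral>y. f (x, y) \<partial>lborel \<partial>lborel) = (\<integral>z. f z \<partial>lborel)"
    using lborel_pair.integral_fst'[OF f] by (simp add: lborel_prod)
  show "(\<integral>y. \<integral>x. f (x, y) \<partial>lborel \<partial>lborel) = (\<integral>z. f z \<partial>lborel)"
    using lborel_pair.integral_snd[of "\<lambda>x y. f (x, y)"] f by (simp add: lborel_prod)
qed

lemma lborel_tonelli:
  fixes f :: "'a::euclidean_space \<times> 'b::euclidean_space \<Rightarrow> ennreal"
  assumes "f \<in> borel_measurable borel"
  shows "(\<integral>\<^sup>+z. f z \<partial>lborel) = (\<integral>\<^sup>+x. \<integral>\<^sup>+y. f (x, y) \<partial>lborel \<partial>lborel)"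
    and "(\<integral>\<^sup>+z. f z \<partial>lborel) = (\<integral>\<^sup>+y. \<integral>\<^sup>+x. f (x, y) \<partial>lborel \<partial>lborel)"
proof -
  have f: "f \<in> borel_measurable (lborel \<Otimes>\<^sub>M lborel)" using assms by (simp add: lborel_prod)
  show "(\<integral>\<^sup>+z. f z \<partial>lborel) = (\<integral>\<^sup>+x. \<integral>\<^sup>+y. f (x, y) \<partial>lborel \<partial>lborel)"
    using lborel.nn_integral_fst[OF f] by (simp add: lborel_prod)
  show "(\<integral>\<^sup>+z. f z \<partial>lborel) = (\<integral>\<^sup>+y. \<integral>\<^sup>+x. f (x, y) \<partial>lborel \<partial>lborel)"
    using lborel_pair.nn_integral_snd[OF f] by (simp add: lborel_prod)
qed

lemma borel_measurable_fst [measurable]: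
    "fst \<in> borel_measurable (borel :: ('a::euclidean_space \<times> 'b::euclidean_space) measure)"
  and borel_measurable_snd [measurable]:
    "snd \<in> borel_measurable (borel :: ('a::euclidean_space \<times> 'b::euclidean_space) measure)"
  by (intro borel_measurable_continuous_onI continuous_intros)+

lemma integrable_tensor:
  fixes f :: "'a::euclidean_space \<Rightarrow> complex" and g :: "'b::euclidean_space \<Rightarrow> complex"
  assumes f: "integrable lborel f" and g: "integrable lborel g"
  shows "integrable lborel (\<lambda>z. f (fst z) * g (snd z))"
    and "(\<integral>z. f (fst z) * g (snd z) \<partial>lborel) = (\<integral>x. f x \<partial>lborel) * (\<integral>y. g y \<partial>lborel)"
proof -
  have [measurable]: "f \<in> borel_measurable borel" "g \<in> borel_measurable borel" using f g by auto
  show i: "integrable lborel (\<lambda>z. f (fst z) * g (snd z))"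
  proof (rule integrableI_bounded)
    have "(\<integral>\<^sup>+z. ennreal (norm (f (fst z) * g (snd z))) \<partial>lborel)
      = (\<integral>\<^sup>+x. \<integral>\<^sup>+y. ennreal (norm (f x)) * ennreal (norm (g y)) \<partial>lborel \<partial>lborel)"
      by (subst lborel_tonelli(1)) (simp_all add: norm_mult ennreal_mult)
    also have "\<dots> = (\<integral>\<^sup>+x. ennreal (norm (f x)) \<partial>lborel) * (\<integral>\<^sup>+y. ennreal (norm (g y)) \<partial>lborel)"
      by (simp add: nn_integral_cmult nn_integral_multc)
    also have "\<dots> < \<infinity>" using f g by (auto simp: integrable_iff_bounded ennreal_mult_less_top)
    finally show "(\<integral>\<^sup>+z. ennreal (norm (f (fst z) * g (snd z))) \<partial>lborel) < \<infinity>" .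
  qed simp
  show "(\<integral>z. f (fst z) * g (snd z) \<partial>lborel) = (\<integral>x. f x \<partial>lborel) * (\<integral>y. g y \<partial>lborel)"
    unfolding lborel_fubini(3)[OF i, symmetric] by simp
qed

lemma nn_integral_reflect_translate:
  fixes f :: "'a::euclidean_space \<Rightarrow> ennreal"
  assumes "f \<in> borel_measurable borel" "\<And>x. f (- x) = f x"
  shows "(\<integral>\<^sup>+\<eta>. f (\<xi> - \<eta>) \<partial>lborel) = (\<integral>\<^sup>+\<eta>. f \<eta> \<partial>lborel)"
proof -
  have "(\<integral>\<^sup>+\<eta>. f \<eta> \<partial>lborel) = (\<integral>\<^sup>+\<eta>. f \<eta> \<partial>distr lborel borel ((+) (- \<xi>)))"
    by (simp add: lborel_distr_plus)
  also have "\<dots> = (\<integral>\<^sup>+\<eta>. f (- \<xi> + \<eta>) \<partial>lborel)" using assms(1) by (subst nn_integral_distr) auto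
  also have "\<dots> = (\<integral>\<^sup>+\<eta>. f (\<xi> - \<eta>) \<partial>lborel)"
    using assms(2)[of "\<xi> - _"] by (intro nn_integral_cong) simp
  finally show ?thesis by simp
qed

text \<open>A substitute for Plancherel. Expanding the square turns the left side into the quadratic form of \<open>g\<close>
with kernel \<open>k (\<xi> - \<eta>)\<close>, where \<open>k\<close> is the Fourier transform of the weight, again a Gaussian and in
particular nonnegative and integrable. The inequality \<open>2 |g \<xi>| |g \<eta>| \<le> |g \<xi>|\<^sup>2 + |g \<eta>|\<^sup>2\<close> bounds
this form by the integral \<open>K\<close> of \<open>k\<close> times the squared norm of \<open>g\<close> (the Schur test). The
integrability of \<open>g\<close> itself makes its Fourier integral and the use of Fubini legitimate.\<close>
lemma gaussian_weighted_fourier_bound: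
  fixes g :: "'a::euclidean_space \<Rightarrow> complex"
  assumes g1: "integrable lborel g" and g2: "g \<in> L2 lborel"
  defines "K \<equiv> sqrt (2 * pi) ^ DIM('a) * integral\<^sup>L lborel (\<lambda>x::'a. exp (- ((norm x)\<^sup>2 / 2)))"
  shows "(\<integral>\<^sup>+x. ennreal (exp (- ((norm x)\<^sup>2 / 2)) * (cmod (\<integral>\<xi>. exp (\<i> * complex_of_real (x \<bullet> \<xi>)) * g \<xi> \<partial>lborel))\<^sup>2) \<partial>lborel)
     \<le> ennreal (K * (\<integral>\<xi>. (cmod (g \<xi>))\<^sup>2 \<partial>lborel))"
proof -
  have [measurable]: "g \<in> borel_measurable borel" using g1 by auto
  define \<phi> where "\<phi> x = exp (- ((norm x)\<^sup>2 / 2))" for x :: 'a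
  have \<phi>m [measurable]: "\<phi> \<in> borel_measurable borel" unfolding \<phi>_def by measurable
  have \<phi>i: "integrable lborel \<phi>" using integrable_gaussian[of "1/2", where 'a = 'a] by (simp add: \<phi>_def[abs_def])
  define k where "k \<xi> = sqrt (2 * pi) ^ DIM('a) * \<phi> \<xi>" for \<xi> :: 'a
  have km [measurable]: "k \<in> borel_measurable borel" unfolding k_def by measurable
  have k0: "k \<xi> \<ge> 0" for \<xi> by (simp add: k_def \<phi>_def)
  have "integrable lborel k" using \<phi>i by (simp add: k_def[abs_def])
  moreover have "integral\<^sup>L lborel k = K" by (simp add: k_def[abs_def] K_def \<phi>_def)
  ultimately have ki: "(\<integral>\<^sup>+\<xi>. ennreal (k \<xi>) \<partial>lborel) = ennreal K"
    using k0 by (simp add: nn_integral_eq_integral)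
  define E where "E x \<xi> = exp (\<i> * complex_of_real (x \<bullet> \<xi>))" for x \<xi> :: 'a
  have Em [measurable]: "(\<lambda>(x, \<xi>). E x \<xi>) \<in> borel_measurable (borel \<Otimes>\<^sub>M borel)"
    unfolding E_def by measurable
  have normE [simp]: "cmod (E x \<xi>) = 1" for x \<xi> by (simp add: E_def)
  have E1: "integrable lborel (\<lambda>\<xi>. E x \<xi> * g \<xi>)" for x
    by (rule Bochner_Integration.integrable_bound[OF g1]) (auto simp: norm_mult E_def)
  define G where "G x = (\<integral>\<xi>. E x \<xi> * g \<xi> \<partial>lborel)" for x
  have gc: "integrable lborel (\<lambda>\<xi>. cnj (g \<xi>))" using g1 by simp
  define \<Phi> where "\<Phi> = (\<lambda>(x, p). complex_of_real (\<phi> x) * ((E x (fst p) * g (fst p)) * cnj (E x (snd p) * g (snd p))))"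
  have \<Phi>m: "\<Phi> \<in> borel_measurable borel"
    unfolding \<Phi>_def E_def borel_prod[symmetric] by measurable
  have \<Phi>i: "integrable lborel \<Phi>"
  proof (rule Bochner_Integration.integrable_bound)
    show "integrable lborel (\<lambda>z. complex_of_real (\<phi> (fst z)) * (\<lambda>p. g (fst p) * cnj (g (snd p))) (snd z))"
      using \<phi>i by (intro integrable_tensor g1 gc) simp
    show "\<Phi> \<in> borel_measurable lborel" using \<Phi>m by simp
  qed (auto simp: \<Phi>_def norm_mult)
  have in1: "(\<integral>p. \<Phi> (x, p) \<partial>lborel) = complex_of_real (\<phi> x * (cmod (G x))\<^sup>2)" for x
  proof -
    have "(\<integral>p. \<Phi> (x, p) \<partial>lborel) = complex_of_real (\<phi> x) *
        (\<integral>p. (E x (fst p) * g (fst p)) * cnj (E x (snd p) * g (snd p)) \<partial>lborel)"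
      by (simp add: \<Phi>_def)
    also have "(\<integral>p. (E x (fst p) * g (fst p)) * cnj (E x (snd p) * g (snd p)) \<partial>lborel)
        = G x * (\<integral>\<xi>. cnj (E x \<xi> * g \<xi>) \<partial>lborel)"
      unfolding G_def by (rule integrable_tensor(2)[OF E1]) (use E1[of x] in \<open>simp only: integrable_cnj\<close>)
    also have "(\<integral>\<xi>. cnj (E x \<xi> * g \<xi>) \<partial>lborel) = cnj (G x)" unfolding G_def by (rule Bochner_Integration.integral_cnj)
    finally show ?thesis unfolding of_real_mult complex_norm_square .
  qed
  have in2: "(\<integral>x. \<Phi> (x, p) \<partial>lborel) = g (fst p) * cnj (g (snd p)) * complex_of_real (k (fst p - snd p))" for p
  proof -
    have "(\<integral>x. \<Phi> (x, p) \<partial>lborel) = (\<integral>x. (g (fst p) * cnj (g (snd p))) *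
       (exp (\<i> * complex_of_real (x \<bullet> (fst p - snd p))) * complex_of_real (\<phi> x)) \<partial>lborel)"
    proof (intro Bochner_Integration.integral_cong refl)
      fix x
      have "E x (fst p) * cnj (E x (snd p)) = exp (\<i> * complex_of_real (x \<bullet> (fst p - snd p)))"
        by (simp add: E_def exp_cnj mult_exp_exp inner_diff_right algebra_simps)
      then show "\<Phi> (x, p) = (g (fst p) * cnj (g (snd p))) *
         (exp (\<i> * complex_of_real (x \<bullet> (fst p - snd p))) * complex_of_real (\<phi> x))"
        by (simp add: \<Phi>_def algebra_simps)
    qed
    then show ?thesis using fourier_gaussian[of "fst p - snd p"] by (simp add: \<phi>_def k_def)
  qed
  have int1: "integrable lborel (\<lambda>x. complex_of_real (\<phi> x * (cmod (G x))\<^sup>2))"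
    using lborel_fubini(1)[OF \<Phi>i] by (simp only: in1)
  then have int1': "integrable lborel (\<lambda>x. \<phi> x * (cmod (G x))\<^sup>2)" by (simp only: complex_of_real_integrable_eq)
  have "ennreal (\<integral>x. \<phi> x * (cmod (G x))\<^sup>2 \<partial>lborel)
     = ennreal (cmod (\<integral>x. complex_of_real (\<phi> x * (cmod (G x))\<^sup>2) \<partial>lborel))"
    unfolding integral_complex_of_real norm_of_real
    by (subst abs_of_nonneg) (auto intro!: integral_nonneg_AE simp: \<phi>_def)
  also have "(\<integral>x. complex_of_real (\<phi> x * (cmod (G x))\<^sup>2) \<partial>lborel)
     = (\<integral>p. g (fst p) * cnj (g (snd p)) * complex_of_real (k (fst p - snd p)) \<partial>lborel)"
    using lborel_fubini(3)[OF \<Phi>i] lborel_fubini(4)[OF \<Phi>i] unfolding in1 in2 by simp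
  also have "ennreal (cmod \<dots>) \<le> (\<integral>\<^sup>+p. ennreal (cmod (g (fst p) * cnj (g (snd p)) * complex_of_real (k (fst p - snd p)))) \<partial>lborel)"
    using lborel_fubini(2)[OF \<Phi>i] unfolding in2 by (rule integral_norm_bound_ennreal)
  also have "\<dots> \<le> (\<integral>\<^sup>+p. ennreal ((cmod (g (fst p)))\<^sup>2 / 2) * ennreal (k (fst p - snd p))
      + ennreal ((cmod (g (snd p)))\<^sup>2 / 2) * ennreal (k (fst p - snd p)) \<partial>lborel)"
  proof (intro nn_integral_mono)
    fix p :: "'a \<times> 'a"
    have "cmod (g (fst p)) * cmod (g (snd p)) \<le> (cmod (g (fst p)))\<^sup>2 / 2 + (cmod (g (snd p)))\<^sup>2 / 2"
      using sum_squares_bound[of "cmod (g (fst p))" "cmod (g (snd p))"] by simp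
    from mult_right_mono[OF this k0[of "fst p - snd p"]]
    show "ennreal (cmod (g (fst p) * cnj (g (snd p)) * complex_of_real (k (fst p - snd p))))
      \<le> ennreal ((cmod (g (fst p)))\<^sup>2 / 2) * ennreal (k (fst p - snd p))
      + ennreal ((cmod (g (snd p)))\<^sup>2 / 2) * ennreal (k (fst p - snd p))"
      using k0 by (simp add: norm_mult distrib_right flip: ennreal_mult ennreal_plus)
  qed
  also have "\<dots> = (\<integral>\<^sup>+p. ennreal ((cmod (g (fst p)))\<^sup>2 / 2) * ennreal (k (fst p - snd p)) \<partial>lborel)
      + (\<integral>\<^sup>+p. ennreal ((cmod (g (snd p)))\<^sup>2 / 2) * ennreal (k (fst p - snd p)) \<partial>lborel)"
    by (intro nn_integral_add) auto
  also have "(\<integral>\<^sup>+p. ennreal ((cmod (g (fst p)))\<^sup>2 / 2) * ennreal (k (fst p - snd p)) \<partial>lborel)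
     = (\<integral>\<^sup>+\<xi>. ennreal ((cmod (g \<xi>))\<^sup>2 / 2) * ennreal K \<partial>lborel)"
  proof -
    have "(\<integral>\<^sup>+\<eta>. ennreal (k (\<xi> - \<eta>)) \<partial>lborel) = ennreal K" for \<xi>
      unfolding ki[symmetric] by (rule nn_integral_reflect_translate) (auto simp: k_def \<phi>_def)
    then show ?thesis by (subst lborel_tonelli(1)) (auto simp: nn_integral_cmult)
  qed
  also have "(\<integral>\<^sup>+p. ennreal ((cmod (g (snd p)))\<^sup>2 / 2) * ennreal (k (fst p - snd p)) \<partial>lborel)
     = (\<integral>\<^sup>+\<xi>. ennreal ((cmod (g \<xi>))\<^sup>2 / 2) * ennreal K \<partial>lborel)"
  proof -
    have "(\<integral>\<^sup>+\<eta>. ennreal (k (\<eta> - \<xi>)) \<partial>lborel) = (\<integral>\<^sup>+\<eta>. ennreal (k (\<xi> - \<eta>)) \<partial>lborel)" for \<xi>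
      by (intro nn_integral_cong) (simp add: k_def \<phi>_def norm_minus_commute)
    moreover have "(\<integral>\<^sup>+\<eta>. ennreal (k (\<xi> - \<eta>)) \<partial>lborel) = ennreal K" for \<xi>
      unfolding ki[symmetric] by (rule nn_integral_reflect_translate) (auto simp: k_def \<phi>_def)
    ultimately have "(\<integral>\<^sup>+\<eta>. ennreal (k (\<eta> - \<xi>)) \<partial>lborel) = ennreal K" for \<xi> by simp
    then show ?thesis by (subst lborel_tonelli(2)) (auto simp: nn_integral_cmult)
  qed
  also have "(\<integral>\<^sup>+\<xi>. ennreal ((cmod (g \<xi>))\<^sup>2 / 2) * ennreal K \<partial>lborel)
      + (\<integral>\<^sup>+\<xi>. ennreal ((cmod (g \<xi>))\<^sup>2 / 2) * ennreal K \<partial>lborel)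
      = (\<integral>\<^sup>+\<xi>. ennreal ((cmod (g \<xi>))\<^sup>2) * ennreal K \<partial>lborel)"
    by (subst nn_integral_add[symmetric]) (auto simp flip: distrib_right ennreal_plus)
  also have "\<dots> = (\<integral>\<^sup>+\<xi>. ennreal ((cmod (g \<xi>))\<^sup>2) \<partial>lborel) * ennreal K" by (simp add: nn_integral_multc)
  also have "(\<integral>\<^sup>+\<xi>. ennreal ((cmod (g \<xi>))\<^sup>2) \<partial>lborel) = ennreal (\<integral>\<xi>. (cmod (g \<xi>))\<^sup>2 \<partial>lborel)"
    using g2 by (intro nn_integral_eq_integral) (auto simp: L2_iff)
  also have "ennreal (\<integral>\<xi>. (cmod (g \<xi>))\<^sup>2 \<partial>lborel) * ennreal K = ennreal (K * (\<integral>\<xi>. (cmod (g \<xi>))\<^sup>2 \<partial>lborel))"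
    by (subst ennreal_mult[symmetric]) (auto simp: K_def mult.commute intro!: mult_nonneg_nonneg integral_nonneg_AE)
  finally have fin: "ennreal (\<integral>x. \<phi> x * (cmod (G x))\<^sup>2 \<partial>lborel) \<le> ennreal (K * (\<integral>\<xi>. (cmod (g \<xi>))\<^sup>2 \<partial>lborel))" .
  have "(\<integral>\<^sup>+x. ennreal (\<phi> x * (cmod (G x))\<^sup>2) \<partial>lborel) = ennreal (\<integral>x. \<phi> x * (cmod (G x))\<^sup>2 \<partial>lborel)"
    using int1' by (intro nn_integral_eq_integral) (auto simp: \<phi>_def)
  then show ?thesis using fin by (simp add: \<phi>_def G_def E_def)
qed

section \<open>Limits and truncation in L2\<close>

text \<open>Completeness in the weak form needed for constructing adjoints. The rate \<open>16\<close> is the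
product of one factor \<open>4 ^ k\<close> for summability and one for the weights that make
\<open>D = (\<Sum>k. 4 ^ k * |f (k + 1) - f k|\<^sup>2)\<close> control each increment: \<open>D\<close> is integrable, so almost everywhere the increments are at most
\<open>sqrt D / 2 ^ k\<close>. Hence \<open>f\<close> converges almost everywhere, dominated by the square integrable function
\<open>|f 0| + 2 sqrt D\<close>.\<close>
lemma L2_rapidly_cauchy_converges:
  assumes f: "\<And>k. f k \<in> L2 M"
    and d: "\<And>k. (\<integral>x. (cmod (f (Suc k) x - f k x))\<^sup>2 \<partial>M) \<le> C * (1 / 16) ^ k"
  obtains h where "h \<in> L2 M" "\<And>u. u \<in> L2 M \<Longrightarrow> (\<lambda>k. l2_inner M u (f k)) \<longlonglongrightarrow> l2_inner M u h"
proof -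
  have fm [measurable]: "f k \<in> borel_measurable M" for k using f by (rule L2_measurable)
  define \<delta> where "\<delta> k x = f (Suc k) x - f k x" for k x
  have \<delta>L2: "\<delta> k \<in> L2 M" for k unfolding \<delta>_def by (intro L2.diff_closed f)
  then have \<delta>m [measurable]: "\<delta> k \<in> borel_measurable M" for k by (rule L2_measurable)
  define D where "D x = (\<Sum>k. ennreal (4 ^ k * (cmod (\<delta> k x))\<^sup>2))" for x
  have Dm [measurable]: "D \<in> borel_measurable M" unfolding D_def by measurable
  have "0 \<le> (\<integral>x. (cmod (f (Suc 0) x - f 0 x))\<^sup>2 \<partial>M)" by (intro integral_nonneg_AE) auto
  from order_trans[OF this d[of 0]] have C0: "0 \<le> C" by simp
  have "(\<integral>\<^sup>+x. D x \<partial>M) = (\<Sum>k. \<integral>\<^sup>+x. ennreal (4 ^ k * (cmod (\<delta> k x))\<^sup>2) \<partial>M)"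
    unfolding D_def by (rule nn_integral_suminf) measurable
  also have "\<dots> \<le> (\<Sum>k. ennreal (C * (1 / 4) ^ k))"
  proof (rule suminf_le)
    fix k
    have "(\<integral>\<^sup>+x. ennreal (4 ^ k * (cmod (\<delta> k x))\<^sup>2) \<partial>M) = ennreal (\<integral>x. 4 ^ k * (cmod (\<delta> k x))\<^sup>2 \<partial>M)"
      using \<delta>L2[of k] by (intro nn_integral_eq_integral) (auto simp: L2_iff)
    also have "(\<integral>x. 4 ^ k * (cmod (\<delta> k x))\<^sup>2 \<partial>M) \<le> 4 ^ k * (C * (1 / 16) ^ k)"
      using d[of k] unfolding \<delta>_def by (subst integral_mult_right_zero) (rule mult_left_mono, auto)
    also have "\<dots> = C * (4 * (1 / 16)) ^ k" unfolding power_mult_distrib by simp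
    finally show "(\<integral>\<^sup>+x. ennreal (4 ^ k * (cmod (\<delta> k x))\<^sup>2) \<partial>M) \<le> ennreal (C * (1 / 4) ^ k)"
      by (simp add: ennreal_leI)
  qed auto
  also have "\<dots> = ennreal (\<Sum>k. C * (1 / 4) ^ k)"
    using C0 by (intro suminf_ennreal2 summable_mult summable_geometric) auto
  finally have "(\<integral>\<^sup>+x. D x \<partial>M) \<le> ennreal (\<Sum>k. C * (1 / 4) ^ k)" .
  then have Dfin: "(\<integral>\<^sup>+x. D x \<partial>M) < \<infinity>" by (rule le_less_trans) simp
  define s where "s x = enn2real (D x)" for x
  have sm [measurable]: "s \<in> borel_measurable M" unfolding s_def by measurable
  have s0: "s x \<ge> 0" for x by (simp add: s_def)
  have AED: "AE x in M. D x = ennreal (s x)"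
  proof -
    have "(\<integral>\<^sup>+x. D x \<partial>M) \<noteq> \<infinity>" using Dfin by simp
    from nn_integral_noteq_infinite[OF Dm this] show ?thesis
      by eventually_elim (simp add: s_def less_top)
  qed
  have four: "(4::real) ^ k = (2 ^ k)\<^sup>2" for k :: nat
    by (subst power_mult[symmetric], subst mult.commute, subst power_mult) simp
  have bound: "cmod (\<delta> k x) \<le> sqrt (s x) * (1 / 2) ^ k" if "D x = ennreal (s x)" for x k
  proof -
    have "(\<Sum>i\<in>{k}. ennreal (4 ^ i * (cmod (\<delta> i x))\<^sup>2)) \<le> D x"
      unfolding D_def by (rule sum_le_suminf) auto
    then have "ennreal (4 ^ k * (cmod (\<delta> k x))\<^sup>2) \<le> ennreal (s x)" using that by simp
    then have "4 ^ k * (cmod (\<delta> k x))\<^sup>2 \<le> s x" by (subst (asm) ennreal_le_iff) (simp_all add: s_def)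
    then have "(2 ^ k * cmod (\<delta> k x))\<^sup>2 \<le> s x" by (simp only: power_mult_distrib four)
    then have "2 ^ k * cmod (\<delta> k x) \<le> sqrt (s x)" by (rule real_le_rsqrt)
    then show ?thesis by (simp add: field_simps)
  qed
  define G where "G x = 1 * complex_of_real (cmod (f 0 x)) + 2 * complex_of_real (sqrt (s x))" for x
  have G_L2: "G \<in> L2 M"
    unfolding G_def
  proof (rule L2_lin)
    show "(\<lambda>x. complex_of_real (cmod (f 0 x))) \<in> L2 M" using f[of 0] by (simp add: L2_iff)
    have "(\<integral>\<^sup>+x. ennreal (s x) \<partial>M) = (\<integral>\<^sup>+x. D x \<partial>M)"
      using AED by (intro nn_integral_cong_AE) auto
    then have "(\<integral>\<^sup>+x. ennreal (norm (s x)) \<partial>M) < \<infinity>" using Dfin by (simp add: s_def)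
    with sm have "integrable M s" by (rule integrableI_bounded)
    then show "(\<lambda>x. complex_of_real (sqrt (s x))) \<in> L2 M" by (simp add: L2_iff s0)
  qed
  have normG: "cmod (G x) = cmod (f 0 x) + 2 * sqrt (s x)" for x
  proof -
    have "G x = complex_of_real (cmod (f 0 x) + 2 * sqrt (s x))" by (simp add: G_def)
    then show ?thesis by (simp only: norm_of_real) (simp add: s_def)
  qed
  have tele: "f n x = f 0 x + (\<Sum>k<n. \<delta> k x)" for n x
    unfolding \<delta>_def by (subst sum_lessThan_telescope) simp
  have fG: "cmod (f n x) \<le> cmod (G x)" if "D x = ennreal (s x)" for n x
  proof -
    have "cmod (\<Sum>k<n. \<delta> k x) \<le> (\<Sum>k<n. sqrt (s x) * (1 / 2) ^ k)"
      using bound[OF that] by (intro order_trans[OF norm_sum] sum_mono)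
    also have "\<dots> = sqrt (s x) * (\<Sum>k<n. (1 / 2) ^ k)" by (simp add: sum_distrib_left)
    also have "\<dots> \<le> sqrt (s x) * 2"
    proof (intro mult_left_mono)
      have "(\<Sum>k<n. (1 / 2 :: real) ^ k) \<le> (\<Sum>k. (1 / 2) ^ k)" by (rule sum_le_suminf) auto
      then show "(\<Sum>k<n. (1 / 2 :: real) ^ k) \<le> 2" by (simp add: suminf_geometric)
    qed (simp add: s_def)
    finally show ?thesis
      unfolding tele[of n] normG using norm_triangle_ineq[of "f 0 x" "\<Sum>k<n. \<delta> k x"] by simp
  qed
  define h where "h x = lim (\<lambda>n. f n x)" for x
  have hm [measurable]: "h \<in> borel_measurable M" unfolding h_def by measurable
  have lim: "(\<lambda>n. f n x) \<longlonglongrightarrow> h x" if "D x = ennreal (s x)" for x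
  proof -
    have "summable (\<lambda>k. \<delta> k x)"
      by (rule summable_comparison_test'[of "\<lambda>k. sqrt (s x) * (1 / 2) ^ k" 0])
         (auto intro!: summable_mult bound[OF that])
    then have "(\<lambda>n. f 0 x + (\<Sum>k<n. \<delta> k x)) \<longlonglongrightarrow> f 0 x + (\<Sum>k. \<delta> k x)"
      by (intro tendsto_add tendsto_const summable_LIMSEQ)
    then have "(\<lambda>n. f n x) \<longlonglongrightarrow> f 0 x + (\<Sum>k. \<delta> k x)" by (simp flip: tele)
    then show ?thesis unfolding h_def by (simp add: limI)
  qed
  have hG: "cmod (h x) \<le> cmod (G x)" if "D x = ennreal (s x)" for x
    using fG[OF that] by (intro tendsto_upperbound[OF tendsto_norm[OF lim[OF that]]]) auto
  have "h \<in> L2 M"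
    unfolding L2_iff
  proof
    show "integrable M (\<lambda>x. (cmod (h x))\<^sup>2)"
    proof (rule Bochner_Integration.integrable_bound)
      show "integrable M (\<lambda>x. (cmod (G x))\<^sup>2)" using G_L2 by (simp add: L2_iff)
      show "AE x in M. norm ((cmod (h x))\<^sup>2) \<le> norm ((cmod (G x))\<^sup>2)"
        using AED by eventually_elim (auto intro!: power_mono hG)
    qed measurable
  qed measurable
  moreover have "(\<lambda>k. l2_inner M u (f k)) \<longlonglongrightarrow> l2_inner M u h" if u: "u \<in> L2 M" for u
    unfolding l2_inner_def
  proof (rule integral_dominated_convergence)
    have [measurable]: "u \<in> borel_measurable M" "(\<lambda>x. cnj (u x)) \<in> borel_measurable M"
      using u L2_cnj[OF u] by (auto intro: L2_measurable)
    show "(\<lambda>x. cnj (u x) * h x) \<in> borel_measurable M" "(\<lambda>x. cnj (u x) * f k x) \<in> borel_measurable M" for k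
      by measurable
    show "integrable M (\<lambda>x. cmod (u x * G x))"
      by (intro integrable_norm L2_integrable_mult u G_L2)
    show "AE x in M. (\<lambda>k. cnj (u x) * f k x) \<longlonglongrightarrow> cnj (u x) * h x"
      using AED by eventually_elim (intro tendsto_mult tendsto_const lim)
    show "AE x in M. norm (cnj (u x) * f k x) \<le> cmod (u x * G x)" for k
      using AED by eventually_elim (auto simp: norm_mult intro!: mult_left_mono fG)
  qed
  ultimately show ?thesis using that by blast
qed

text \<open>Truncation to a ball makes square integrable functions integrable, so that their Fourier integrals
exist pointwise.\<close>
definition cutoff :: "nat \<Rightarrow> ('a::euclidean_space \<Rightarrow> complex) \<Rightarrow> 'a \<Rightarrow> complex" where
  "cutoff n g \<xi> = (if norm \<xi> \<le> real n then g \<xi> else 0)"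

lemma cutoff_measurable [measurable]:
  assumes [measurable]: "g \<in> borel_measurable borel"
  shows "cutoff n g \<in> borel_measurable borel"
  unfolding cutoff_def[abs_def] by measurable

lemma cutoff_one_L2: "(\<lambda>\<xi>::'a::euclidean_space. cutoff n (\<lambda>_. 1) \<xi>) \<in> L2 lborel"
proof -
  have "integrable lborel (indicator (cball 0 (real n)) :: 'a \<Rightarrow> real)"
    by (intro integrable_real_indicator) (use emeasure_bounded_finite[OF bounded_cball] in auto)
  moreover have "(\<lambda>\<xi>. (cmod (cutoff n (\<lambda>_. 1) \<xi>))\<^sup>2) = (indicator (cball 0 (real n)) :: 'a \<Rightarrow> real)"
    by (auto simp: cutoff_def fun_eq_iff split: split_indicator)
  ultimately show ?thesis by (simp add: L2_iff)
qed

lemma cutoff_L2: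
  assumes "g \<in> L2 lborel"
  shows "cutoff n g \<in> L2 lborel"
  unfolding L2_iff
proof
  have [measurable]: "g \<in> borel_measurable borel" using L2_measurable[OF assms] by simp
  show "cutoff n g \<in> borel_measurable lborel" by simp
  show "integrable lborel (\<lambda>x. (cmod (cutoff n g x))\<^sup>2)"
    by (rule Bochner_Integration.integrable_bound[of _ "\<lambda>x. (cmod (g x))\<^sup>2"])
       (use assms in \<open>auto simp: L2_iff cutoff_def\<close>)
qed

lemma cutoff_integrable:
  assumes "g \<in> L2 lborel"
  shows "integrable lborel (cutoff n g)"
proof -
  have "(\<lambda>\<xi>. g \<xi> * cutoff n (\<lambda>_. 1) \<xi>) = cutoff n g" by (auto simp: cutoff_def fun_eq_iff)
  then show ?thesis using L2_integrable_mult[OF assms cutoff_one_L2, of n] by simp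
qed

lemma cutoff_bounded_L2:
  assumes [measurable]: "g \<in> borel_measurable borel" and b: "\<And>\<xi>. cmod (g \<xi>) \<le> b"
  shows "cutoff n g \<in> L2 lborel"
  unfolding L2_iff
proof
  show "cutoff n g \<in> borel_measurable lborel" by simp
  show "integrable lborel (\<lambda>x. (cmod (cutoff n g x))\<^sup>2)"
  proof (rule Bochner_Integration.integrable_bound)
    show "integrable lborel (\<lambda>x. b\<^sup>2 * (cmod (cutoff n (\<lambda>_. 1) x))\<^sup>2)"
      using cutoff_one_L2 by (auto simp: L2_iff)
    show "AE x in lborel. norm ((cmod (cutoff n g x))\<^sup>2) \<le> norm (b\<^sup>2 * (cmod (cutoff n (\<lambda>_. 1) x))\<^sup>2)"
      using b by (auto simp: cutoff_def intro!: power_mono)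
  qed simp
qed

lemma cutoff_idem: "cutoff n (cutoff n g) = cutoff n g"
  by (auto simp: cutoff_def fun_eq_iff)

lemma cutoff_tendsto:
  assumes "g \<in> L2 lborel"
  shows "(\<lambda>n. \<integral>\<xi>. (cmod (cutoff n g \<xi> - g \<xi>))\<^sup>2 \<partial>lborel) \<longlonglongrightarrow> 0"
proof -
  have [measurable]: "g \<in> borel_measurable borel" using L2_measurable[OF assms] by simp
  have "(\<lambda>n. \<integral>\<xi>. (cmod (cutoff n g \<xi> - g \<xi>))\<^sup>2 \<partial>lborel) \<longlonglongrightarrow> (\<integral>\<xi>. 0 \<partial>(lborel :: 'a measure))"
  proof (rule integral_dominated_convergence[where w = "\<lambda>x. (cmod (g x))\<^sup>2"])
    show "integrable lborel (\<lambda>x. (cmod (g x))\<^sup>2)" using assms by (simp add: L2_iff)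
    show "AE x in lborel. (\<lambda>n. (cmod (cutoff n g x - g x))\<^sup>2) \<longlonglongrightarrow> 0"
    proof (rule AE_I2)
      fix x :: 'a
      have "\<forall>\<^sub>F n in sequentially. (cmod (cutoff n g x - g x))\<^sup>2 = 0"
        using eventually_ge_at_top[of "nat \<lceil>norm x\<rceil>"]
        by eventually_elim (auto simp: cutoff_def)
      then show "(\<lambda>n. (cmod (cutoff n g x - g x))\<^sup>2) \<longlonglongrightarrow> 0" by (rule tendsto_eventually)
    qed
    show "AE x in lborel. norm ((cmod (cutoff n g x - g x))\<^sup>2) \<le> (cmod (g x))\<^sup>2" for n
      by (auto simp: cutoff_def)
  qed auto
  then show ?thesis by simp
qed

section \<open>The restriction operator with Gaussian weight\<close>
definition phase :: "real \<times> (real ^ 'n) \<Rightarrow> real ^ 'n \<Rightarrow> complex" where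
  "phase z \<xi> = exp (- \<i> * complex_of_real (snd z \<bullet> \<xi> - fst z * (norm \<xi>)\<^sup>2))"

lemma norm_phase [simp]: "cmod (phase z \<xi>) = 1"
  by (simp add: phase_def)

lemma phase_measurable [measurable]:
  assumes [measurable]: "f \<in> M \<rightarrow>\<^sub>M borel" "g \<in> M \<rightarrow>\<^sub>M borel"
  shows "(\<lambda>x. phase (f x) (g x)) \<in> borel_measurable M"
  unfolding phase_def by measurable

lemma gauss_weight_measurable [measurable]: "gauss_weight N \<in> borel_measurable borel"
  unfolding gauss_weight_def[abs_def] by measurable

lemma gauss_weight_L2:
  assumes "N \<ge> 1"
  shows "(gauss_weight N :: real \<times> 'a::euclidean_space \<Rightarrow> complex) \<in> L2 lborel"
  unfolding L2_iff
proof
  show "integrable lborel (\<lambda>z::real \<times> 'a. (cmod (gauss_weight N z))\<^sup>2)"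
  proof (rule Bochner_Integration.integrable_bound)
    show "integrable lborel (\<lambda>z::real \<times> 'a. exp (- (2 / N\<^sup>2 * (norm z)\<^sup>2)))"
      using assms by (intro integrable_gaussian) simp
    show "AE z in lborel. norm ((cmod (gauss_weight N z))\<^sup>2) \<le> norm (exp (- (2 / N\<^sup>2 * (norm (z :: real \<times> 'a))\<^sup>2)))"
    proof (rule AE_I2)
      fix z :: "real \<times> 'a"
      have "1 / N\<^sup>2 * (norm (snd z))\<^sup>2 \<le> 1 * (norm (snd z))\<^sup>2"
        using assms by (intro mult_right_mono) auto
      moreover have "(cmod (gauss_weight N z))\<^sup>2 = exp (2 * (- ((fst z / N)\<^sup>2 + (norm (snd z))\<^sup>2)))"
        unfolding exp_double by (simp add: gauss_weight_def)
      moreover have "(norm z)\<^sup>2 = (fst z)\<^sup>2 + (norm (snd z))\<^sup>2" by (simp add: norm_prod_def)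
      ultimately show "norm ((cmod (gauss_weight N z))\<^sup>2) \<le> norm (exp (- (2 / N\<^sup>2 * (norm z)\<^sup>2)))"
        by (simp add: power_divide algebra_simps add_divide_distrib)
    qed
  qed simp
qed simp

context
  fixes N :: real
  assumes N: "N \<ge> 1"
begin

abbreviation "weight \<equiv> (gauss_weight N :: real \<times> (real ^ 'n) \<Rightarrow> complex)"
abbreviation "restr \<equiv> weighted_restriction (gauss_weight N :: real \<times> (real ^ 'n) \<Rightarrow> complex)"

lemma weight_mult_integrable:
  fixes F :: "real \<times> (real ^ 'n) \<Rightarrow> complex"
  assumes "F \<in> L2 lborel"
  shows "integrable lborel (\<lambda>z. weight z * F z)"
  by (intro L2_integrable_mult gauss_weight_L2 N assms)

lemma restr_eq:
  fixes F :: "real \<times> (real ^ 'n) \<Rightarrow> complex"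
  assumes "F \<in> L2 lborel"
  shows "restr F \<xi> = (\<integral>z. phase z \<xi> * (weight z * F z) \<partial>lborel)"
proof -
  have i: "integrable lborel (\<lambda>z. phase z \<xi> * (weight z * F z))"
    by (rule Bochner_Integration.integrable_bound[OF weight_mult_integrable[OF assms]])
       (use L2_measurable[OF assms] in \<open>auto simp: norm_mult\<close>)
  show ?thesis
    using lborel_fubini(3)[OF i] by (simp add: weighted_restriction_def restriction_op_def phase_def)
qed

lemma restr_measurable:
  fixes F :: "real \<times> (real ^ 'n) \<Rightarrow> complex"
  assumes "F \<in> L2 lborel"
  shows "restr F \<in> borel_measurable borel"
proof -
  have [measurable]: "F \<in> borel_measurable borel" using L2_measurable[OF assms] by simp
  have "(\<lambda>\<xi>. \<integral>z. phase z \<xi> * (weight z * F z) \<partial>lborel) \<in> borel_measurable borel" by measurable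
  then show ?thesis by (simp add: restr_eq[OF assms, abs_def])
qed

lemma restr_bounded:
  fixes F :: "real \<times> (real ^ 'n) \<Rightarrow> complex"
  assumes "F \<in> L2 lborel"
  shows "cmod (restr F \<xi>) \<le> (\<integral>z. cmod (weight z * F z) \<partial>lborel)"
proof -
  have "cmod (restr F \<xi>) \<le> (\<integral>z. cmod (phase z \<xi> * (weight z * F z)) \<partial>lborel)"
    unfolding restr_eq[OF assms] by (rule integral_norm_bound)
  then show ?thesis by (simp add: norm_mult)
qed

text \<open>The formal adjoint of the weighted restriction operator. For integrable \<open>g\<close> it is given by an
absolutely convergent integral; on all of \<open>L\<^sup>2\<close> it has to be extended by continuity.\<close>
definition extension :: "(real ^ 'n \<Rightarrow> complex) \<Rightarrow> real \<times> (real ^ 'n) \<Rightarrow> complex" where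
  "extension g z = cnj (weight z) * (\<integral>\<xi>. cnj (phase z \<xi>) * g \<xi> \<partial>lborel)"

lemma phase_mult_integrable:
  fixes g :: "real ^ 'n \<Rightarrow> complex"
  assumes "integrable lborel g"
  shows "integrable lborel (\<lambda>\<xi>. cnj (phase z \<xi>) * g \<xi>)"
proof (rule Bochner_Integration.integrable_bound[OF assms])
  have [measurable]: "g \<in> borel_measurable borel" using assms by auto
  have "(\<lambda>\<xi>. cnj (phase z \<xi>)) \<in> borel_measurable borel" by measurable
  then show "(\<lambda>\<xi>. cnj (phase z \<xi>) * g \<xi>) \<in> borel_measurable lborel" by measurable
qed (auto simp: norm_mult)

lemma extension_diff:
  assumes "integrable lborel f" "integrable lborel g"
  shows "extension (\<lambda>\<xi>. f \<xi> - g \<xi>) z = extension f z - extension g z"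
proof -
  have "(\<integral>\<xi>. cnj (phase z \<xi>) * (f \<xi> - g \<xi>) \<partial>lborel)
    = (\<integral>\<xi>. cnj (phase z \<xi>) * f \<xi> - cnj (phase z \<xi>) * g \<xi> \<partial>lborel)"
    by (simp add: right_diff_distrib)
  also have "\<dots> = (\<integral>\<xi>. cnj (phase z \<xi>) * f \<xi> \<partial>lborel) - (\<integral>\<xi>. cnj (phase z \<xi>) * g \<xi> \<partial>lborel)"
    by (intro Bochner_Integration.integral_diff phase_mult_integrable assms)
  finally show ?thesis by (simp only: extension_def right_diff_distrib)
qed

lemma extension_measurable:
  assumes "g \<in> borel_measurable borel"
  shows "extension g \<in> borel_measurable borel"
proof -
  have [measurable]: "g \<in> borel_measurable borel" by fact
  have "(\<lambda>(z, \<xi>). cnj (phase z \<xi>) * g \<xi>) \<in> borel_measurable (borel \<Otimes>\<^sub>M lborel)" by measurable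
  then have [measurable]: "(\<lambda>z. \<integral>\<xi>. cnj (phase z \<xi>) * g \<xi> \<partial>lborel) \<in> borel_measurable borel"
    by (rule lborel.borel_measurable_lebesgue_integral)
  show ?thesis unfolding extension_def[abs_def] by measurable
qed

text \<open>At fixed time \<open>t\<close> the factor \<open>exp (- i t |\<xi>|\<^sup>2)\<close> does not change \<open>|g \<xi>|\<close>, so the Gaussian-weighted
Fourier bound applies with a constant that does not depend on \<open>t\<close>; the decay of the weight in time
makes the integral over \<open>t\<close> finite.\<close>
lemma extension_bounded:
  obtains K where "K \<ge> 0" and "\<forall>g :: real ^ 'n \<Rightarrow> complex. integrable lborel g \<longrightarrow> g \<in> L2 lborel \<longrightarrow>
     extension g \<in> L2 lborel \<and> (\<integral>z. (cmod (extension g z))\<^sup>2 \<partial>lborel) \<le> K * (\<integral>\<xi>. (cmod (g \<xi>))\<^sup>2 \<partial>lborel)"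
proof -
  define K0 where "K0 = sqrt (2 * pi) ^ DIM(real ^ 'n) * integral\<^sup>L lborel (\<lambda>x::real ^ 'n. exp (- ((norm x)\<^sup>2 / 2)))"
  define m where "m t = exp (- (2 / N\<^sup>2 * t\<^sup>2))" for t :: real
  have mi: "integrable lborel m" unfolding m_def using N by (intro integrable_gaussian_real) simp
  have [measurable]: "m \<in> borel_measurable borel" using mi by auto
  define K where "K = integral\<^sup>L lborel m * K0"
  have m0: "integral\<^sup>L lborel m \<ge> 0" by (intro integral_nonneg_AE) (simp add: m_def)
  have "integral\<^sup>L lborel (\<lambda>x::real ^ 'n. exp (- ((norm x)\<^sup>2 / 2))) \<ge> 0" by (intro integral_nonneg_AE) simp
  then have K00: "K0 \<ge> 0" by (simp add: K0_def)
  then have K: "K \<ge> 0" using m0 by (simp add: K_def)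
  have "extension g \<in> L2 lborel \<and> (\<integral>z. (cmod (extension g z))\<^sup>2 \<partial>lborel) \<le> K * (\<integral>\<xi>. (cmod (g \<xi>))\<^sup>2 \<partial>lborel)"
    if g1: "integrable lborel g" and g2: "g \<in> L2 lborel" for g :: "real ^ 'n \<Rightarrow> complex"
  proof -
    have gm [measurable]: "g \<in> borel_measurable borel" using g1 by auto
    have dm [measurable]: "extension g \<in> borel_measurable borel" by (rule extension_measurable[OF gm])
    define nrm where "nrm = (\<integral>\<xi>. (cmod (g \<xi>))\<^sup>2 \<partial>lborel)"
    have nrm0: "nrm \<ge> 0" unfolding nrm_def by (intro integral_nonneg_AE) simp
    have slice: "(\<integral>\<^sup>+x. ennreal ((cmod (extension g (t, x)))\<^sup>2) \<partial>lborel) \<le> ennreal (m t) * ennreal (K0 * nrm)" for t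
    proof -
      define gt where "gt \<xi> = exp (- \<i> * complex_of_real (t * (norm \<xi>)\<^sup>2)) * g \<xi>" for \<xi>
      have gtm: "gt \<in> borel_measurable borel" unfolding gt_def[abs_def] by measurable
      have ngt: "cmod (gt \<xi>) = cmod (g \<xi>)" for \<xi> by (simp add: gt_def norm_mult)
      have gt1: "integrable lborel gt"
        by (rule Bochner_Integration.integrable_bound[OF g1]) (use gtm in \<open>auto simp: ngt\<close>)
      have gt2: "gt \<in> L2 lborel" using g2 gtm by (simp add: L2_iff ngt)
      have "(cmod (extension g (t, x)))\<^sup>2 \<le> m t * (exp (- ((norm x)\<^sup>2 / 2)) * (cmod (\<integral>\<xi>. exp (\<i> * complex_of_real (x \<bullet> \<xi>)) * gt \<xi> \<partial>lborel))\<^sup>2)" for x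
      proof -
        have "cnj (phase (t, x) \<xi>) * g \<xi> = exp (\<i> * complex_of_real (x \<bullet> \<xi>)) * gt \<xi>" for \<xi>
          by (simp add: phase_def gt_def exp_cnj right_diff_distrib exp_diff exp_minus field_simps)
        then have d: "extension g (t, x) = cnj (weight (t, x)) * (\<integral>\<xi>. exp (\<i> * complex_of_real (x \<bullet> \<xi>)) * gt \<xi> \<partial>lborel)"
          by (simp add: extension_def)
        have "(cmod (weight (t, x)))\<^sup>2 = exp (2 * (- ((t / N)\<^sup>2 + (norm x)\<^sup>2)))"
          unfolding exp_double by (simp add: gauss_weight_def)
        also have "\<dots> = m t * exp (- (2 * (norm x)\<^sup>2))"
          by (simp add: m_def power_divide flip: exp_add)
        also have "\<dots> \<le> m t * exp (- ((norm x)\<^sup>2 / 2))" by (simp add: m_def)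
        finally have "(cmod (weight (t, x)))\<^sup>2 \<le> m t * exp (- ((norm x)\<^sup>2 / 2))" .
        then show ?thesis unfolding d norm_mult power_mult_distrib complex_mod_cnj mult.assoc[symmetric]
          by (rule mult_right_mono) simp
      qed
      then have "(\<integral>\<^sup>+x. ennreal ((cmod (extension g (t, x)))\<^sup>2) \<partial>lborel)
        \<le> (\<integral>\<^sup>+x. ennreal (m t * (exp (- ((norm x)\<^sup>2 / 2)) * (cmod (\<integral>\<xi>. exp (\<i> * complex_of_real (x \<bullet> \<xi>)) * gt \<xi> \<partial>lborel))\<^sup>2)) \<partial>lborel)"
        by (intro nn_integral_mono ennreal_leI)
      also have "\<dots> = ennreal (m t) * (\<integral>\<^sup>+x. ennreal (exp (- ((norm x)\<^sup>2 / 2)) * (cmod (\<integral>\<xi>. exp (\<i> * complex_of_real (x \<bullet> \<xi>)) * gt \<xi> \<partial>lborel))\<^sup>2) \<partial>lborel)"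
      proof -
        have "(\<lambda>x. \<integral>\<xi>. exp (\<i> * complex_of_real (x \<bullet> \<xi>)) * gt \<xi> \<partial>lborel) \<in> borel_measurable borel"
        proof (rule lborel.borel_measurable_lebesgue_integral)
          show "(\<lambda>(x, \<xi>). exp (\<i> * complex_of_real (x \<bullet> \<xi>)) * gt \<xi>) \<in> borel_measurable (borel \<Otimes>\<^sub>M lborel)"
            using gtm by measurable
        qed
        then show ?thesis
          by (subst nn_integral_cmult[symmetric]) (auto simp: m_def ennreal_mult)
      qed
      also have "\<dots> \<le> ennreal (m t) * ennreal (K0 * (\<integral>\<xi>. (cmod (gt \<xi>))\<^sup>2 \<partial>lborel))"
        unfolding K0_def by (intro mult_left_mono gaussian_weighted_fourier_bound gt1 gt2) simp
      finally show ?thesis unfolding ngt nrm_def .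
    qed
    have "(\<integral>\<^sup>+z. ennreal ((cmod (extension g z))\<^sup>2) \<partial>lborel) = (\<integral>\<^sup>+t. \<integral>\<^sup>+x. ennreal ((cmod (extension g (t, x)))\<^sup>2) \<partial>lborel \<partial>lborel)"
      by (rule lborel_tonelli(1)) measurable
    also have "\<dots> \<le> (\<integral>\<^sup>+t. ennreal (m t) * ennreal (K0 * nrm) \<partial>lborel)"
      by (intro nn_integral_mono slice)
    also have "\<dots> = (\<integral>\<^sup>+t. ennreal (m t) \<partial>lborel) * ennreal (K0 * nrm)" by (rule nn_integral_multc) measurable
    also have "(\<integral>\<^sup>+t. ennreal (m t) \<partial>lborel) = ennreal (integral\<^sup>L lborel m)"
      by (rule nn_integral_eq_integral[OF mi]) (simp add: m_def)
    also have "\<dots> * ennreal (K0 * nrm) = ennreal (K * nrm)"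
      by (simp add: K_def mult.assoc m0 K00 nrm0 flip: ennreal_mult)
    finally have le: "(\<integral>\<^sup>+z. ennreal ((cmod (extension g z))\<^sup>2) \<partial>lborel) \<le> ennreal (K * nrm)" .
    have i: "integrable lborel (\<lambda>z. (cmod (extension g z))\<^sup>2)"
    proof (rule integrableI_bounded)
      have "(\<integral>\<^sup>+z. ennreal (norm ((cmod (extension g z))\<^sup>2)) \<partial>lborel) \<le> ennreal (K * nrm)" using le by simp
      then show "(\<integral>\<^sup>+z. ennreal (norm ((cmod (extension g z))\<^sup>2)) \<partial>lborel) < \<infinity>" by (rule le_less_trans) simp
    qed measurable
    have "ennreal (\<integral>z. (cmod (extension g z))\<^sup>2 \<partial>lborel) \<le> ennreal (K * nrm)"
      using le nn_integral_eq_integral[OF i] by simp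
    then have "(\<integral>z. (cmod (extension g z))\<^sup>2 \<partial>lborel) \<le> K * nrm"
      by (subst (asm) ennreal_le_iff) (simp_all add: K nrm0)
    then show ?thesis using i dm by (simp add: L2_iff nrm_def)
  qed
  then show ?thesis using that K by blast
qed

lemma restr_extension:
  assumes F: "F \<in> L2 lborel" and g: "integrable lborel g"
  shows "l2_inner lborel (restr F) g = l2_inner lborel F (extension g)"
proof -
  have [measurable]: "F \<in> borel_measurable borel" "g \<in> borel_measurable borel"
    using L2_measurable[OF F] g by auto
  define \<Psi> where "\<Psi> = (\<lambda>p. cnj (phase (fst p) (snd p)) * (cnj (weight (fst p) * F (fst p)) * g (snd p)))"
  have i0: "integrable lborel (\<lambda>p. cnj (weight (fst p) * F (fst p)) * g (snd p))"
    by (rule integrable_tensor(1)[OF _ g]) (use weight_mult_integrable[OF F] in \<open>simp only: integrable_cnj\<close>)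
  have i: "integrable lborel \<Psi>"
    unfolding \<Psi>_def
  proof (rule Bochner_Integration.integrable_bound[OF i0])
    have "(\<lambda>p. cnj (phase (fst p) (snd p))) \<in> borel_measurable borel" by measurable
    then show "(\<lambda>p. cnj (phase (fst p) (snd p)) * (cnj (weight (fst p) * F (fst p)) * g (snd p))) \<in> borel_measurable lborel"
      using i0 by measurable
  qed (auto simp: norm_mult)
  have "l2_inner lborel (restr F) g = (\<integral>\<xi>. \<integral>z. \<Psi> (z, \<xi>) \<partial>lborel \<partial>lborel)"
    unfolding l2_inner_def
  proof (intro Bochner_Integration.integral_cong refl)
    fix \<xi>
    have "cnj (restr F \<xi>) = (\<integral>z. cnj (phase z \<xi> * (weight z * F z)) \<partial>lborel)"
      unfolding restr_eq[OF F] by (rule Bochner_Integration.integral_cnj[symmetric])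
    then have "cnj (restr F \<xi>) * g \<xi> = (\<integral>z. cnj (phase z \<xi> * (weight z * F z)) * g \<xi> \<partial>lborel)" by simp
    then show "cnj (restr F \<xi>) * g \<xi> = (\<integral>z. \<Psi> (z, \<xi>) \<partial>lborel)" by (simp add: \<Psi>_def mult.assoc)
  qed
  also have "\<dots> = (\<integral>z. \<integral>\<xi>. \<Psi> (z, \<xi>) \<partial>lborel \<partial>lborel)"
    using lborel_fubini(3,4)[OF i] by simp
  also have "\<dots> = l2_inner lborel F (extension g)"
    unfolding l2_inner_def
  proof (intro Bochner_Integration.integral_cong refl)
    fix z
    have "(\<integral>\<xi>. \<Psi> (z, \<xi>) \<partial>lborel) = (\<integral>\<xi>. (cnj (F z) * cnj (weight z)) * (cnj (phase z \<xi>) * g \<xi>) \<partial>lborel)"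
      by (intro Bochner_Integration.integral_cong refl) (simp add: \<Psi>_def mult_ac)
    then show "(\<integral>\<xi>. \<Psi> (z, \<xi>) \<partial>lborel) = cnj (F z) * extension g z" by (simp add: extension_def mult.assoc)
  qed
  finally show ?thesis .
qed

text \<open>The operator inherits the bound of its formal adjoint: pairing \<open>restr F\<close> with its own truncation
\<open>c n\<close> gives \<open>\<parallel>c n\<parallel>\<^sup>2 \<le> \<parallel>F\<parallel> \<parallel>extension (c n)\<parallel> \<le> sqrt K \<parallel>F\<parallel> \<parallel>c n\<parallel>\<close>, uniformly in \<open>n\<close>, and the truncations
increase to \<open>|restr F|\<close>. Truncations are admissible because \<open>restr F\<close> is bounded.\<close>
lemma restr_L2:
  fixes F :: "real \<times> (real ^ 'n) \<Rightarrow> complex"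
  assumes K: "K \<ge> 0" and extension: "\<forall>g :: real ^ 'n \<Rightarrow> complex. integrable lborel g \<longrightarrow> g \<in> L2 lborel \<longrightarrow>
     extension g \<in> L2 lborel \<and> (\<integral>z. (cmod (extension g z))\<^sup>2 \<partial>lborel) \<le> K * (\<integral>\<xi>. (cmod (g \<xi>))\<^sup>2 \<partial>lborel)"
    and F: "F \<in> L2 lborel"
  shows "restr F \<in> L2 lborel" "(\<integral>\<xi>. (cmod (restr F \<xi>))\<^sup>2 \<partial>lborel) \<le> K * (\<integral>z. (cmod (F z))\<^sup>2 \<partial>lborel)"
proof -
  have restr_m [measurable]: "restr F \<in> borel_measurable borel" by (rule restr_measurable[OF F])
  define c where "c n = cutoff n (restr F)" for n
  have c2: "c n \<in> L2 lborel" for n unfolding c_def using restr_bounded[OF F] by (intro cutoff_bounded_L2) auto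
  have c1: "integrable lborel (c n)" for n
    using cutoff_integrable[OF c2[of n], of n] unfolding c_def cutoff_idem .
  define nF where "nF = (\<integral>z. (cmod (F z))\<^sup>2 \<partial>lborel)"
  have nF0: "nF \<ge> 0" unfolding nF_def by (intro integral_nonneg_AE) simp
  define q where "q n = (\<integral>\<xi>. (cmod (c n \<xi>))\<^sup>2 \<partial>lborel)" for n
  have q0: "q n \<ge> 0" for n unfolding q_def by (intro integral_nonneg_AE) simp
  have q: "q n \<le> K * nF" for n
  proof -
    have "complex_of_real (q n) = l2_inner lborel (restr F) (c n)"
      unfolding q_def l2_inner_self[symmetric] unfolding l2_inner_def
      by (intro Bochner_Integration.integral_cong refl) (simp add: c_def cutoff_def)
    also have "\<dots> = l2_inner lborel F (extension (c n))" by (rule restr_extension[OF F c1])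
    finally have "(q n)\<^sup>2 = (cmod (l2_inner lborel F (extension (c n))))\<^sup>2" by (metis norm_of_real power2_abs)
    also have "\<dots> \<le> Re (l2_inner lborel F F) * Re (l2_inner lborel (extension (c n)) (extension (c n)))"
      using extension[rule_format, OF c1 c2] by (intro L2.cauchy_schwarz F) blast
    also have "\<dots> \<le> nF * (K * q n)"
      unfolding l2_inner_self nF_def[symmetric] q_def Re_complex_of_real
      using extension[rule_format, OF c1 c2, of n] nF0 by (intro mult_left_mono) auto
    finally have "q n * q n \<le> (K * nF) * q n" by (simp add: power2_eq_square mult_ac)
    then show ?thesis
      using q0[of n] K nF0 by (cases "q n = 0") (auto simp: mult_le_cancel_right)
  qed
  have "(\<integral>\<^sup>+\<xi>. ennreal ((cmod (restr F \<xi>))\<^sup>2) \<partial>lborel) = (\<integral>\<^sup>+\<xi>. (SUP n. ennreal ((cmod (c n \<xi>))\<^sup>2)) \<partial>lborel)"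
  proof (intro nn_integral_cong antisym)
    fix \<xi> :: "real ^ 'n"
    have "\<xi> \<in> cball 0 (real (nat \<lceil>norm \<xi>\<rceil>))" by (simp add: real_nat_ceiling_ge)
    then have "ennreal ((cmod (restr F \<xi>))\<^sup>2) \<le> ennreal ((cmod (c (nat \<lceil>norm \<xi>\<rceil>) \<xi>))\<^sup>2)"
      by (simp add: c_def cutoff_def)
    also have "\<dots> \<le> (SUP n. ennreal ((cmod (c n \<xi>))\<^sup>2))" by (rule SUP_upper) simp
    finally show "ennreal ((cmod (restr F \<xi>))\<^sup>2) \<le> (SUP n. ennreal ((cmod (c n \<xi>))\<^sup>2))" .
    show "(SUP n. ennreal ((cmod (c n \<xi>))\<^sup>2)) \<le> ennreal ((cmod (restr F \<xi>))\<^sup>2)"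
      by (rule SUP_least) (simp add: c_def cutoff_def)
  qed
  also have "\<dots> = (SUP n. \<integral>\<^sup>+\<xi>. ennreal ((cmod (c n \<xi>))\<^sup>2) \<partial>lborel)"
  proof (rule nn_integral_monotone_convergence_SUP)
    show "incseq (\<lambda>n \<xi>. ennreal ((cmod (c n \<xi>))\<^sup>2))"
      by (auto simp: incseq_def le_fun_def c_def cutoff_def)
    show "(\<lambda>\<xi>. ennreal ((cmod (c n \<xi>))\<^sup>2)) \<in> borel_measurable lborel" for n
      unfolding c_def by measurable
  qed
  also have "\<dots> \<le> ennreal (K * nF)"
  proof (rule SUP_least)
    fix n
    have "(\<integral>\<^sup>+\<xi>. ennreal ((cmod (c n \<xi>))\<^sup>2) \<partial>lborel) = ennreal (q n)"
      unfolding q_def using c2[of n] by (intro nn_integral_eq_integral) (auto simp: L2_iff)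
    then show "(\<integral>\<^sup>+\<xi>. ennreal ((cmod (c n \<xi>))\<^sup>2) \<partial>lborel) \<le> ennreal (K * nF)"
      using q by (simp add: ennreal_leI)
  qed
  finally have le: "(\<integral>\<^sup>+\<xi>. ennreal ((cmod (restr F \<xi>))\<^sup>2) \<partial>lborel) \<le> ennreal (K * nF)" .
  have i: "integrable lborel (\<lambda>\<xi>. (cmod (restr F \<xi>))\<^sup>2)"
  proof (rule integrableI_bounded)
    have "(\<integral>\<^sup>+z. ennreal (norm ((cmod (restr F z))\<^sup>2)) \<partial>lborel) \<le> ennreal (K * nF)" using le by simp
    then show "(\<integral>\<^sup>+z. ennreal (norm ((cmod (restr F z))\<^sup>2)) \<partial>lborel) < \<infinity>" by (rule le_less_trans) simp
  qed measurable
  then show "restr F \<in> L2 lborel" by (simp add: L2_iff)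
  have "ennreal (\<integral>z. (cmod (restr F z))\<^sup>2 \<partial>lborel) \<le> ennreal (K * nF)"
    using le nn_integral_eq_integral[OF i] by simp
  then show "(\<integral>z. (cmod (restr F z))\<^sup>2 \<partial>lborel) \<le> K * (\<integral>z. (cmod (F z))\<^sup>2 \<partial>lborel)"
    by (subst (asm) ennreal_le_iff) (simp_all add: K nF0 nF_def)
qed

text \<open>Truncations of \<open>g\<close> that converge fast enough have extensions that converge, by the bound for
\<open>extension\<close> applied to their differences; the limit represents the functional.\<close>
lemma adjoint_value_exists:
  fixes g :: "real ^ 'n \<Rightarrow> complex"
  assumes K: "K \<ge> 0" and extension: "\<forall>g :: real ^ 'n \<Rightarrow> complex. integrable lborel g \<longrightarrow> g \<in> L2 lborel \<longrightarrow>
     extension g \<in> L2 lborel \<and> (\<integral>z. (cmod (extension g z))\<^sup>2 \<partial>lborel) \<le> K * (\<integral>\<xi>. (cmod (g \<xi>))\<^sup>2 \<partial>lborel)"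
    and g: "g \<in> L2 lborel"
  shows "\<exists>h\<in>L2 lborel. \<forall>F\<in>L2 lborel. l2_inner lborel (restr F) g = l2_inner lborel F h"
proof -
  let ?e = "\<lambda>n. \<integral>\<xi>. (cmod (cutoff n g \<xi> - g \<xi>))\<^sup>2 \<partial>lborel"
  have "\<exists>n. ?e n < (1 / 16) ^ k" for k :: nat
    using order_tendstoD(2)[OF cutoff_tendsto[OF g], of "(1 / 16) ^ k"] by (auto simp: eventually_sequentially)
  then obtain \<rho> where \<rho>: "\<And>k. ?e (\<rho> k) < (1 / 16) ^ k" by metis
  define c where "c k = cutoff (\<rho> k) g" for k
  have c2: "c k \<in> L2 lborel" and c1: "integrable lborel (c k)" for k
    unfolding c_def by (intro cutoff_L2 cutoff_integrable g)+
  have ce: "(\<integral>\<xi>. (cmod (c k \<xi> - g \<xi>))\<^sup>2 \<partial>lborel) < (1 / 16) ^ k" for k using \<rho> by (simp add: c_def)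
  have step: "(\<integral>z. (cmod (extension (c (Suc k)) z - extension (c k) z))\<^sup>2 \<partial>lborel) \<le> (4 * K) * (1 / 16) ^ k" for k
  proof -
    let ?d = "\<lambda>\<xi>. c (Suc k) \<xi> - c k \<xi>"
    have d2: "?d \<in> L2 lborel" and d1: "integrable lborel ?d"
      by (intro L2.diff_closed c2) (intro Bochner_Integration.integrable_diff c1)
    have i: "integrable lborel (\<lambda>\<xi>. (cmod (c k \<xi> - g \<xi>))\<^sup>2)" for k
      using L2.diff_closed[OF c2[of k] g] by (simp add: L2_iff)
    have "(\<integral>\<xi>. (cmod (?d \<xi>))\<^sup>2 \<partial>lborel)
       \<le> (\<integral>\<xi>. 2 * (cmod (c (Suc k) \<xi> - g \<xi>))\<^sup>2 + 2 * (cmod (c k \<xi> - g \<xi>))\<^sup>2 \<partial>lborel)"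
    proof (rule integral_mono)
      show "integrable lborel (\<lambda>\<xi>. (cmod (?d \<xi>))\<^sup>2)" using d2 by (simp add: L2_iff)
      show "(cmod (?d \<xi>))\<^sup>2 \<le> 2 * (cmod (c (Suc k) \<xi> - g \<xi>))\<^sup>2 + 2 * (cmod (c k \<xi> - g \<xi>))\<^sup>2" for \<xi>
      proof -
        have "(cmod (?d \<xi>))\<^sup>2 \<le> (cmod (c (Suc k) \<xi> - g \<xi>) + cmod (c k \<xi> - g \<xi>))\<^sup>2"
          using norm_triangle_ineq4[of "c (Suc k) \<xi> - g \<xi>" "c k \<xi> - g \<xi>"] by (intro power_mono) auto
        also have "\<dots> \<le> 2 * (cmod (c (Suc k) \<xi> - g \<xi>))\<^sup>2 + 2 * (cmod (c k \<xi> - g \<xi>))\<^sup>2"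
          using sum_squares_bound[of "cmod (c (Suc k) \<xi> - g \<xi>)" "cmod (c k \<xi> - g \<xi>)"] by (simp add: power2_sum)
        finally show ?thesis .
      qed
    qed (use i in auto)
    also have "\<dots> = 2 * (\<integral>\<xi>. (cmod (c (Suc k) \<xi> - g \<xi>))\<^sup>2 \<partial>lborel) + 2 * (\<integral>\<xi>. (cmod (c k \<xi> - g \<xi>))\<^sup>2 \<partial>lborel)"
      using i by simp
    also have "\<dots> \<le> 2 * (1 / 16) ^ Suc k + 2 * (1 / 16) ^ k"
      using ce[of "Suc k"] ce[of k] by linarith
    also have "\<dots> \<le> 4 * (1 / 16) ^ k" by simp
    finally have d4: "(\<integral>\<xi>. (cmod (?d \<xi>))\<^sup>2 \<partial>lborel) \<le> 4 * (1 / 16) ^ k" .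
    have "(\<integral>z. (cmod (extension ?d z))\<^sup>2 \<partial>lborel) \<le> K * (\<integral>\<xi>. (cmod (?d \<xi>))\<^sup>2 \<partial>lborel)"
      using extension[rule_format, OF d1 d2] by blast
    also have "\<dots> \<le> K * (4 * (1 / 16) ^ k)" by (rule mult_left_mono[OF d4 K])
    finally show ?thesis using extension_diff[OF c1 c1] by (simp add: mult_ac)
  qed
  have "extension (c k) \<in> L2 lborel" for k using extension[rule_format, OF c1 c2] by blast
  then obtain h where h: "h \<in> L2 lborel"
      "\<And>u. u \<in> L2 lborel \<Longrightarrow> (\<lambda>k. l2_inner lborel u (extension (c k))) \<longlonglongrightarrow> l2_inner lborel u h"
    using L2_rapidly_cauchy_converges[of "\<lambda>k. extension (c k)" lborel "4 * K"] step by blast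
  have "l2_inner lborel (restr F) g = l2_inner lborel F h" if F: "F \<in> L2 lborel" for F
  proof -
    have "(\<lambda>k. \<integral>\<xi>. (cmod (c k \<xi> - g \<xi>))\<^sup>2 \<partial>lborel) \<longlonglongrightarrow> 0"
    proof (rule tendsto_sandwich[where f = "\<lambda>_. 0" and h = "\<lambda>k. (1 / 16) ^ k"])
      show "(\<lambda>k. (1 / 16 :: real) ^ k) \<longlonglongrightarrow> 0" by (rule LIMSEQ_power_zero) simp
      show "\<forall>\<^sub>F k in sequentially. (\<integral>\<xi>. (cmod (c k \<xi> - g \<xi>))\<^sup>2 \<partial>lborel) \<le> (1 / 16) ^ k"
        using ce by (intro always_eventually allI less_imp_le)
      show "\<forall>\<^sub>F k in sequentially. 0 \<le> (\<integral>\<xi>. (cmod (c k \<xi> - g \<xi>))\<^sup>2 \<partial>lborel)"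
        by (intro always_eventually allI integral_nonneg_AE AE_I2) simp
    qed (rule tendsto_const)
    then have "(\<lambda>k. l2_inner lborel (restr F) (c k)) \<longlonglongrightarrow> l2_inner lborel (restr F) g"
      by (intro L2.conv_right c2 g restr_L2(1)[OF K extension F]) (auto simp: l2_inner_self)
    then have "(\<lambda>k. l2_inner lborel F (extension (c k))) \<longlonglongrightarrow> l2_inner lborel (restr F) g"
      by (simp add: restr_extension[OF F c1])
    then show ?thesis using h(2)[OF F] LIMSEQ_unique by blast
  qed
  then show ?thesis using h(1) by blast
qed

text \<open>This makes the operator of the theorem a genuine \<open>T\<^sup>* T\<close>: without an adjoint, the choice in
\<open>l2_adjoint\<close> would carry no information.\<close>
lemma restr_gram_operator:
  "\<exists>B K. gram_operator (lborel :: (real \<times> (real ^ 'n)) measure) (lborel :: (real ^ 'n) measure) restr B K"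
proof -
  obtain K where K: "K \<ge> 0" and extension: "\<forall>g :: real ^ 'n \<Rightarrow> complex. integrable lborel g \<longrightarrow> g \<in> L2 lborel \<longrightarrow>
     extension g \<in> L2 lborel \<and> (\<integral>z. (cmod (extension g z))\<^sup>2 \<partial>lborel) \<le> K * (\<integral>\<xi>. (cmod (g \<xi>))\<^sup>2 \<partial>lborel)"
    using extension_bounded by blast
  have "\<forall>g :: real ^ 'n \<Rightarrow> complex. \<exists>h :: real \<times> (real ^ 'n) \<Rightarrow> complex. g \<in> L2 lborel \<longrightarrow> h \<in> L2 lborel \<and> (\<forall>F\<in>L2 lborel. l2_inner lborel (restr F) g = l2_inner lborel F h)"
    using adjoint_value_exists[OF K extension] by blast
  then obtain B where B: "\<And>g :: real ^ 'n \<Rightarrow> complex. g \<in> L2 lborel \<Longrightarrow> B g \<in> L2 lborel \<and> (\<forall>F\<in>L2 lborel. l2_inner lborel (restr F) g = l2_inner lborel F (B g))"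
    by metis
  have "gram_operator lborel lborel restr B K"
  proof
    fix F :: "real \<times> (real ^ 'n) \<Rightarrow> complex" assume F: "F \<in> L2 lborel"
    show "restr F \<in> L2 lborel" by (rule restr_L2(1)[OF K extension F])
    show "Re (l2_inner lborel (restr F) (restr F)) \<le> K * Re (l2_inner lborel F F)"
      using restr_L2(2)[OF K extension F] by (simp add: l2_inner_self)
  next
    show "is_l2_adjoint lborel lborel restr B" using B by (simp add: is_l2_adjoint_def)
  qed
  then show ?thesis by blast
qed

end

section \<open>Mixed norms of the Gaussian weights\<close>
lemma Lp_norm_ennreal:
  assumes "p \<ge> 1" and u: "\<And>x. u x \<ge> 0" and i: "integrable M (\<lambda>x. u x powr p)"
  shows "Lp_norm (ennreal p) M (\<lambda>x. ennreal (u x)) = ennreal ((\<integral>x. u x powr p \<partial>M) powr (1 / p))"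
proof -
  have "(\<integral>\<^sup>+x. ennreal_powr (ennreal (u x)) p \<partial>M) = ennreal (\<integral>x. u x powr p \<partial>M)"
    using u i by (subst nn_integral_eq_integral[symmetric]) (auto simp: ennreal_powr_def)
  then show ?thesis using assms(1) by (simp add: Lp_norm_def ennreal_powr_def integral_nonneg_AE)
qed

lemma gaussian_scaling:
  fixes N a :: real
  assumes "N > 0" "a > 0"
  shows "(\<integral>t. exp (- (a * (t / N)\<^sup>2)) \<partial>lborel) = N * (\<integral>t. exp (- (a * t\<^sup>2)) \<partial>lborel)"
  using lborel_integral_real_affine[of N "\<lambda>t. exp (- (a * (t / N)\<^sup>2))" 0] assms by simp

lemma mixed_norm_gauss_weight_le:
  assumes Q: "Q \<ge> 1"
  obtains D where "D > 0"
    "\<And>P N. P \<ge> 1 \<Longrightarrow> N \<ge> 1 \<Longrightarrow>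
       mixed_norm (ennreal P) (ennreal Q) (gauss_weight N :: real \<times> (real ^ 'n) \<Rightarrow> complex)
         = ennreal (D * (\<integral>t. exp (- (P * t\<^sup>2)) \<partial>lborel) powr (1 / P) * N powr (1 / P))"
    "\<And>N. mixed_norm \<infinity> (ennreal Q) (gauss_weight N :: real \<times> (real ^ 'n) \<Rightarrow> complex) \<le> ennreal D"
proof -
  define I where "I = integral\<^sup>L lborel (\<lambda>x::real ^ 'n. exp (- (Q * (norm x)\<^sup>2)))"
  define D where "D = I powr (1 / Q)"
  have i: "integrable lborel (\<lambda>x::real ^ 'n. exp (- (Q * (norm x)\<^sup>2)))"
    using Q by (intro integrable_gaussian) simp
  have I0: "I > 0"
  proof -
    have "I \<ge> 0" unfolding I_def by (intro integral_nonneg_AE) simp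
    moreover have "I \<noteq> 0"
    proof
      assume "I = 0"
      then have "AE x in (lborel :: (real ^ 'n) measure). exp (- (Q * (norm x)\<^sup>2)) = 0"
        using integral_nonneg_eq_0_iff_AE[OF i] by (simp add: I_def)
      then have "AE x in (lborel :: (real ^ 'n) measure). False" by simp
      then show False by (simp add: AE_iff_null null_sets_def)
    qed
    ultimately show ?thesis by simp
  qed
  have D0: "D > 0" using I0 by (simp add: D_def)
  define m where "m N t = exp (- (t / N)\<^sup>2)" for N t :: real
  have m1: "m N t \<le> 1" "m N t > 0" for N t by (simp_all add: m_def)
  have mm [measurable]: "m N \<in> borel_measurable borel" for N unfolding m_def[abs_def] by measurable
  have inner: "Lp_norm (ennreal Q) lborel (\<lambda>x::real ^ 'n. ennreal (cmod (gauss_weight N (t, x)))) = ennreal (D * m N t)" for N t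
  proof -
    have e: "cmod (gauss_weight N (t, x)) powr Q = m N t powr Q * exp (- (Q * (norm x)\<^sup>2))" for x :: "real ^ 'n"
      by (simp add: gauss_weight_def m_def exp_powr_real mult_exp_exp algebra_simps)
    have "Lp_norm (ennreal Q) lborel (\<lambda>x::real ^ 'n. ennreal (cmod (gauss_weight N (t, x))))
       = ennreal ((integral\<^sup>L lborel (\<lambda>x::real ^ 'n. cmod (gauss_weight N (t, x)) powr Q)) powr (1 / Q))"
      by (rule Lp_norm_ennreal[OF Q]) (use i in \<open>auto simp: e\<close>)
    also have "integral\<^sup>L lborel (\<lambda>x::real ^ 'n. cmod (gauss_weight N (t, x)) powr Q) = m N t powr Q * I"
      by (simp add: e I_def)
    also have "(m N t powr Q * I) powr (1 / Q) = D * m N t"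
      using Q I0 m1[of N t] by (simp add: powr_mult powr_powr D_def)
    finally show ?thesis .
  qed
  show ?thesis
  proof (rule that[OF D0])
    fix P N :: real assume P: "P \<ge> 1" and N: "N \<ge> 1"
    have e: "(D * m N t) powr P = D powr P * exp (- (P * (t / N)\<^sup>2))" for t
      using D0 by (simp add: powr_mult m_def exp_powr_real algebra_simps)
    have "integrable lborel (\<lambda>t. exp (- ((P / N\<^sup>2) * t\<^sup>2)))"
      using P N by (intro integrable_gaussian_real) simp
    then have i2: "integrable lborel (\<lambda>t. exp (- (P * (t / N)\<^sup>2)))" by (simp add: power_divide)
    define J where "J = (\<integral>t. exp (- (P * t\<^sup>2)) \<partial>lborel)"
    have J0: "J \<ge> 0" unfolding J_def by (intro integral_nonneg_AE) simp
    have "mixed_norm (ennreal P) (ennreal Q) (gauss_weight N :: real \<times> (real ^ 'n) \<Rightarrow> complex)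
       = Lp_norm (ennreal P) lborel (\<lambda>t. ennreal (D * m N t))"
      by (simp add: mixed_norm_def inner)
    also have "\<dots> = ennreal ((\<integral>t. (D * m N t) powr P \<partial>lborel) powr (1 / P))"
      by (rule Lp_norm_ennreal[OF P]) (use i2 D0 m1 in \<open>auto simp: e less_imp_le\<close>)
    also have "(\<integral>t. (D * m N t) powr P \<partial>lborel) = D powr P * (N * J)"
      using gaussian_scaling[of N P] N P by (simp add: e J_def)
    also have "(D powr P * (N * J)) powr (1 / P) = D * J powr (1 / P) * N powr (1 / P)"
      using P N D0 J0 by (simp add: powr_mult powr_powr)
    finally show "mixed_norm (ennreal P) (ennreal Q) (gauss_weight N :: real \<times> (real ^ 'n) \<Rightarrow> complex)
         = ennreal (D * (\<integral>t. exp (- (P * t\<^sup>2)) \<partial>lborel) powr (1 / P) * N powr (1 / P))"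
      by (simp add: J_def)
  next
    fix N :: real
    have "mixed_norm \<infinity> (ennreal Q) (gauss_weight N :: real \<times> (real ^ 'n) \<Rightarrow> complex) = Lp_norm \<infinity> lborel (\<lambda>t. ennreal (D * m N t))"
      by (simp add: mixed_norm_def inner)
    also have "\<dots> = esssup lborel (\<lambda>t. ennreal (D * m N t))" by (simp add: Lp_norm_def)
    also have "\<dots> \<le> ennreal D"
      using D0 m1(1) by (intro esssup_I) (auto intro!: ennreal_leI mult_left_le less_imp_le)
    finally show "mixed_norm \<infinity> (ennreal Q) (gauss_weight N :: real \<times> (real ^ 'n) \<Rightarrow> complex) \<le> ennreal D" .
  qed
qed

section \<open>Test functions on disjoint time slabs\<close>
definition slab :: "nat \<Rightarrow> (real \<times> (real ^ 'n)) set" where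
  "slab j = {real j..<real j + 1} \<times> cbox 0 One"

definition slab_fun :: "nat \<Rightarrow> real \<times> (real ^ 'n) \<Rightarrow> complex" where
  "slab_fun j = indicator (slab j)"

lemma slab_sets [measurable]: "(slab j :: (real \<times> (real ^ 'n)) set) \<in> sets borel"
  unfolding slab_def borel_prod[symmetric] by (intro pair_measureI) auto

lemma emeasure_slab: "emeasure lborel (slab j :: (real \<times> (real ^ 'n)) set) = 1"
proof -
  have "emeasure lborel (slab j :: (real \<times> (real ^ 'n)) set)
     = emeasure lborel {real j..<real j + 1} * emeasure lborel (cbox 0 One :: (real ^ 'n) set)"
    unfolding slab_def lborel_prod[symmetric] by (rule lborel.emeasure_pair_measure_Times) auto
  also have "emeasure lborel (cbox 0 One :: (real ^ 'n) set) = 1"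
    by (subst emeasure_lborel_cbox) auto
  finally show ?thesis by simp
qed

lemma slab_fun_measurable [measurable]: "slab_fun j \<in> borel_measurable borel"
  unfolding slab_fun_def by measurable

lemma slab_fun_L2: "(slab_fun j :: real \<times> (real ^ 'n) \<Rightarrow> complex) \<in> L2 lborel"
proof -
  have "(\<lambda>z::real \<times> (real ^ 'n). (cmod (slab_fun j z))\<^sup>2) = indicator (slab j)"
    by (auto simp: slab_fun_def fun_eq_iff split: split_indicator)
  moreover have "integrable lborel (indicator (slab j) :: real \<times> (real ^ 'n) \<Rightarrow> real)"
    by (intro integrable_real_indicator) (simp_all add: emeasure_slab)
  ultimately show ?thesis by (simp add: L2_iff)
qed

lemma slab_fun_orthonormal:
  "L2.orthonormal lborel S (slab_fun :: nat \<Rightarrow> real \<times> (real ^ 'n) \<Rightarrow> complex)"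
  unfolding L2.orthonormal_def
proof (intro conjI ballI slab_fun_L2)
  fix i j
  show "l2_inner lborel (slab_fun i) (slab_fun j :: real \<times> (real ^ 'n) \<Rightarrow> complex) = (if i = j then 1 else 0)"
  proof (cases "i = j")
    case True
    have "(\<lambda>z::real \<times> (real ^ 'n). (cmod (slab_fun i z))\<^sup>2) = indicator (slab i)"
      by (auto simp: slab_fun_def fun_eq_iff split: split_indicator)
    then show ?thesis using True by (simp add: l2_inner_self measure_def emeasure_slab)
  next
    case False
    then have "real i + 1 \<le> real j \<or> real j + 1 \<le> real i" by linarith
    then have "(\<lambda>z::real \<times> (real ^ 'n). cnj (slab_fun i z) * slab_fun j z) = (\<lambda>z. 0)"
      by (auto simp: slab_fun_def slab_def indicator_def fun_eq_iff)
    then show ?thesis using False by (simp add: l2_inner_def del: mult_eq_0_iff)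
  qed
qed

lemma cos_ge_half: "\<bar>\<theta>\<bar> \<le> 1 \<Longrightarrow> cos \<theta> \<ge> 1 / 2" for \<theta> :: real
proof -
  assume "\<bar>\<theta>\<bar> \<le> 1"
  then have "cos (pi / 3) \<le> cos \<bar>\<theta>\<bar>" using pi_gt3 by (intro cos_monotone_0_pi_le) auto
  then show ?thesis by (simp add: cos_60)
qed

text \<open>On the slab, \<open>x\<close> is bounded and \<open>t\<close> differs from \<open>j\<close> by at most 1. For small \<open>\<xi>\<close> the oscillating factor,
multiplied by the constant \<open>exp (- i j |\<xi>|\<^sup>2)\<close> of modulus 1, therefore has a phase \<open>\<theta>\<close> with
\<open>|\<theta>| \<le> 1\<close>, so there is no cancellation. The weight is bounded below on the slab because \<open>t \<le> N\<close>. The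
resulting constant depends on the dimension only.\<close>
lemma slab_energy_ge:
  obtains c where "c > 0" "\<And>N j. j < N \<Longrightarrow>
    c \<le> Re (l2_inner lborel (weighted_restriction (gauss_weight (real N)) (slab_fun j))
         (weighted_restriction (gauss_weight (real N)) (slab_fun j :: real \<times> (real ^ 'n) \<Rightarrow> complex)))"
proof -
  obtain b where b: "b > 0" "\<And>x::real ^ 'n. x \<in> cbox 0 One \<Longrightarrow> norm x \<le> b"
    using bounded_cbox[of 0 "One :: real ^ 'n"] by (auto simp: bounded_pos)
  define r where "r = min (1 / 2) (1 / (2 * b))"
  have r: "r > 0" "r \<le> 1 / 2" "b * r \<le> 1 / 2" using b(1) by (auto simp: r_def min_def field_simps)
  define \<kappa> where "\<kappa> = exp (- (1 + b\<^sup>2)) / 2"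
  define B where "B = (ball 0 r :: (real ^ 'n) set)"
  define c where "c = \<kappa>\<^sup>2 * measure lborel B"
  have Bfin: "emeasure lborel B < \<infinity>" unfolding B_def using emeasure_bounded_finite[OF bounded_ball] by auto
  have "emeasure lborel B \<noteq> 0"
  proof
    assume "emeasure lborel B = 0"
    then have "negligible B" by (simp add: negligible_iff_null_sets null_sets_def null_setsI completion.complete B_def null_sets_completionI)
    then show False using open_not_negligible[of B] r(1) by (simp add: B_def)
  qed
  then have "measure lborel B > 0" using Bfin by (simp add: measure_def enn2real_positive_iff less_top zero_less_iff_neq_zero)
  then have "c > 0" by (simp add: c_def \<kappa>_def)
  moreover have "c \<le> Re (l2_inner lborel (weighted_restriction (gauss_weight (real N)) (slab_fun j))
         (weighted_restriction (gauss_weight (real N)) (slab_fun j :: real \<times> (real ^ 'n) \<Rightarrow> complex)))"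
    if j: "j < N" for N j
  proof -
    let ?W = "gauss_weight (real N) :: real \<times> (real ^ 'n) \<Rightarrow> complex"
    let ?F = "slab_fun j :: real \<times> (real ^ 'n) \<Rightarrow> complex"
    have N: "real N \<ge> 1" using j by simp
    obtain A K where "gram_operator (lborel :: (real \<times> (real ^ 'n)) measure) (lborel :: (real ^ 'n) measure) (weighted_restriction ?W) A K"
      using restr_gram_operator[OF N] by blast
    then have RL2: "weighted_restriction ?W ?F \<in> L2 lborel"
      using slab_fun_L2 by (rule gram_operator.T_closed)
    have low: "\<kappa> \<le> cmod (weighted_restriction ?W ?F \<xi>)" if \<xi>: "\<xi> \<in> B" for \<xi>
    proof -
      define u where "u = exp (- \<i> * complex_of_real (real j * (norm \<xi>)\<^sup>2))"
      have nu: "cmod u = 1" by (simp add: u_def)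
      have \<xi>r: "norm \<xi> \<le> r" using \<xi> by (simp add: B_def)
      have i0: "integrable lborel (\<lambda>z. phase z \<xi> * (?W z * ?F z))"
        by (rule Bochner_Integration.integrable_bound[OF weight_mult_integrable[OF N slab_fun_L2]])
           (auto simp: norm_mult)
      then have i: "integrable lborel (\<lambda>z. u * (phase z \<xi> * (?W z * ?F z)))" by simp
      have "\<kappa> = (\<integral>z. \<kappa> * indicator (slab j :: (real \<times> (real ^ 'n)) set) z \<partial>lborel)"
        by (simp add: measure_def emeasure_slab)
      also have "\<dots> \<le> (\<integral>z. Re (u * (phase z \<xi> * (?W z * ?F z))) \<partial>lborel)"
      proof (rule integral_mono)
        show "integrable lborel (\<lambda>z. \<kappa> * indicator (slab j :: (real \<times> (real ^ 'n)) set) z)"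
          by (intro integrable_mult_right integrable_real_indicator) (simp_all add: emeasure_slab)
        show "integrable lborel (\<lambda>z. Re (u * (phase z \<xi> * (?W z * ?F z))))" using i by (rule integrable_Re)
        fix z :: "real \<times> (real ^ 'n)"
        show "\<kappa> * indicator (slab j) z \<le> Re (u * (phase z \<xi> * (?W z * ?F z)))"
        proof (cases "z \<in> slab j")
          case True
          obtain t x where z: "z = (t, x)" by (cases z)
          have t: "real j \<le> t" "t \<le> real j + 1" and x: "norm x \<le> b"
            using True b(2) by (auto simp: z slab_def)
          define \<theta> where "\<theta> = x \<bullet> \<xi> - (t - real j) * (norm \<xi>)\<^sup>2"
          have "\<bar>x \<bullet> \<xi>\<bar> \<le> b * r"
            by (rule order_trans[OF Cauchy_Schwarz_ineq2 mult_mono]) (use x \<xi>r b(1) in auto)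
          moreover have "\<bar>(t - real j) * (norm \<xi>)\<^sup>2\<bar> \<le> 1 * (1 / 2)"
          proof -
            have "(norm \<xi>)\<^sup>2 \<le> (1 / 2)\<^sup>2" using \<xi>r r(2) by (intro power_mono) auto
            also have "\<dots> \<le> 1 / 2" by (simp add: power2_eq_square)
            finally show ?thesis using t unfolding abs_mult by (intro mult_mono) auto
          qed
          ultimately have "\<bar>\<theta>\<bar> \<le> 1" using r(3) by (simp add: \<theta>_def)
          then have cos: "cos \<theta> \<ge> 1 / 2" by (rule cos_ge_half)
          have "u * phase z \<xi> = exp (\<i> * complex_of_real (- \<theta>))"
            by (simp add: u_def phase_def z \<theta>_def mult_exp_exp algebra_simps)
          then have up: "Re (u * phase z \<xi>) = cos \<theta>" by (simp add: Re_exp)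
          define w where "w = exp (- ((t / real N)\<^sup>2 + (norm x)\<^sup>2))"
          have "t / real N \<le> 1" using t j N by (simp add: field_simps)
          then have "(t / real N)\<^sup>2 \<le> 1" using t(1) N by (intro power_le_one) auto
          moreover have "(norm x)\<^sup>2 \<le> b\<^sup>2" using x by (intro power_mono) auto
          ultimately have w: "exp (- (1 + b\<^sup>2)) \<le> w" by (simp add: w_def)
          have "u * (phase z \<xi> * (?W z * ?F z)) = (u * phase z \<xi>) * complex_of_real w"
            using True by (simp add: gauss_weight_def slab_fun_def w_def z mult_ac)
          moreover have "Re (v * complex_of_real w) = Re v * w" for v by simp
          ultimately have "Re (u * (phase z \<xi> * (?W z * ?F z))) = cos \<theta> * w" using up by (simp only:)
          also have "\<dots> \<ge> (1 / 2) * exp (- (1 + b\<^sup>2))" using cos w by (intro mult_mono) auto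
          finally show ?thesis using True by (simp add: \<kappa>_def)
        qed (simp add: slab_fun_def)
      qed
      also have "\<dots> = Re (u * weighted_restriction ?W ?F \<xi>)"
        unfolding restr_eq[OF N slab_fun_L2] integral_mult_right_zero[symmetric] by (rule integral_Re[OF i])
      also have "\<dots> \<le> cmod (u * weighted_restriction ?W ?F \<xi>)" by (rule complex_Re_le_cmod)
      finally show ?thesis by (simp add: norm_mult nu)
    qed
    have "c = (\<integral>\<xi>. \<kappa>\<^sup>2 * indicator B \<xi> \<partial>lborel)" by (simp add: c_def B_def)
    also have "\<dots> \<le> (\<integral>\<xi>. (cmod (weighted_restriction ?W ?F \<xi>))\<^sup>2 \<partial>lborel)"
    proof (rule integral_mono)
      show "integrable lborel (\<lambda>\<xi>. \<kappa>\<^sup>2 * indicator B \<xi>)"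
        using Bfin by (intro integrable_mult_right integrable_real_indicator) (simp_all add: B_def)
      show "integrable lborel (\<lambda>\<xi>. (cmod (weighted_restriction ?W ?F \<xi>))\<^sup>2)" using RL2 by (simp add: L2_iff)
      show "\<kappa>\<^sup>2 * indicator B \<xi> \<le> (cmod (weighted_restriction ?W ?F \<xi>))\<^sup>2" for \<xi>
        using low[of \<xi>] by (auto simp: \<kappa>_def intro!: power_mono split: split_indicator)
    qed
    finally show ?thesis by (simp add: l2_inner_self)
  qed
  ultimately show ?thesis using that by blast
qed

text \<open>If the Schatten sum \<open>I\<close> is finite, only finitely many singular values exceed \<open>c / 2\<close>, and these satisfy
\<open>\<mu> n \<le> (c / 2) powr (1 - a) * \<mu> n powr a\<close>, which converts the bound on their sum into one on \<open>I\<close>.\<close>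
lemma (in gram_operator) schatten_norm_ge:
  assumes a: "a \<ge> 1" and c: "c > 0"
    and F: "L2.orthonormal M {..<k} F" "\<And>j. j < k \<Longrightarrow> c \<le> Re (l2_inner N (T (F j)) (T (F j)))"
  shows "ennreal (real k powr (1 / a) * (c / 2)) \<le> schatten_norm (ennreal a) M gram"
proof -
  have "ennreal (real k powr (1 / a) * (c / 2)) \<le> Lp_norm (ennreal a) (count_space UNIV) (\<lambda>n. ennreal (\<mu> n))"
    if comp: "l2_compact M gram" and sv: "singular_value_seq M gram \<mu>" for \<mu>
  proof -
    have \<mu>0: "\<mu> n \<ge> 0" for n using sv by (simp add: singular_value_seq_def)
    define I where "I = (\<integral>\<^sup>+n. ennreal (\<mu> n powr a) \<partial>count_space UNIV)"
    have L: "Lp_norm (ennreal a) (count_space UNIV) (\<lambda>n. ennreal (\<mu> n)) = ennreal_powr I (1 / a)"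
      using a \<mu>0 by (simp add: Lp_norm_def I_def ennreal_powr_def)
    show ?thesis
    proof (cases "I = \<infinity>")
      case True
      then show ?thesis by (simp add: L ennreal_powr_def)
    next
      case False
      define S where "S = {n. \<mu> n > c / 2}"
      have big: "(c / 2) powr a \<le> \<mu> n powr a" if "n \<in> S" for n
        using that a c by (intro powr_mono2) (auto simp: S_def)
      have fin: "finite S"
      proof (rule ccontr)
        assume inf: "infinite S"
        have "\<infinity> = ennreal ((c / 2) powr a) * emeasure (count_space UNIV) S"
          using c inf by (simp add: ennreal_mult_top)
        also have "\<dots> = (\<integral>\<^sup>+n. ennreal ((c / 2) powr a) * indicator S n \<partial>count_space UNIV)"
          by (rule nn_integral_cmult_indicator[symmetric]) simp
        also have "\<dots> \<le> I"
          unfolding I_def using big by (intro nn_integral_mono) (auto split: split_indicator intro: ennreal_leI)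
        finally show False using False by (simp add: top_unique)
      qed
      have "real k * (c / 2) \<le> (\<Sum>n\<in>S. \<mu> n)"
        using singular_values_sum_ge[OF comp sv _ c F] fin by (simp add: S_def)
      also have "\<dots> \<le> (\<Sum>n\<in>S. (c / 2) powr (1 - a) * \<mu> n powr a)"
      proof (rule sum_mono)
        fix n assume "n \<in> S"
        then have n: "\<mu> n > c / 2" "\<mu> n > 0" using c by (auto simp: S_def)
        have "\<mu> n = \<mu> n powr (1 - a) * \<mu> n powr a" using n by (simp add: powr_add[symmetric])
        also have "\<dots> \<le> (c / 2) powr (1 - a) * \<mu> n powr a"
          using n a c by (intro mult_right_mono powr_mono2') auto
        finally show "\<mu> n \<le> (c / 2) powr (1 - a) * \<mu> n powr a" .
      qed
      also have "\<dots> = (c / 2) powr (1 - a) * (\<Sum>n\<in>S. \<mu> n powr a)" by (simp add: sum_distrib_left)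
      finally have "(c / 2) powr (a - 1) * (real k * (c / 2))
          \<le> (c / 2) powr (a - 1) * ((c / 2) powr (1 - a) * (\<Sum>n\<in>S. \<mu> n powr a))"
        by (rule mult_left_mono) simp
      also have "(c / 2) powr (a - 1) * ((c / 2) powr (1 - a) * (\<Sum>n\<in>S. \<mu> n powr a)) = (\<Sum>n\<in>S. \<mu> n powr a)"
        using c by (simp add: powr_add[symmetric] mult.assoc[symmetric])
      also have "(c / 2) powr (a - 1) * (real k * (c / 2)) = real k * (c / 2) powr a"
        using c by (simp add: powr_diff)
      finally have S: "real k * (c / 2) powr a \<le> (\<Sum>n\<in>S. \<mu> n powr a)" .
      have "ennreal (real k * (c / 2) powr a) \<le> (\<Sum>n\<in>S. ennreal (\<mu> n powr a))"
        using S by (subst sum_ennreal) (auto intro: ennreal_leI)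
      also have "\<dots> = (\<integral>\<^sup>+n. ennreal (\<mu> n powr a) \<partial>count_space S)"
        using fin by (simp add: nn_integral_count_space_finite)
      also have "\<dots> \<le> I"
        unfolding I_def by (subst nn_integral_count_space_indicator) (auto intro!: nn_integral_mono split: split_indicator)
      finally have "ennreal (real k * (c / 2) powr a) \<le> I" .
      then have "real k * (c / 2) powr a \<le> enn2real I"
        using False by (cases I) auto
      then have "(real k * (c / 2) powr a) powr (1 / a) \<le> enn2real I powr (1 / a)"
        using a by (intro powr_mono2) auto
      also have "(real k * (c / 2) powr a) powr (1 / a) = real k powr (1 / a) * (c / 2)"
        using a c by (simp add: powr_mult powr_powr)
      finally show ?thesis using False by (simp add: L ennreal_powr_def ennreal_leI)
    qed
  qed
  then show ?thesis
    using a by (auto simp: schatten_norm_def intro!: INF_greatest)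
qed

lemma schatten_norm_gauss_weight_ge:
  obtains c where "c > 0" "\<And>a k. a \<ge> 1 \<Longrightarrow> k \<ge> 1 \<Longrightarrow> ennreal (c * real k powr (1 / a)) \<le>
     schatten_norm (ennreal a) lborel (sandwiched_TS (gauss_weight (real k) :: real \<times> (real ^ 'n) \<Rightarrow> complex))"
proof -
  obtain c where c: "c > 0" "\<And>N j. j < N \<Longrightarrow>
    c \<le> Re (l2_inner lborel (weighted_restriction (gauss_weight (real N)) (slab_fun j))
         (weighted_restriction (gauss_weight (real N)) (slab_fun j :: real \<times> (real ^ 'n) \<Rightarrow> complex)))"
    using slab_energy_ge by blast
  have "ennreal (c / 2 * real k powr (1 / a)) \<le>
     schatten_norm (ennreal a) lborel (sandwiched_TS (gauss_weight (real k) :: real \<times> (real ^ 'n) \<Rightarrow> complex))"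
    if a: "a \<ge> 1" and k: "k \<ge> 1" for a k
  proof -
    let ?W = "gauss_weight (real k) :: real \<times> (real ^ 'n) \<Rightarrow> complex"
    obtain B K where "gram_operator (lborel :: (real \<times> (real ^ 'n)) measure) (lborel :: (real ^ 'n) measure) (weighted_restriction ?W) B K"
      using restr_gram_operator[of "real k"] k by auto
    then interpret G: gram_operator "lborel :: (real \<times> (real ^ 'n)) measure" "lborel :: (real ^ 'n) measure" "weighted_restriction ?W" B K .
    have "G.gram = sandwiched_TS ?W" by (simp add: fun_eq_iff G.gram_def sandwiched_TS_def)
    then show ?thesis
      using G.schatten_norm_ge[OF a c(1) slab_fun_orthonormal c(2)] by (simp add: mult.commute)
  qed
  then show ?thesis using that[of "c / 2"] c(1) by simp
qed

section \<open>Comparison of the growth rates\<close>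
lemma powr_growth_comparison:
  fixes s e B :: real
  assumes "\<And>k::nat. k \<ge> 1 \<Longrightarrow> real k powr s \<le> B * real k powr e"
  shows "s \<le> e"
proof (rule ccontr)
  assume "\<not> s \<le> e"
  then have se: "s - e > 0" by simp
  have B: "real k powr (s - e) \<le> B" if "k \<ge> 1" for k
  proof -
    have "real k powr (s - e) = real k powr s / real k powr e" by (rule powr_diff)
    also have "\<dots> \<le> B" using assms[OF that] that by (simp add: divide_le_eq)
    finally show ?thesis .
  qed
  have B1: "B \<ge> 1" using B[of 1] by simp
  define k where "k = nat \<lceil>(B + 1) powr (1 / (s - e))\<rceil>"
  have k: "(B + 1) powr (1 / (s - e)) \<le> real k" unfolding k_def by (rule real_nat_ceiling_ge)
  have "(B + 1) powr (1 / (s - e)) > 0" using B1 by simp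
  then have "k \<ge> 1" using k by (cases k) auto
  have "B + 1 = ((B + 1) powr (1 / (s - e))) powr (s - e)" using se B1 by (simp add: powr_powr)
  also have "\<dots> \<le> real k powr (s - e)" using k se by (intro powr_mono2) auto
  finally show False using B[OF \<open>k \<ge> 1\<close>] by simp
qed

theorem proposition3:
  fixes p q \<alpha> :: ennreal and C :: real
  assumes "1 \<le> p" and "1 \<le> q"
    and "2 / p + of_nat CARD('n::finite) / q = 1"
    and "1 \<le> \<alpha>" and "0 < C"
    and "\<And>W :: real \<times> (real ^ 'n) \<Rightarrow> complex. schwartz W \<Longrightarrow>
           schatten_norm \<alpha> lborel (sandwiched_TS W) \<le> ennreal C * (mixed_norm p q W)\<^sup>2"
  shows "(if q = \<infinity> then 1 else q / (q - of_nat CARD('n))) \<le> \<alpha>"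
proof (cases "q = \<infinity> \<or> \<alpha> = \<infinity>")
  case True
  then show ?thesis using assms(4) by auto
next
  case False
  then obtain Q a where q: "q = ennreal Q" "Q \<ge> 0" and \<alpha>: "\<alpha> = ennreal a" "a \<ge> 0"
    by (cases q; cases \<alpha>) auto
  have Q1: "Q \<ge> 1" using assms(2) q by (simp flip: ennreal_1)
  have a1: "a \<ge> 1" using assms(4) \<alpha> by (simp flip: ennreal_1)
  obtain c where c: "c > 0" "\<And>a k. a \<ge> 1 \<Longrightarrow> k \<ge> 1 \<Longrightarrow> ennreal (c * real k powr (1 / a)) \<le>
     schatten_norm (ennreal a) lborel (sandwiched_TS (gauss_weight (real k) :: real \<times> (real ^ 'n) \<Rightarrow> complex))"
    using schatten_norm_gauss_weight_ge by blast
  obtain D where D: "D > 0"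
    "\<And>P N. P \<ge> 1 \<Longrightarrow> N \<ge> 1 \<Longrightarrow>
       mixed_norm (ennreal P) (ennreal Q) (gauss_weight N :: real \<times> (real ^ 'n) \<Rightarrow> complex)
         = ennreal (D * (\<integral>t. exp (- (P * t\<^sup>2)) \<partial>lborel) powr (1 / P) * N powr (1 / P))"
    "\<And>N. mixed_norm \<infinity> (ennreal Q) (gauss_weight N :: real \<times> (real ^ 'n) \<Rightarrow> complex) \<le> ennreal D"
    using mixed_norm_gauss_weight_le[OF Q1] by blast
  have exponent: "1 / a \<le> 2 * e"
    if E: "E \<ge> 0" "\<And>k::nat. k \<ge> 1 \<Longrightarrow>
      mixed_norm p q (gauss_weight (real k) :: real \<times> (real ^ 'n) \<Rightarrow> complex) \<le> ennreal (E * real k powr e)" for E e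
  proof (rule powr_growth_comparison)
    fix k :: nat assume k: "k \<ge> 1"
    let ?W = "gauss_weight (real k) :: real \<times> (real ^ 'n) \<Rightarrow> complex"
    have "ennreal (c * real k powr (1 / a)) \<le> schatten_norm \<alpha> lborel (sandwiched_TS ?W)"
      using c(2)[OF a1 k] by (simp add: \<alpha>)
    also have "\<dots> \<le> ennreal C * (mixed_norm p q ?W)\<^sup>2"
      using k by (intro assms(6) schwartz_gauss_weight) simp
    also have "\<dots> \<le> ennreal C * (ennreal (E * real k powr e))\<^sup>2"
      using E(2)[OF k] by (intro mult_left_mono power_mono) auto
    also have "(ennreal (E * real k powr e))\<^sup>2 = ennreal ((E * real k powr e)\<^sup>2)"
      using E(1) by (intro ennreal_power) simp
    also have "ennreal C * \<dots> = ennreal (C * (E * real k powr e)\<^sup>2)"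
      using assms(5) by (intro ennreal_mult[symmetric]) auto
    finally have "c * real k powr (1 / a) \<le> C * (E * real k powr e)\<^sup>2"
      using assms(5) by (subst (asm) ennreal_le_iff) simp_all
    also have "(E * real k powr e)\<^sup>2 = E\<^sup>2 * real k powr (2 * e)"
    proof -
      have "(real k powr e)\<^sup>2 = real k powr (2 * e)"
        unfolding power2_eq_square mult_2 by (rule powr_add[symmetric])
      then show ?thesis by (simp add: power_mult_distrib)
    qed
    finally show "real k powr (1 / a) \<le> (C * E\<^sup>2 / c) * real k powr (2 * e)"
      using c(1) by (simp add: field_simps)
  qed
  have "p \<noteq> \<infinity>"
  proof
    assume "p = \<infinity>"
    then have "1 / a \<le> 2 * 0" using D(1,3) q by (intro exponent[of D]) auto
    then show False using a1 by simp
  qed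
  then obtain P where p: "p = ennreal P" "P \<ge> 0" by (cases p) auto
  have P1: "P \<ge> 1" using assms(1) p by (simp flip: ennreal_1)
  define J where "J = (\<integral>t. exp (- (P * t\<^sup>2)) \<partial>lborel) powr (1 / P)"
  have "1 / a \<le> 2 * (1 / P)"
    using D(1) D(2)[OF P1] by (intro exponent[of "D * J"]) (auto simp: p q J_def)
  then have aP: "P / 2 \<le> a" using a1 P1 by (simp add: field_simps)
  define d where "d = real CARD('n)"
  have d: "(of_nat CARD('n) :: ennreal) = ennreal d" by (simp add: d_def ennreal_of_nat_eq_real_of_nat)
  have d0: "d > 0" by (simp add: d_def)
  have "2 / p + of_nat CARD('n) / q = ennreal (2 / P + d / Q)"
    using P1 Q1 d0 by (simp add: p q d divide_ennreal flip: ennreal_numeral ennreal_plus)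
  then have "ennreal (2 / P + d / Q) = ennreal 1" using assms(3) by (simp only: ennreal_1)
  then have sum1: "2 / P + d / Q = 1" using P1 Q1 d0 by (subst (asm) ennreal_inj) simp_all
  then have "Q > d" using P1 Q1 by (smt (verit) divide_pos_pos divide_less_eq_1)
  have eq: "Q / (Q - d) = P / 2" using sum1 \<open>Q > d\<close> P1 Q1 by (simp add: field_simps)
  have "q / (q - of_nat CARD('n)) = ennreal (Q / (Q - d))"
    using \<open>Q > d\<close> d0 Q1 by (simp add: q d ennreal_minus divide_ennreal)
  also have "\<dots> = ennreal (P / 2)" by (simp only: eq)
  finally have "q / (q - of_nat CARD('n)) = ennreal (P / 2)" .
  then show ?thesis using False aP \<alpha> by (simp add: ennreal_leI)
qed

end
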